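(* When $\varepsilon<\varepsilon_0$ (with $\varepsilon_0$ and $W^0$ as in the context) is so small that $\sup_{\theta\in\mathbb T}|W^0_2(\theta)|<\frac12$, the equation $$\dot x(t)=X\big(x(t),\varepsilon x(t-r(x(t)))\big)$$ admits a limit cycle close to the limit cycle of the unperturbed equation $\dot x=X(x,0)$. If $\omega$, $W^0$ solve the invariance equation $$\omega \frac{d}{d\theta}W^0(\theta)-\begin{pmatrix}\omega_0\\ \lambda_0W^0_2(\theta)\end{pmatrix}=\varepsilon\, Y\big(W^0(\theta),\,W^0(\theta-\omega\, r(K(W^0(\theta)))),\,\varepsilon\big),$$ then $K\circ W^0(\theta)$ gives a parameterization of the limit cycle of the delay equation, i.e. for any $\theta$, $K\circ W^0(\theta+\omega t)$ solves the delay equation for all $t$.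
   Context: Setting. $\mathbb T=\mathbb R/\mathbb Z$, $\mathbb R_+=[0,\infty)$, $\varepsilon\ge0$. $X:\mathbb R^2\times\mathbb R^2\to\mathbb R^2$ is analytic, $X_0(x)=X(x,0)$, and the planar ODE $\dot x=X_0(x)$ has a (stable) limit cycle; $r:\mathbb R^2\to[0,h]$ is as smooth as needed. Given data: $\omega_0>0$, $\lambda_0<0$ and an analytic local diffeomorphism $K:\mathbb T\times[-1,1]\to\mathbb R^2$ with $X_0(K(\theta,s))=DK(\theta,s)(\omega_0,\lambda_0 s)^T$; $\theta\mapsto K(\theta,0)$ parameterizes the limit cycle. $P$ is defined by $\varepsilon P(x,y,\varepsilon)=X(x,\varepsilon y)-X(x,0)$, and $Y(u,v,\varepsilon)=(DK(u))^{-1}P(K(u),K(v),\varepsilon)$ for $u,v\in\mathbb T\times[-1,1]$. $\phi:\mathbb R\to[0,1]$ is $C^\infty$ with $\phi(x)=1$ for $|x|\le\frac12$ and $\phi(x)=0$ for $|x|>1$. Put $\rho(\theta,s)=r(K(\theta,s))\phi(s)$ (zero for $|s|>1$) and $\overline Y(u,v,\varepsilon)=Y(u,v,\varepsilon)\phi(u_2)\phi(v_2)$ (zero if $|u_2|>1$ or $|v_2|>1$); these have bounded derivatives up to any order. Subscripts on vectors denote components. The number $\varepsilon_0$ and the function $W^0$. Background result (not part of the claim): for a given integer $L>0$ there is $\varepsilon_0>0$ such that for $0\le\varepsilon<\varepsilon_0$ there exist $\omega>0$ and an $L$ times differentiable $W^0:\mathbb T\to\mathbb T\times\mathbb R$ with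 Lipschitz $L$-th derivative, whose lift satisfies $W^0(\theta+1)=W^0(\theta)+(1,0)^T$, solving the equation with cut-offs $\omega\frac{d}{d\theta}W^0-(\omega_0,\lambda_0W^0_2)^T=\varepsilon\overline Y\big(W^0(\theta),W^0(\theta-\omega\rho(W^0(\theta))),\varepsilon\big)$. When $\sup_\theta|W^0_2|<\frac12$ this equation coincides with the cut-off-free equation displayed in the claim.
   Formalization: A periodic orbit is shown whenever sup|W^0_2|<1/2; that it is isolated (a limit cycle) and within distance η of the unperturbed cycle is claimed only for ε below some δ>0 depending on η, since isolation can fail for larger ε<ε_0. *)

theory Defs
  imports "HOL-Analysis.Analysis"
begin

(* Conventions.  The plane is real^2.  The cylinder T x R is replaced by its universal cover
   real * real (angle, radial variable); T-periodicity is stated explicitly, and a map of the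
   circle into the cylinder is given by a lift W with W (theta + 1) = W theta + (1, 0). *)

(* Power series in several variables: a multi-index is a function from Basis to nat,
   and for finite-dimensional values has_sum is absolute convergence. *)
definition real_analytic_at ::
  "('a::euclidean_space \<Rightarrow> 'b::real_normed_vector) \<Rightarrow> 'a \<Rightarrow> bool" where
  "real_analytic_at f a \<longleftrightarrow>
     (\<exists>(c :: ('a \<Rightarrow> nat) \<Rightarrow> 'b) R. R > 0 \<and>
        (\<forall>x\<in>ball a R.
           ((\<lambda>\<alpha>. (\<Prod>b\<in>Basis. ((x - a) \<bullet> b) ^ \<alpha> b) *\<^sub>R c \<alpha>) has_sum f x)
             (Basis \<rightarrow>\<^sub>E (UNIV :: nat set))))"

(* At each point of a non-open S the expansion holds on a full neighbourhood, i.e. the function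
   is analytic on an open set containing S. *)
definition real_analytic_on ::
  "('a::euclidean_space \<Rightarrow> 'b::real_normed_vector) \<Rightarrow> 'a set \<Rightarrow> bool" where
  "real_analytic_on f S \<longleftrightarrow> (\<forall>a\<in>S. real_analytic_at f a)"

definition local_diffeo_on ::
  "('a::euclidean_space \<Rightarrow> 'b::euclidean_space) \<Rightarrow> 'a set \<Rightarrow> bool" where
  "local_diffeo_on f S \<longleftrightarrow>
     (\<forall>a\<in>S. \<exists>U V g. open U \<and> a \<in> U \<and> open V \<and> homeomorphism U V f g \<and>
                 f differentiable_on U \<and> g differentiable_on V)"

definition smooth_real :: "(real \<Rightarrow> real) \<Rightarrow> bool" where
  "smooth_real f \<longleftrightarrow> (\<forall>n x. (deriv ^^ n) f differentiable (at x))"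

definition C1_map :: "('a::euclidean_space \<Rightarrow> 'b::real_normed_vector) \<Rightarrow> bool" where
  "C1_map f \<longleftrightarrow> (\<forall>x. f differentiable (at x)) \<and>
     (\<forall>v. continuous_on UNIV (\<lambda>x. frechet_derivative f (at x) v))"

definition vderiv :: "(real \<Rightarrow> 'a::real_normed_vector) \<Rightarrow> real \<Rightarrow> 'a" where
  "vderiv f t = vector_derivative f (at t)"

definition times_diff_Lipschitz :: "nat \<Rightarrow> (real \<Rightarrow> 'a::real_normed_vector) \<Rightarrow> bool" where
  "times_diff_Lipschitz L f \<longleftrightarrow>
     (\<forall>k<L. \<forall>t. (vderiv ^^ k) f differentiable (at t)) \<and>
     (\<exists>C. C-lipschitz_on UNIV ((vderiv ^^ L) f))"

definition ode_solution :: "(real^2 \<Rightarrow> real^2) \<Rightarrow> (real \<Rightarrow> real^2) \<Rightarrow> bool" where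
  "ode_solution f x \<longleftrightarrow> (\<forall>t. (x has_vector_derivative f (x t)) (at t))"

definition dde_solution ::
  "((real^2) \<times> (real^2) \<Rightarrow> real^2) \<Rightarrow> (real^2 \<Rightarrow> real) \<Rightarrow> real \<Rightarrow> (real \<Rightarrow> real^2) \<Rightarrow> bool" where
  "dde_solution X r \<epsilon> x \<longleftrightarrow>
     (\<forall>t. (x has_vector_derivative X (x t, \<epsilon> *\<^sub>R x (t - r (x t)))) (at t))"

(* sol is the predicate of being a solution on the whole real line, so that the ODE and the
   delay equation share one notion of closed orbit and of limit cycle.  Closed orbits are regarded
   as subsets of the plane, also for the delay equation. *)
definition closed_orbit :: "((real \<Rightarrow> real^2) \<Rightarrow> bool) \<Rightarrow> (real^2) set \<Rightarrow> bool" where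
  "closed_orbit sol \<Gamma> \<longleftrightarrow>
     (\<exists>x p. sol x \<and> p > 0 \<and> (\<forall>t. x (t + p) = x t) \<and> (\<exists>s t. x s \<noteq> x t) \<and> \<Gamma> = range x)"

definition limit_cycle :: "((real \<Rightarrow> real^2) \<Rightarrow> bool) \<Rightarrow> (real^2) set \<Rightarrow> bool" where
  "limit_cycle sol \<Gamma> \<longleftrightarrow> closed_orbit sol \<Gamma> \<and>
     (\<exists>U. open U \<and> \<Gamma> \<subseteq> U \<and> (\<forall>\<Gamma>'. closed_orbit sol \<Gamma>' \<and> \<Gamma>' \<subseteq> U \<longrightarrow> \<Gamma>' = \<Gamma>))"

definition ode_forward_solution :: "(real^2 \<Rightarrow> real^2) \<Rightarrow> (real \<Rightarrow> real^2) \<Rightarrow> bool" where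
  "ode_forward_solution f x \<longleftrightarrow>
     (\<forall>t\<ge>0. (x has_vector_derivative f (x t)) (at t within {0..}))"

definition ode_stable_set :: "(real^2 \<Rightarrow> real^2) \<Rightarrow> (real^2) set \<Rightarrow> bool" where
  "ode_stable_set f \<Gamma> \<longleftrightarrow>
     (\<forall>V. open V \<and> \<Gamma> \<subseteq> V \<longrightarrow>
        (\<exists>U. open U \<and> \<Gamma> \<subseteq> U \<and>
           (\<forall>x. ode_forward_solution f x \<and> x 0 \<in> U \<longrightarrow> (\<forall>t\<ge>0. x t \<in> V)))) \<and>
     (\<exists>U. open U \<and> \<Gamma> \<subseteq> U \<and>
        (\<forall>x. ode_forward_solution f x \<and> x 0 \<in> U \<longrightarrow> ((\<lambda>t. infdist (x t) \<Gamma>) \<longlongrightarrow> 0) at_top))"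

definition Hausdorff_close :: "real \<Rightarrow> 'a::metric_space set \<Rightarrow> 'a set \<Rightarrow> bool" where
  "Hausdorff_close \<eta> A B \<longleftrightarrow> (\<forall>a\<in>A. infdist a B < \<eta>) \<and> (\<forall>b\<in>B. infdist b A < \<eta>)"

abbreviation strip :: "(real \<times> real) set" where
  "strip \<equiv> UNIV \<times> {-1..1}"

(* epsilon * P(x,y,epsilon) = X(x,epsilon*y) - X(x,0); at epsilon = 0 the value is the limit. *)
definition P_fun ::
  "((real^2) \<times> (real^2) \<Rightarrow> real^2) \<Rightarrow> real^2 \<Rightarrow> real^2 \<Rightarrow> real \<Rightarrow> real^2" where
  "P_fun X x y \<epsilon> =
     (if \<epsilon> = 0 then frechet_derivative (\<lambda>z. X (x, z)) (at 0) y
      else (1 / \<epsilon>) *\<^sub>R (X (x, \<epsilon> *\<^sub>R y) - X (x, 0)))"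

definition Y_fun ::
  "((real^2) \<times> (real^2) \<Rightarrow> real^2) \<Rightarrow> (real \<times> real \<Rightarrow> real^2) \<Rightarrow>
   real \<times> real \<Rightarrow> real \<times> real \<Rightarrow> real \<Rightarrow> real \<times> real" where
  "Y_fun X K u v \<epsilon> = inv (frechet_derivative K (at u)) (P_fun X (K u) (K v) \<epsilon>)"

definition rho_cut ::
  "(real^2 \<Rightarrow> real) \<Rightarrow> (real \<times> real \<Rightarrow> real^2) \<Rightarrow> (real \<Rightarrow> real) \<Rightarrow> real \<times> real \<Rightarrow> real" where
  "rho_cut r K \<phi> u = (if \<bar>snd u\<bar> > 1 then 0 else r (K u) * \<phi> (snd u))"

definition Y_cut ::
  "((real^2) \<times> (real^2) \<Rightarrow> real^2) \<Rightarrow> (real \<times> real \<Rightarrow> real^2) \<Rightarrow> (real \<Rightarrow> real) \<Rightarrow>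
   real \<times> real \<Rightarrow> real \<times> real \<Rightarrow> real \<Rightarrow> real \<times> real" where
  "Y_cut X K \<phi> u v \<epsilon> =
     (if \<bar>snd u\<bar> > 1 \<or> \<bar>snd v\<bar> > 1 then 0
      else (\<phi> (snd u) * \<phi> (snd v)) *\<^sub>R Y_fun X K u v \<epsilon>)"

definition circle_lift :: "(real \<Rightarrow> real \<times> real) \<Rightarrow> bool" where
  "circle_lift W \<longleftrightarrow> (\<forall>\<theta>. W (\<theta> + 1) = W \<theta> + (1, 0))"

definition invariance_eq ::
  "((real^2) \<times> (real^2) \<Rightarrow> real^2) \<Rightarrow> (real^2 \<Rightarrow> real) \<Rightarrow> (real \<times> real \<Rightarrow> real^2) \<Rightarrow>
   real \<Rightarrow> real \<Rightarrow> real \<Rightarrow> real \<Rightarrow> (real \<Rightarrow> real \<times> real) \<Rightarrow> bool" where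
  "invariance_eq X r K \<omega>\<^sub>0 lam\<^sub>0 \<epsilon> \<omega> W \<longleftrightarrow>
     (\<forall>\<theta>. \<omega> *\<^sub>R vderiv W \<theta> - (\<omega>\<^sub>0, lam\<^sub>0 * snd (W \<theta>)) =
           \<epsilon> *\<^sub>R Y_fun X K (W \<theta>) (W (\<theta> - \<omega> * r (K (W \<theta>)))) \<epsilon>)"

definition invariance_eq_cut ::
  "((real^2) \<times> (real^2) \<Rightarrow> real^2) \<Rightarrow> (real^2 \<Rightarrow> real) \<Rightarrow> (real \<times> real \<Rightarrow> real^2) \<Rightarrow>
   (real \<Rightarrow> real) \<Rightarrow> real \<Rightarrow> real \<Rightarrow> real \<Rightarrow> real \<Rightarrow> (real \<Rightarrow> real \<times> real) \<Rightarrow> bool" where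
  "invariance_eq_cut X r K \<phi> \<omega>\<^sub>0 lam\<^sub>0 \<epsilon> \<omega> W \<longleftrightarrow>
     (\<forall>\<theta>. \<omega> *\<^sub>R vderiv W \<theta> - (\<omega>\<^sub>0, lam\<^sub>0 * snd (W \<theta>)) =
           \<epsilon> *\<^sub>R Y_cut X K \<phi> (W \<theta>) (W (\<theta> - \<omega> * rho_cut r K \<phi> (W \<theta>))) \<epsilon>)"

end

theory Submission
  imports Defs
begin

text \<open>
  In the coordinates \<open>K\<close> the delay equation reads \<open>u' = (\<omega>\<^sub>0, lam\<^sub>0 u\<^sub>2) + H \<epsilon> (u(t), u(t - r(K(u(t)))))\<close>,
  where \<open>H \<epsilon>\<close> and its Lipschitz constant are of order \<open>\<epsilon>\<close>.  The invariance equation says exactly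
  that \<open>t \<mapsto> W(\<theta> + \<omega> t)\<close> solves it, which gives the closed orbit, and boundedness of the second
  component forces \<open>W\<^sub>2 = O(\<epsilon>)\<close>, which gives closeness to the unperturbed cycle.

  The orbit is isolated because, for small \<open>\<epsilon>\<close>, a solution on the whole line that stays in the strip
  is determined by the angle at time \<open>0\<close>: the difference of two such solutions with equal initial
  angle, measured with the weight \<open>exp (- \<mu> \<bar>t\<bar>)\<close>, is contracted by the integral equations for the two
  components (forward from \<open>0\<close> for the angle, from \<open>- \<infinity>\<close> for the contracting direction).
  To apply this, a closed orbit near the cycle has to be lifted to the strip.  The unperturbed flow
  shows that \<open>K\<close> takes no value on the cycle at a point off the central line, so over a thin tube \<open>K\<close> is a
  covering map, although it need not be injective on the cylinder.
\<close>

section \<open>Power series are continuously differentiable with Lipschitz derivative\<close>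

text \<open>All that is taken from analyticity is differentiability with a locally Lipschitz
  derivative. \<open>H\<close> calls for it twice: in the current state its Lipschitz constant is of
  order \<open>\<epsilon>\<close> because the derivative of \<open>X\<close> in that state changes
  only by O(\<epsilon>) when the second argument moves from 0 to \<epsilon> y, and the inverse of
  \<open>DK\<close> must itself be Lipschitz. Trajectories of a delay equation may cross in the
  plane, so planar ODE arguments give no isolation. Among solutions defined for all times,
  boundedness in the infinite past replaces the initial datum in the radial direction. The angular
  difference of two such solutions is not bounded a priori, but grows at most linearly, and the
  exponential weight absorbs this. Evaluating the weight at a delayed time costs the factor exp
  (\<mu> h), where the bound on the delay enters; the dependence of the delay on the state costs a
  further term, controlled by the speed of solutions. The isolating tube is built from
  \<open>K\<close> alone, before \<open>\<epsilon>\<close> is chosen, so one threshold serves all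
  invariant curves.\<close>

lemma power_bounds_half:
  fixes s t :: real and n :: nat
  assumes t: "\<bar>t\<bar> \<le> 1/2" and s: "\<bar>s\<bar> \<le> 1/2"
  shows "\<bar>t ^ n\<bar> \<le> 1" "\<bar>t ^ n - s ^ n\<bar> \<le> \<bar>t - s\<bar>"
    "\<bar>real n * t ^ (n - 1)\<bar> \<le> 1" "\<bar>real n * t ^ (n - 1) - real n * s ^ (n - 1)\<bar> \<le> 4 * \<bar>t - s\<bar>"
proof -
  have half: "\<bar>x ^ k\<bar> \<le> (1/2) ^ k" if "\<bar>x\<bar> \<le> 1/2" for x :: real and k
    using power_mono[OF that, of k] by (simp add: power_abs)
  have lip: "\<bar>t ^ k - s ^ k\<bar> \<le> real k * (1/2) ^ (k - 1) * \<bar>t - s\<bar>" for k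
  proof -
    have "norm (t ^ k - s ^ k) \<le> (real k * (1/2) ^ (k - 1)) * norm (t - s)"
    proof (rule field_differentiable_bound[where S = "cball 0 (1/2)" and f = "\<lambda>x. x ^ k"
          and f' = "\<lambda>x. real k * x ^ (k - 1)"])
      fix z :: real assume z: "z \<in> cball 0 (1/2)"
      show "((\<lambda>x. x ^ k) has_field_derivative real k * z ^ (k - 1)) (at z within cball 0 (1/2))"
        by (auto intro!: derivative_eq_intros)
      show "norm (real k * z ^ (k - 1)) \<le> real k * (1/2) ^ (k - 1)"
        using half[of z "k - 1"] z by (auto simp: abs_mult intro!: mult_left_mono)
    qed (use t s in auto)
    then show ?thesis by simp
  qed
  have n1: "real n * (1/2) ^ (n - 1) \<le> 1" for n
  proof (cases n)
    case (Suc m)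
    have "real (Suc m) \<le> 2 ^ m"
      by (induction m) auto
    then show ?thesis using Suc by (simp add: power_one_over field_simps)
  qed simp
  \<comment> \<open>This bounds the second derivative of the power on the interval. The true maximum
    is 3, at n = 3 and n = 4; with 4 a plain induction goes through.\<close>
  have n2: "real n * (real (n - 1) * (1/2) ^ (n - 1 - 1)) \<le> 4" for n
  proof -
    consider "n = 0" | "n = 1" | m where "n = m + 2"
      by (metis One_nat_def Suc_eq_plus1 add_2_eq_Suc' not0_implies_Suc)
    then show ?thesis
    proof cases
      case (3 m)
      have "real (m + 2) * real (m + 1) \<le> 4 * 2 ^ m"
      proof (induction m)
        case (Suc m)
        have e: "real (k + 2) \<le> 2 * 2 ^ k" for k
          by (induction k) auto
        show ?case
        proof (cases m)
          case (Suc k)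
          have "real (Suc m + 2) * real (Suc m + 1)
              = real (m + 2) * real (m + 1) + 2 * real (m + 2)"
            by (simp add: algebra_simps)
          also have "\<dots> \<le> 4 * 2 ^ m + 4 * 2 ^ m"
            using Suc.IH e[of m] by simp
          finally show ?thesis by simp
        qed simp
      qed simp
      then show ?thesis using 3 by (simp add: power_one_over field_simps)
    qed auto
  qed
  have "(1/2::real) ^ n \<le> 1" by (simp add: power_le_one)
  with half[OF t, of n] show "\<bar>t ^ n\<bar> \<le> 1" by linarith
  have "real n * (1/2) ^ (n - 1) * \<bar>t - s\<bar> \<le> 1 * \<bar>t - s\<bar>"
    by (rule mult_right_mono[OF n1]) simp
  with lip[of n] show "\<bar>t ^ n - s ^ n\<bar> \<le> \<bar>t - s\<bar>" by (metis mult_1 order_trans)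
  have "\<bar>real n * t ^ (n - 1)\<bar> \<le> real n * (1/2) ^ (n - 1)"
    using half[OF t, of "n - 1"] by (auto simp: abs_mult intro!: mult_left_mono)
  with n1[of n] show "\<bar>real n * t ^ (n - 1)\<bar> \<le> 1" by linarith
  have "\<bar>real n * t ^ (n - 1) - real n * s ^ (n - 1)\<bar> = real n * \<bar>t ^ (n - 1) - s ^ (n - 1)\<bar>"
    by (simp add: abs_mult flip: right_diff_distrib)
  also have "\<dots> \<le> real n * (real (n - 1) * (1/2) ^ (n - 1 - 1) * \<bar>t - s\<bar>)"
    by (intro mult_left_mono lip) simp
  also have "\<dots> = real n * (real (n - 1) * (1/2) ^ (n - 1 - 1)) * \<bar>t - s\<bar>"
    by simp
  also have "\<dots> \<le> 4 * \<bar>t - s\<bar>"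
    by (rule mult_right_mono[OF n2]) simp
  finally show "\<bar>real n * t ^ (n - 1) - real n * s ^ (n - 1)\<bar> \<le> 4 * \<bar>t - s\<bar>" .
qed

definition monom_fun :: "('a::euclidean_space \<Rightarrow> nat) \<Rightarrow> 'a \<Rightarrow> real" where
  "monom_fun \<alpha> z = (\<Prod>b\<in>Basis. (z \<bullet> b) ^ \<alpha> b)"

text \<open>The shape is that of the product rule \<open>has_derivative_prod\<close>. For \<alpha> b
  = 0 the truncated exponent is harmless, because the factor in front vanishes.\<close>

definition monom_deriv :: "('a::euclidean_space \<Rightarrow> nat) \<Rightarrow> 'a \<Rightarrow> 'a \<Rightarrow> real" where
  "monom_deriv \<alpha> z h =
     (\<Sum>b\<in>Basis. (real (\<alpha> b) * (h \<bullet> b) * (z \<bullet> b) ^ (\<alpha> b - 1)) * (\<Prod>j\<in>Basis - {b}. (z \<bullet> j) ^ \<alpha> j))"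

lemma monom_fun_has_derivative: "(monom_fun \<alpha> has_derivative monom_deriv \<alpha> z) (at z)"
  unfolding monom_fun_def[abs_def] monom_deriv_def[abs_def]
  by (rule has_derivative_prod, rule has_derivative_power, rule has_derivative_inner_left,
      rule has_derivative_ident)

definition half_cube :: "'a::euclidean_space set" where
  "half_cube = {z. \<forall>b\<in>Basis. \<bar>z \<bullet> b\<bar> < 1/2}"

lemma half_cube_eq_box: "half_cube = box (- (1/2) *\<^sub>R One) ((1/2) *\<^sub>R (One::'a::euclidean_space))"
  by (auto simp: half_cube_def box_def abs_less_iff)

lemma half_cube_coord: "z \<in> half_cube \<Longrightarrow> b \<in> Basis \<Longrightarrow> \<bar>z \<bullet> b\<bar> \<le> 1/2"
  by (auto simp: half_cube_def intro: less_imp_le)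

text \<open>The constants must not depend on the multi-index. On the half cube they do not: powers
  of 1/2 decay faster than the exponents that differentiation brings down. In the second bound, 4
  accounts for the variation of the differentiated factor and the inner \<open>DIM('a)\<close> for
  that of the remaining product; the outer one counts the partial derivatives.\<close>

lemma monom_deriv_bounds:
  fixes z w h :: "'a::euclidean_space"
  assumes z: "z \<in> half_cube" and w: "w \<in> half_cube"
  shows "\<bar>monom_deriv \<alpha> z h\<bar> \<le> DIM('a) * norm h"
    and "\<bar>monom_deriv \<alpha> z h - monom_deriv \<alpha> w h\<bar>
      \<le> real DIM('a) * (4 + real DIM('a)) * norm (z - w) * norm h"
proof -
  define p where "p v b = real (\<alpha> b) * (v \<bullet> b) ^ (\<alpha> b - 1)" for v b :: 'a
  define q where "q v b = (\<Prod>j\<in>Basis - {b}. (v \<bullet> j) ^ \<alpha> j)" for v b :: 'a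
  have eq: "monom_deriv \<alpha> v h = (\<Sum>b\<in>Basis. (h \<bullet> b) * (p v b * q v b))" for v
    by (simp add: monom_deriv_def p_def q_def mult_ac)
  have p1: "\<bar>p v b\<bar> \<le> 1" if "v \<in> half_cube" "b \<in> Basis" for v b
    unfolding p_def using power_bounds_half(3) half_cube_coord[OF that] by blast
  have q1: "\<bar>q v b\<bar> \<le> 1" if "v \<in> half_cube" "b \<in> Basis" for v b
    unfolding q_def abs_prod
    by (rule prod_le_1) (use power_bounds_half(1) half_cube_coord[OF that(1)] in auto)
  have pw: "\<bar>(v \<bullet> b) ^ n\<bar> \<le> 1" if "v \<in> half_cube" "b \<in> Basis" for v b :: 'a and n
    using power_bounds_half(1) half_cube_coord[OF that] by blast
  have dz: "\<bar>z \<bullet> b - w \<bullet> b\<bar> \<le> norm (z - w)" if "b \<in> Basis" for b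
    using Basis_le_norm[OF that, of "z - w"] by (simp add: inner_diff_left)
  have p2: "\<bar>p z b - p w b\<bar> \<le> 4 * norm (z - w)" if "b \<in> Basis" for b
    unfolding p_def
    using power_bounds_half(4)[OF half_cube_coord[OF z that] half_cube_coord[OF w that]] dz[OF that]
    by (meson mult_left_mono order_trans zero_le_numeral)
  have q2: "\<bar>q z b - q w b\<bar> \<le> DIM('a) * norm (z - w)" if "b \<in> Basis" for b
  proof -
    have "norm (q z b - q w b) \<le> (\<Sum>j\<in>Basis - {b}. norm ((z \<bullet> j) ^ \<alpha> j - (w \<bullet> j) ^ \<alpha> j))"
      unfolding q_def
    by (rule norm_prod_diff) (use pw z w in auto)
    also have "\<dots> \<le> (\<Sum>j\<in>Basis - {b}. norm (z - w))"
    proof (rule sum_mono)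
      fix j assume "j \<in> (Basis::'a set) - {b}"
      then have j: "j \<in> Basis" by simp
      show "norm ((z \<bullet> j) ^ \<alpha> j - (w \<bullet> j) ^ \<alpha> j) \<le> norm (z - w)"
        using power_bounds_half(2)[OF half_cube_coord[OF z j] half_cube_coord[OF w j], of "\<alpha> j"] dz[OF j]
        by simp
    qed
    also have "\<dots> \<le> (\<Sum>j\<in>(Basis::'a set). norm (z - w))"
      by (intro sum_mono2) auto
    finally show ?thesis by simp
  qed
  have hb: "\<bar>h \<bullet> b\<bar> \<le> norm h" if "b \<in> Basis" for b
    using Basis_le_norm[OF that] .
  have "\<bar>monom_deriv \<alpha> z h\<bar> \<le> (\<Sum>b\<in>(Basis::'a set). norm h * 1)"
    unfolding eq
  proof (rule order_trans[OF sum_abs], rule sum_mono)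
    fix b :: 'a assume b: "b \<in> Basis"
    have "\<bar>p z b * q z b\<bar> \<le> 1 * 1"
      unfolding abs_mult by (rule mult_mono) (use p1[OF z b] q1[OF z b] in auto)
    then show "\<bar>(h \<bullet> b) * (p z b * q z b)\<bar> \<le> norm h * 1"
      unfolding abs_mult[of "h \<bullet> b"] by (intro mult_mono hb b) auto
  qed
  then show "\<bar>monom_deriv \<alpha> z h\<bar> \<le> DIM('a) * norm h" by simp
  have "\<bar>monom_deriv \<alpha> z h - monom_deriv \<alpha> w h\<bar>
      = \<bar>\<Sum>b\<in>Basis. (h \<bullet> b) * (p z b * q z b - p w b * q w b)\<bar>"
    unfolding eq by (simp add: right_diff_distrib sum_subtractf)
  also have "\<dots> \<le> (\<Sum>b\<in>(Basis::'a set). norm h * ((4 + DIM('a)) * norm (z - w)))"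
  proof (rule order_trans[OF sum_abs], rule sum_mono)
    fix b :: 'a assume b: "b \<in> Basis"
    have "\<bar>p z b * q z b - p w b * q w b\<bar> = \<bar>(p z b - p w b) * q z b + p w b * (q z b - q w b)\<bar>"
      by (simp add: algebra_simps)
    also have "\<dots> \<le> \<bar>p z b - p w b\<bar> * \<bar>q z b\<bar> + \<bar>p w b\<bar> * \<bar>q z b - q w b\<bar>"
      by (metis abs_mult abs_triangle_ineq)
    also have "\<dots> \<le> (4 * norm (z - w)) * 1 + 1 * (DIM('a) * norm (z - w))"
      by (intro add_mono mult_mono p1 p2 q1 q2 z w b) auto
    finally have "\<bar>p z b * q z b - p w b * q w b\<bar> \<le> (4 + DIM('a)) * norm (z - w)"
      by (simp add: algebra_simps)
    then show "\<bar>(h \<bullet> b) * (p z b * q z b - p w b * q w b)\<bar> \<le> norm h * ((4 + DIM('a)) * norm (z - w))"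
      unfolding abs_mult[of "h \<bullet> b"] by (intro mult_mono hb b) auto
  qed
  also have "\<dots> = real DIM('a) * (4 + real DIM('a)) * norm (z - w) * norm h"
    by simp
  finally show "\<bar>monom_deriv \<alpha> z h - monom_deriv \<alpha> w h\<bar>
      \<le> real DIM('a) * (4 + real DIM('a)) * norm (z - w) * norm h" .
qed

section \<open>Termwise differentiation of dominated unordered sums\<close>

lemma has_sum_diff:
  fixes f g :: "'i \<Rightarrow> 'a::topological_ab_group_add"
  assumes "(f has_sum a) I" "(g has_sum b) I"
  shows "((\<lambda>i. f i - g i) has_sum (a - b)) I"
  using has_sum_add[OF assms(1), of "\<lambda>i. - g i" "- b"] assms(2)
  by (simp add: has_sum_uminus)

lemma summable_on_sum:
  fixes f :: "'k \<Rightarrow> 'i \<Rightarrow> 'a::topological_ab_group_add"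
  assumes "finite B" "\<And>b. b \<in> B \<Longrightarrow> f b summable_on A"
  shows "(\<lambda>i. \<Sum>b\<in>B. f b i) summable_on A"
  using assms by (induction B rule: finite_induct) (auto intro!: summable_on_add)

lemma norm_has_sum_le_cmult:
  fixes A :: "'i \<Rightarrow> real"
  assumes "A summable_on I" "(g has_sum s) I" "\<And>i. i \<in> I \<Longrightarrow> norm (g i) \<le> A i * c"
  shows "norm s \<le> infsum A I * c"
  using norm_infsum_le[OF assms(2) has_sum_cmult_left assms(3)] assms(1) by auto

text \<open>A Lipschitz derivative makes the linearization error of each term at most A i times the
  squared increment. These errors can be summed, so the limit has a quadratic remainder with the
  summed derivative as linear part. No uniform convergence of difference quotients has to be
  discussed, and the Lipschitz bound passes to the sum in the same way.\<close>

lemma has_derivative_has_sum: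
  fixes f :: "'i \<Rightarrow> 'a::real_normed_vector \<Rightarrow> 'b::banach"
    and D :: "'i \<Rightarrow> 'a \<Rightarrow> 'a \<Rightarrow>\<^sub>L 'b"
  assumes S: "open S" "convex S"
    and D: "\<And>i x. i \<in> I \<Longrightarrow> x \<in> S \<Longrightarrow> (f i has_derivative D i x) (at x)"
    and bound: "\<And>i x. i \<in> I \<Longrightarrow> x \<in> S \<Longrightarrow> norm (D i x) \<le> A i"
    and Lip: "\<And>i x y. i \<in> I \<Longrightarrow> x \<in> S \<Longrightarrow> y \<in> S \<Longrightarrow> norm (D i x - D i y) \<le> A i * norm (x - y)"
    and A: "A summable_on I"
    and F: "\<And>x. x \<in> S \<Longrightarrow> ((\<lambda>i. f i x) has_sum F x) I"
  obtains DF where "\<And>x. x \<in> S \<Longrightarrow> (F has_derivative blinfun_apply (DF x)) (at x)"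
    "\<And>x y. x \<in> S \<Longrightarrow> y \<in> S \<Longrightarrow> norm (DF x - DF y) \<le> infsum A I * norm (x - y)"
proof
  define DF where "DF x = (\<Sum>\<^sub>\<infinity>i\<in>I. D i x)" for x
  have "(\<lambda>i. D i x) summable_on I" if "x \<in> S" for x
    by (rule abs_summable_summable, rule summable_on_comparison_test[OF A])
      (use bound that in auto)
  then have DF: "((\<lambda>i. D i x) has_sum DF x) I" if "x \<in> S" for x
    unfolding DF_def using that by (simp add: has_sum_infsum)
  show "norm (DF x - DF y) \<le> infsum A I * norm (x - y)" if "x \<in> S" "y \<in> S" for x y
    by (rule norm_has_sum_le_cmult[OF A has_sum_diff[OF DF DF]]) (use that Lip in auto)
  show "(F has_derivative blinfun_apply (DF x)) (at x)" if x: "x \<in> S" for x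
  proof -
    obtain e where e: "e > 0" "ball x e \<subseteq> S"
      using S(1) x openE by blast
    have rem: "norm (F y - F x - DF x (y - x)) \<le> infsum A I * (norm (y - x) * norm (y - x))"
      if y: "y \<in> S" for y
    proof (rule norm_has_sum_le_cmult[OF A, where g = "\<lambda>i. f i y - f i x - D i x (y - x)"])
      show "((\<lambda>i. f i y - f i x - D i x (y - x)) has_sum F y - F x - DF x (y - x)) I"
        by (intro has_sum_diff F x y has_sum_bounded_linear[OF blinfun.bounded_linear_left] DF)
      fix i assume i: "i \<in> I"
      have "norm (f i y - f i x - blinfun_apply (D i x) (y - x)) \<le> norm (y - x) * (A i * norm (y - x))"
      proof (rule differentiable_bound_linearization[where S = "closed_segment x y"
            and f' = "\<lambda>z. blinfun_apply (D i z)"])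
        show "x + t *\<^sub>R (y - x) \<in> closed_segment x y" if "t \<in> {0..1}" for t
          using that by (auto simp: in_segment algebra_simps)
        have sub: "closed_segment x y \<subseteq> S"
          using S(2) x y by (simp add: closed_segment_subset)
        show "(f i has_derivative blinfun_apply (D i z)) (at z within closed_segment x y)"
          if "z \<in> closed_segment x y" for z
          using D[OF i, of z] that sub has_derivative_at_withinI by blast
        show "onorm (blinfun_apply (D i z) - blinfun_apply (D i x)) \<le> A i * norm (y - x)"
          if z: "z \<in> closed_segment x y" for z
        proof -
          have "onorm (blinfun_apply (D i z) - blinfun_apply (D i x)) = norm (D i z - D i x)"
            by (simp add: norm_blinfun.rep_eq minus_blinfun.rep_eq fun_diff_def)
          also have "\<dots> \<le> A i * norm (z - x)"
            using Lip[OF i, of z x] x z sub by auto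
          also have "\<dots> \<le> A i * norm (y - x)"
          proof (rule mult_left_mono)
            show "norm (z - x) \<le> norm (y - x)"
              using segment_bound1[OF z] by simp
            show "0 \<le> A i" using bound[OF i x] norm_ge_zero order_trans by blast
          qed
          finally show ?thesis .
        qed
        show "x \<in> closed_segment x y" by simp
      qed
      then show "norm (f i y - f i x - blinfun_apply (D i x) (y - x)) \<le> A i * (norm (y - x) * norm (y - x))"
        by (simp add: mult_ac)
    qed
    show ?thesis
    proof (rule has_derivativeI_sandwich[OF e(1)])
      show "bounded_linear (blinfun_apply (DF x))" by (rule blinfun.bounded_linear_right)
      show "norm (F y - F x - DF x (y - x)) / norm (y - x) \<le> infsum A I * norm (y - x)"
        if "y \<noteq> x" "dist y x < e" for y
        using rem[of y] e(2) that by (auto simp: dist_commute divide_le_eq mult_ac subset_eq)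
      have "((\<lambda>y. infsum A I * norm (y - x)) \<longlongrightarrow> infsum A I * norm (x - x)) (at x)"
        by (intro tendsto_intros)
      then show "((\<lambda>y. infsum A I * norm (y - x)) \<longlongrightarrow> 0) (at x)" by simp
    qed
  qed
qed

lemma abs_summable_on_euclidean:
  fixes f :: "'i \<Rightarrow> 'b::euclidean_space"
  assumes "f summable_on A"
  shows "(\<lambda>i. norm (f i)) summable_on A"
proof -
  have "(\<lambda>i. \<bar>f i \<bullet> b\<bar>) summable_on A" for b
    using summable_on_bounded_linear[OF bounded_linear_inner_left assms, of b]
      summable_on_iff_abs_summable_on_real by fastforce
  then have "(\<lambda>i. \<Sum>b\<in>Basis. \<bar>f i \<bullet> b\<bar>) summable_on A"
    by (intro summable_on_sum) auto
  then show ?thesis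
    by (rule summable_on_comparison_test) (auto intro: norm_le_l1)
qed

text \<open>After rescaling, the monomials have uniformly bounded first and second differences on the
  cube of half side length, so the power series may be differentiated term by term there.\<close>

lemma real_analytic_at_C11:
  fixes f :: "'a::euclidean_space \<Rightarrow> 'b::euclidean_space"
  assumes "real_analytic_at f a"
  obtains e C D where "e > 0" "\<And>x. x \<in> ball a e \<Longrightarrow> (f has_derivative blinfun_apply (D x)) (at x)"
    "C-lipschitz_on (ball a e) D"
proof -
  let ?I = "Basis \<rightarrow>\<^sub>E (UNIV :: nat set) :: ('a \<Rightarrow> nat) set"
  let ?d = "real DIM('a)"
  from assms obtain c R where R: "R > 0"
    and f: "\<And>x. x \<in> ball a R \<Longrightarrow>
      ((\<lambda>\<alpha>. (\<Prod>b\<in>Basis. ((x - a) \<bullet> b) ^ \<alpha> b) *\<^sub>R c \<alpha>) has_sum f x) ?I"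
    unfolding real_analytic_at_def by blast
  \<comment> \<open>A vector with coordinates at most 1 has norm at most \<open>DIM('a)\<close>, so
    after scaling by \<rho> its norm is at most R/2: the whole unit cube, corners included, lies
    inside the ball of convergence.\<close>
  define \<rho> where "\<rho> = R / (2 * ?d)"
  have \<rho>: "\<rho> > 0" "?d * \<rho> < R" using R by (simp_all add: \<rho>_def)
  have near: "a + \<rho> *\<^sub>R z \<in> ball a R" if "\<And>b. b \<in> Basis \<Longrightarrow> \<bar>z \<bullet> b\<bar> \<le> 1" for z :: 'a
  proof -
    have "norm z \<le> (\<Sum>b\<in>Basis. \<bar>z \<bullet> b\<bar>)" by (rule norm_le_l1)
    also have "\<dots> \<le> ?d" using sum_bounded_above[of Basis "\<lambda>b. \<bar>z \<bullet> b\<bar>" 1] that by simp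
    finally have "\<rho> * norm z \<le> \<rho> * ?d" using \<rho>(1) by simp
    also have "\<rho> * ?d < R" using \<rho>(2) by (simp add: mult.commute)
    finally have "norm (\<rho> *\<^sub>R z) < R" using \<rho>(1) by simp
    then show ?thesis by (simp add: dist_norm)
  qed
  define g where "g \<alpha> = (\<Prod>b\<in>Basis. \<rho> ^ \<alpha> b) *\<^sub>R c \<alpha>" for \<alpha> :: "'a \<Rightarrow> nat"
  have scaled: "((\<lambda>\<alpha>. monom_fun \<alpha> z *\<^sub>R g \<alpha>) has_sum f (a + \<rho> *\<^sub>R z)) ?I"
    if "\<And>b. b \<in> Basis \<Longrightarrow> \<bar>z \<bullet> b\<bar> \<le> 1" for z :: 'a
  proof -
    have "(\<Prod>b\<in>Basis. ((a + \<rho> *\<^sub>R z - a) \<bullet> b) ^ \<alpha> b) *\<^sub>R c \<alpha> = monom_fun \<alpha> z *\<^sub>R g \<alpha>" for \<alpha>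
      by (simp add: g_def monom_fun_def power_mult_distrib prod.distrib mult.commute)
    then show ?thesis using f[OF near[OF that]] by simp
  qed
  \<comment> \<open>At the corner \<open>One\<close> every monomial equals 1, so convergence at this
    single point is summability of the rescaled coefficients, and in finite dimension this is
    absolute.\<close>
  have "((\<lambda>\<alpha>. monom_fun \<alpha> One *\<^sub>R g \<alpha>) has_sum f (a + \<rho> *\<^sub>R One)) ?I"
    by (rule scaled) simp
  then have "((\<lambda>\<alpha>. g \<alpha>) has_sum f (a + \<rho> *\<^sub>R One)) ?I"
    by (simp add: monom_fun_def)
  then have gsum: "(\<lambda>\<alpha>. norm (g \<alpha>)) summable_on ?I"
    by (intro abs_summable_on_euclidean) (auto simp: summable_on_def)
  define D where "D \<alpha> z = Blinfun (\<lambda>h. monom_deriv \<alpha> z h *\<^sub>R g \<alpha>)" for \<alpha> z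
  have Dder: "((\<lambda>z. monom_fun \<alpha> z *\<^sub>R g \<alpha>) has_derivative (\<lambda>h. monom_deriv \<alpha> z h *\<^sub>R g \<alpha>)) (at z)"
    for \<alpha> z
    by (rule has_derivative_scaleR_left[OF monom_fun_has_derivative])
  then have Dapp: "blinfun_apply (D \<alpha> z) = (\<lambda>h. monom_deriv \<alpha> z h *\<^sub>R g \<alpha>)" for \<alpha> z
    unfolding D_def using has_derivative_bounded_linear bounded_linear_Blinfun_apply by blast
  \<comment> \<open>One majorant for both requirements: it is the Lipschitz constant of the
    derivative of the term, and by \<open>d\<close> it also dominates the norm of that
    derivative.\<close>
  define A where "A \<alpha> = ?d * (4 + ?d) * norm (g \<alpha>)" for \<alpha>
  have d: "?d \<le> ?d * (4 + ?d)" by (simp add: algebra_simps)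
  obtain DF where DF: "\<And>z. z \<in> half_cube \<Longrightarrow>
        ((\<lambda>z. f (a + \<rho> *\<^sub>R z)) has_derivative blinfun_apply (DF z)) (at z)"
    "\<And>z w. z \<in> half_cube \<Longrightarrow> w \<in> half_cube \<Longrightarrow> norm (DF z - DF w) \<le> infsum A ?I * norm (z - w)"
  proof (rule has_derivative_has_sum[where f = "\<lambda>\<alpha> z. monom_fun \<alpha> z *\<^sub>R g \<alpha>" and I = ?I
        and D = D and A = A and S = half_cube and F = "\<lambda>z. f (a + \<rho> *\<^sub>R z)"])
    show "open (half_cube :: 'a set)" "convex (half_cube :: 'a set)"
      by (simp_all add: half_cube_eq_box open_box)
    show "((\<lambda>z. monom_fun \<alpha> z *\<^sub>R g \<alpha>) has_derivative blinfun_apply (D \<alpha> x)) (at x)" for \<alpha> x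
      unfolding Dapp by (rule Dder)
    show "norm (D \<alpha> x) \<le> A \<alpha>" if "x \<in> half_cube" for \<alpha> and x :: 'a
    proof (rule norm_blinfun_bound)
      show "0 \<le> A \<alpha>" by (simp add: A_def)
      fix h :: 'a
      have "\<bar>monom_deriv \<alpha> x h\<bar> \<le> ?d * (4 + ?d) * norm h"
        using monom_deriv_bounds(1)[OF that that, of \<alpha> h] d
        by (meson mult_right_mono norm_ge_zero order_trans)
      then have "\<bar>monom_deriv \<alpha> x h\<bar> * norm (g \<alpha>) \<le> ?d * (4 + ?d) * norm h * norm (g \<alpha>)"
        by (rule mult_right_mono) simp
      then show "norm (blinfun_apply (D \<alpha> x) h) \<le> A \<alpha> * norm h"
        by (simp add: Dapp A_def mult_ac)
    qed
    show "norm (D \<alpha> x - D \<alpha> y) \<le> A \<alpha> * norm (x - y)"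
      if "x \<in> half_cube" "y \<in> half_cube" for \<alpha> and x y :: 'a
    proof (rule norm_blinfun_bound)
      show "0 \<le> A \<alpha> * norm (x - y)" by (simp add: A_def)
      fix h :: 'a
      have "\<bar>monom_deriv \<alpha> x h - monom_deriv \<alpha> y h\<bar> * norm (g \<alpha>)
          \<le> ?d * (4 + ?d) * norm (x - y) * norm h * norm (g \<alpha>)"
        by (rule mult_right_mono[OF monom_deriv_bounds(2)[OF that]]) simp
      then show "norm (blinfun_apply (D \<alpha> x - D \<alpha> y) h) \<le> A \<alpha> * norm (x - y) * norm h"
        by (simp add: Dapp A_def mult_ac blinfun.diff_left flip: scaleR_left_diff_distrib)
    qed
    show "A summable_on ?I"
      unfolding A_def by (intro summable_on_cmult_right gsum)
    show "((\<lambda>\<alpha>. monom_fun \<alpha> z *\<^sub>R g \<alpha>) has_sum f (a + \<rho> *\<^sub>R z)) ?I"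
      if "z \<in> half_cube" for z :: 'a
    proof (rule scaled)
      show "\<bar>z \<bullet> b\<bar> \<le> 1" if "b \<in> Basis" for b
        using half_cube_coord[OF \<open>z \<in> half_cube\<close> that] by simp
    qed
  qed (rule that)
  define e where "e = \<rho> / 2"
  define s where "s x = (1 / \<rho>) *\<^sub>R (x - a)" for x
  have s: "s x \<in> half_cube" if "x \<in> ball a e" for x
  proof -
    have "norm (x - a) < \<rho> / 2" using that by (simp add: e_def dist_norm norm_minus_commute)
    moreover have "norm (s x) = norm (x - a) / \<rho>" using \<rho> by (simp add: s_def)
    ultimately have "norm (s x) < 1/2" using \<rho> by (simp add: divide_less_eq)
    then show ?thesis unfolding half_cube_def
      using Basis_le_norm[of _ "s x"] by fastforce
  qed
  have sb: "(s has_derivative (\<lambda>h. (1 / \<rho>) *\<^sub>R h)) (at x)" for x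
    unfolding s_def by (auto intro!: derivative_eq_intros)
  define D' where "D' x = (1 / \<rho>) *\<^sub>R DF (s x)" for x
  show ?thesis
  proof (rule that)
    show "e > 0" using \<rho> by (simp add: e_def)
    show "(f has_derivative blinfun_apply (D' x)) (at x)" if x: "x \<in> ball a e" for x
    proof -
      have "((\<lambda>x. f (a + \<rho> *\<^sub>R s x)) has_derivative (\<lambda>h. DF (s x) ((1 / \<rho>) *\<^sub>R h))) (at x)"
        using has_derivative_compose[OF sb DF(1)[OF s[OF x]]] .
      moreover have "(\<lambda>x. f (a + \<rho> *\<^sub>R s x)) = f"
        using \<rho> by (auto simp: s_def)
      moreover have "(\<lambda>h. DF (s x) ((1 / \<rho>) *\<^sub>R h)) = blinfun_apply (D' x)"
        by (auto simp: D'_def blinfun.scaleR_left blinfun.scaleR_right)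
      ultimately show ?thesis by simp
    qed
    have "norm (D' x - D' y) \<le> \<bar>infsum A ?I / (\<rho> * \<rho>)\<bar> * norm (x - y)" if "x \<in> ball a e" "y \<in> ball a e" for x y
    proof -
      have "norm (s x - s y) = norm (x - y) / \<rho>"
        using \<rho> by (simp add: s_def flip: scaleR_right_diff_distrib)
      then have "norm (DF (s x) - DF (s y)) \<le> infsum A ?I * (norm (x - y) / \<rho>)"
        using DF(2)[OF s[OF that(1)] s[OF that(2)]] by simp
      then have "(1 / \<rho>) * norm (DF (s x) - DF (s y)) \<le> (1 / \<rho>) * (infsum A ?I * (norm (x - y) / \<rho>))"
        using \<rho> by (intro mult_left_mono) auto
      then have "norm (D' x - D' y) \<le> (1 / \<rho>) * (infsum A ?I * (norm (x - y) / \<rho>))"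
        using \<rho> by (simp add: D'_def flip: scaleR_right_diff_distrib)
      also have "\<dots> = infsum A ?I / (\<rho> * \<rho>) * norm (x - y)" by simp
      also have "\<dots> \<le> \<bar>infsum A ?I / (\<rho> * \<rho>)\<bar> * norm (x - y)"
        by (rule mult_right_mono[OF abs_ge_self norm_ge_zero])
      finally show ?thesis .
    qed
    then show "\<bar>infsum A ?I / (\<rho> * \<rho>)\<bar>-lipschitz_on (ball a e) D'"
      by (intro lipschitz_onI) (auto simp: dist_norm)
  qed
qed

text \<open>The derivative is packaged as a bounded linear operator so that its boundedness and
  Lipschitz continuity refer to the operator norm.\<close>

definition deriv_blin :: "('a::real_normed_vector \<Rightarrow> 'b::real_normed_vector) \<Rightarrow> 'a \<Rightarrow> 'a \<Rightarrow>\<^sub>L 'b" where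
  "deriv_blin f x = Blinfun (frechet_derivative f (at x))"

lemma has_derivative_deriv_blin:
  assumes "(f has_derivative f') (at x)"
  shows "blinfun_apply (deriv_blin f x) = f'"
  using assms has_derivative_bounded_linear bounded_linear_Blinfun_apply frechet_derivative_at
  unfolding deriv_blin_def by metis

lemma real_analytic_at_has_derivative:
  fixes f :: "'a::euclidean_space \<Rightarrow> 'b::euclidean_space"
  assumes "real_analytic_at f a"
  shows "(f has_derivative blinfun_apply (deriv_blin f a)) (at a)"
  using real_analytic_at_C11[OF assms] has_derivative_deriv_blin
  by (metis centre_in_ball)

lemma locally_lipschitz_compact:
  fixes f :: "'a::metric_space \<Rightarrow> 'b::metric_space"
  assumes "compact S" "\<And>a. a \<in> S \<Longrightarrow> \<exists>e>0. \<exists>C. C-lipschitz_on (ball a e \<inter> S) f"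
  obtains C where "C-lipschitz_on S f"
proof -
  \<comment> \<open>The passage from local to global on a compact set is stated for time-dependent
    maps; a one-point time set gives the autonomous case.\<close>
  have "local_lipschitz {0::real} S (\<lambda>_. f)"
  proof (rule local_lipschitzI)
    fix a assume "a \<in> S"
    then obtain e C where "e > 0" "C-lipschitz_on (ball a e \<inter> S) f" using assms(2) by blast
    then have "C-lipschitz_on (cball a (e/2) \<inter> S) f"
      by (elim lipschitz_on_subset) (auto simp: subset_eq)
    then show "\<exists>u>0. \<exists>L. \<forall>t\<in>cball t u \<inter> {0}. L-lipschitz_on (cball a u \<inter> S) f" for t :: real
      using \<open>e > 0\<close> by (metis half_gt_zero)
  qed
  then show ?thesis
    using local_lipschitz_compact_implies_lipschitz[of "{0::real}" S "\<lambda>_. f"] assms(1) that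
    by (metis compact_sing continuous_on_const singletonI)
qed

lemma real_analytic_on_compact:
  fixes f :: "'a::euclidean_space \<Rightarrow> 'b::euclidean_space"
  assumes f: "real_analytic_on f S" and S: "compact S"
  obtains C where "C-lipschitz_on S (deriv_blin f)"
proof (rule locally_lipschitz_compact[OF S])
  fix a assume "a \<in> S"
  then obtain e C D where e: "e > 0" and D: "\<And>x. x \<in> ball a e \<Longrightarrow> (f has_derivative blinfun_apply (D x)) (at x)"
    and C: "C-lipschitz_on (ball a e) D"
    using real_analytic_at_C11 f unfolding real_analytic_on_def by metis
  have "deriv_blin f x = D x" if "x \<in> ball a e" for x
    using has_derivative_deriv_blin[OF D[OF that]] by (simp add: blinfun_apply_inject)
  then have "C-lipschitz_on (ball a e) (deriv_blin f)"
    using C by (metis lipschitz_on_transform)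
  then show "\<exists>e>0. \<exists>C. C-lipschitz_on (ball a e \<inter> S) (deriv_blin f)"
    using e lipschitz_on_subset inf_le1 by metis
qed (rule that)

section \<open>The parametrization of a neighbourhood of the cycle\<close>

lemma lipschitz_on_bounded_image:
  assumes "C-lipschitz_on S f" "bounded S"
  shows "bounded (f ` S)"
proof (cases "S = {}")
  case False
  then obtain a where a: "a \<in> S" by blast
  obtain B where B: "\<And>x. x \<in> S \<Longrightarrow> dist a x \<le> B"
    using assms(2) unfolding bounded_any_center[of S a] by (elim exE) auto
  have "dist (f a) (f x) \<le> C * B" if "x \<in> S" for x
    using lipschitz_onD[OF assms(1) a that] B[OF that] lipschitz_on_nonneg[OF assms(1)]
    by (metis mult_left_mono order_trans)
  then show ?thesis unfolding bounded_any_center[of _ "f a"] by auto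
qed simp

lemma lipschitz_on_le_diff:
  assumes "C-lipschitz_on S f" "x \<in> S" "y \<in> S"
  shows "norm (f x - f y) \<le> C * norm (x - y)"
  using lipschitz_onD[OF assms] by (simp add: dist_norm)

lemma bounded_linear_bij_inv:
  fixes f :: "'a::euclidean_space \<Rightarrow> 'b::euclidean_space"
  assumes "linear f" "bij f"
  shows "linear (inv f)"
proof (rule linearI)
  interpret linear f by fact
  have s: "f (inv f y) = y" for y using assms(2) by (simp add: bij_is_surj surj_f_inv_f)
  have i: "inj f" using assms(2) by (rule bij_is_inj)
  show "inv f (x + y) = inv f x + inv f y" for x y
    by (rule injD[OF i]) (simp add: s add)
  show "inv f (c *\<^sub>R x) = c *\<^sub>R inv f x" for c x
    by (rule injD[OF i]) (simp add: s scale)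
qed

section \<open>Functions on a band that are periodic in the angle\<close>

abbreviation band :: "real \<Rightarrow> (real \<times> real) set" where
  "band c \<equiv> {u. \<bar>snd u\<bar> \<le> c}"

lemma convex_band: "convex (band c)"
proof -
  have "band c = UNIV \<times> {-c..c}" by (auto simp: abs_le_iff)
  then show ?thesis by (simp add: convex_Times)
qed

lemma periodic_int:
  assumes "\<And>u. u \<in> band c \<Longrightarrow> f (u + (1, 0)) = f u" "u \<in> band c"
  shows "f (u + (of_int n, 0)) = f u"
proof (induction n rule: int_induct[where k = 0])
  case (step1 i)
  have "u + (of_int (i + 1), 0) = u + (of_int i, 0) + (1, 0)" by (simp add: prod_eq_iff)
  moreover have "f (u + (of_int i, 0) + (1, 0)) = f (u + (of_int i, 0))"
    by (rule assms(1)) (use assms(2) in simp)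
  ultimately show ?case by (simp only: step1(2))
next
  case (step2 i)
  have "u + (of_int (i - 1), 0) + (1, 0) = u + (of_int i, 0)" by (simp add: prod_eq_iff)
  moreover have "f (u + (of_int (i - 1), 0) + (1, 0)) = f (u + (of_int (i - 1), 0))"
    by (rule assms(1)) (use assms(2) in simp)
  ultimately show ?case by (simp only: step2(2))
qed (simp flip: zero_prod_def)

lemma periodic_frac:
  assumes "\<And>u. u \<in> band c \<Longrightarrow> f (u + (1, 0)) = f u" "u \<in> band c"
  shows "f (frac (fst u), snd u) = f u"
proof -
  have "u + (of_int (- \<lfloor>fst u\<rfloor>), 0) = (frac (fst u), snd u)"
    by (simp add: prod_eq_iff frac_def)
  then show ?thesis using periodic_int[where f = f, OF assms, of "- \<lfloor>fst u\<rfloor>"] by (simp only:)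
qed

text \<open>Two points whose angles differ by at most 1 are moved by the same integer shift, which
  puts the first angle in [0, 1) and the second in [-1, 2]; this is why three periods are assumed.
  For larger differences the points are reduced separately. The reduced angles differ by at most 1,
  hence by less than the original ones, and the factor 2 comes from bounding the sum of the two
  coordinate distances by twice the distance.\<close>

lemma periodic_lipschitz:
  assumes per: "\<And>u. u \<in> band c \<Longrightarrow> f (u + (1, 0)) = f u"
    and lip: "C-lipschitz_on ({-1..2} \<times> {-c..c}) f"
  shows "(2 * C)-lipschitz_on (band c) f"
proof (rule lipschitz_onI)
  have C: "C \<ge> 0" using lip lipschitz_on_nonneg by blast
  then show "0 \<le> 2 * C" by simp
  fix u v assume u: "u \<in> band c" and v: "v \<in> band c"
  define w where "w z = (frac (fst z), snd z)" for z :: "real \<times> real"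
  have box: "z \<in> {-1..2} \<times> {-c..c}" if "\<bar>snd z\<bar> \<le> c" "-1 \<le> fst z" "fst z \<le> 2" for z
    using that by (cases z) (auto simp: abs_le_iff)
  have fr: "-1 \<le> frac x" "0 \<le> frac x" "frac x < 1" "frac x \<le> 2" for x :: real
    using frac_ge_0[of x] frac_lt_1[of x] by linarith+
  have wb: "w z \<in> {-1..2} \<times> {-c..c}" if "z \<in> band c" for z
  proof (rule box)
    show "-1 \<le> fst (w z)" "fst (w z) \<le> 2" unfolding w_def fst_conv by (rule fr)+
  qed (use that in \<open>simp add: w_def\<close>)
  note wu = wb[OF u]
  show "dist (f u) (f v) \<le> 2 * C * dist u v"
  proof (cases "\<bar>fst u - fst v\<bar> \<le> 1")
    case True
    define v' where "v' = v + (of_int (- \<lfloor>fst u\<rfloor>), 0)"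
    have *: "fst v' = frac (fst u) + (fst v - fst u)" by (simp add: v'_def frac_def)
    have v'1: "-1 \<le> fst v'" "fst v' \<le> 2"
      unfolding * using fr[of "fst u"] True by linarith+
    have "v' \<in> {-1..2} \<times> {-c..c}"
      by (rule box[OF _ v'1]) (use v in \<open>simp add: v'_def\<close>)
    moreover have "f v' = f v" unfolding v'_def by (rule periodic_int[where f = f, OF per v])
    moreover have "f (w u) = f u" unfolding w_def by (rule periodic_frac[where f = f, OF per u])
    moreover have "dist (w u) v' = dist u v"
      by (simp add: w_def v'_def frac_def dist_prod_def dist_real_def)
    ultimately have "dist (f u) (f v) \<le> C * dist u v"
      using lipschitz_onD[OF lip wu] by metis
    also have "\<dots> \<le> 2 * C * dist u v" using C by (intro mult_right_mono) auto
    finally show ?thesis .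
  next
    case False
    note wv = wb[OF v]
    have f1: "f (w u) = f u" unfolding w_def by (rule periodic_frac[where f = f, OF per u])
    have f2: "f (w v) = f v" unfolding w_def by (rule periodic_frac[where f = f, OF per v])
    have "dist (w u) (w v) \<le> dist (fst (w u)) (fst (w v)) + dist (snd u) (snd v)"
      unfolding dist_prod_def using sqrt_sum_squares_le_sum[of "dist (fst (w u)) (fst (w v))" "dist (snd (w u)) (snd (w v))"]
      by (simp add: w_def)
    moreover have "dist (fst (w u)) (fst (w v)) \<le> 1"
      unfolding w_def fst_conv dist_real_def using fr[of "fst u"] fr[of "fst v"] by linarith
    moreover have "dist (fst u) (fst v) > 1" using False by (simp add: dist_real_def)
    ultimately have "dist (w u) (w v) \<le> 2 * dist u v"
      using dist_fst_le[of u v] dist_snd_le[of u v] by linarith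
    then have "C * dist (w u) (w v) \<le> C * (2 * dist u v)" using C by (rule mult_left_mono)
    then show ?thesis using lipschitz_onD[OF lip wu wv] f1 f2 by simp
  qed
qed

lemma periodic_bounded:
  assumes per: "\<And>u. u \<in> band c \<Longrightarrow> f (u + (1, 0)) = f u"
    and bdd: "bounded (f ` ({0..1} \<times> {-c..c}))"
  shows "bounded (f ` band c)"
proof (rule bounded_subset[OF bdd], rule image_subsetI)
  fix u assume u: "u \<in> band c"
  have "f u = f (frac (fst u), snd u)" using periodic_frac[where f = f, OF per u] by (rule sym)
  moreover have "(frac (fst u), snd u) \<in> {0..1} \<times> {-c..c}"
    using u frac_lt_1[of "fst u"] by (auto simp: abs_le_iff less_imp_le)
  ultimately show "f u \<in> f ` ({0..1} \<times> {-c..c})" by (metis imageI)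
qed

text \<open>Neither \<epsilon> nor a curve is fixed here, so constants obtained inside are uniform
  in both.\<close>

locale delay_perturbation =
  fixes X :: "(real^2) \<times> (real^2) \<Rightarrow> real^2"
    and r :: "real^2 \<Rightarrow> real"
    and K :: "real \<times> real \<Rightarrow> real^2"
    and h \<omega>\<^sub>0 lam\<^sub>0 :: real
  assumes X_analytic: "real_analytic_on X UNIV"
    and r_C1: "C1_map r"
    and r_nonneg: "\<And>x. 0 \<le> r x" and r_le: "\<And>x. r x \<le> h"
    and omega_pos: "\<omega>\<^sub>0 > 0" and lam_neg: "lam\<^sub>0 < 0"
    and K_analytic: "real_analytic_on K strip"
    and K_diffeo: "local_diffeo_on K strip"
    and K_periodic: "\<And>\<theta> s. s \<in> {-1..1} \<Longrightarrow> K (\<theta> + 1, s) = K (\<theta>, s)"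
    and K_eq: "\<And>\<theta> s. s \<in> {-1..1} \<Longrightarrow>
        X (K (\<theta>, s), 0) = frechet_derivative K (at (\<theta>, s)) (\<omega>\<^sub>0, lam\<^sub>0 * s)"
begin

abbreviation DK :: "real \<times> real \<Rightarrow> (real \<times> real) \<Rightarrow>\<^sub>L (real^2)" where
  "DK \<equiv> deriv_blin K"

definition J :: "real \<times> real \<Rightarrow> real^2 \<Rightarrow> real \<times> real" where
  "J u = inv (frechet_derivative K (at u))"

lemma strip_iff: "u \<in> strip \<longleftrightarrow> \<bar>snd u\<bar> \<le> 1"
  by (cases u) (auto simp: abs_le_iff)

lemma K_has_derivative: "\<bar>snd u\<bar> \<le> 1 \<Longrightarrow> (K has_derivative DK u) (at u)"
  using K_analytic real_analytic_at_has_derivative strip_iff unfolding real_analytic_on_def by blast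

lemma DK_eq_frechet: "\<bar>snd u\<bar> \<le> 1 \<Longrightarrow> frechet_derivative K (at u) = DK u"
  using K_has_derivative frechet_derivative_at by metis

lemma K_shift: "\<bar>snd u\<bar> \<le> 1 \<Longrightarrow> K (u + (1, 0)) = K u"
  using K_periodic[of "snd u" "fst u"] by (cases u) (auto simp: abs_le_iff)

text \<open>Periodicity of \<open>K\<close> is given on the closed strip, while comparing
  derivatives takes it on a neighbourhood; hence the strict inequality.\<close>

lemma DK_shift: assumes "\<bar>snd u\<bar> < 1" shows "DK (u + (1, 0)) = DK u"
proof -
  have op: "open {v::real\<times>real. \<bar>snd v\<bar> < 1}"
    by (intro open_Collect_less continuous_intros)
  have "((\<lambda>v. K (v + (1, 0))) has_derivative DK (u + (1, 0))) (at u)"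
  proof -
    have "((\<lambda>v. v + (1, 0)) has_derivative (\<lambda>h. h)) (at u)"
      by (auto intro!: derivative_eq_intros)
    moreover have "(K has_derivative DK (u + (1,0))) (at (u + (1, 0)))"
      by (rule K_has_derivative) (use assms in simp)
    ultimately show ?thesis by (rule has_derivative_compose)
  qed
  then have "(K has_derivative DK (u + (1, 0))) (at u)"
    by (rule has_derivative_transform_within_open[OF _ op]) (use assms K_shift in \<open>auto simp: less_imp_le\<close>)
  moreover have "(K has_derivative DK u) (at u)" by (rule K_has_derivative) (use assms in simp)
  ultimately have "blinfun_apply (DK (u + (1, 0))) = blinfun_apply (DK u)"
    by (rule has_derivative_unique)
  then show ?thesis by (simp add: blinfun_apply_inject)
qed

lemma K_local_inverse:
  assumes "\<bar>snd a\<bar> \<le> 1"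
  obtains U V g where "open U" "a \<in> U" "open V" "homeomorphism U V K g" "g differentiable (at (K a))"
proof -
  obtain U V g where *: "open U" "a \<in> U" "open V" "homeomorphism U V K g" "g differentiable_on V"
    using K_diffeo assms strip_iff unfolding local_diffeo_on_def by meson
  then have "K a \<in> V" by (auto simp: homeomorphism_def)
  then have "g differentiable (at (K a))"
    using * differentiable_on_eq_differentiable_at by blast
  with * that show ?thesis by blast
qed

text \<open>\<open>local_diffeo_on\<close> supplies a differentiable local inverse, and
  differentiating both compositions shows that its derivative is a two-sided inverse of
  \<open>DK u\<close>.\<close>

lemma DK_bij: assumes "\<bar>snd u\<bar> \<le> 1" shows "bij (DK u)"
proof -
  obtain U V g where *: "open U" "u \<in> U" "open V" "homeomorphism U V K g" "g differentiable (at (K u))"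
    using K_local_inverse[OF assms] .
  then obtain g' where g': "(g has_derivative g') (at (K u))"
    using differentiable_def by blast
  have Ku: "K u \<in> V" "g (K u) = u" using * by (auto simp: homeomorphism_def)
  have "((\<lambda>x. g (K x)) has_derivative (\<lambda>h. g' (DK u h))) (at u)"
    using has_derivative_compose[OF K_has_derivative[OF assms] g'] .
  then have "((\<lambda>x. x) has_derivative (\<lambda>h. g' (DK u h))) (at u)"
    by (rule has_derivative_transform_within_open[OF _ *(1,2)]) (use * in \<open>auto simp: homeomorphism_def\<close>)
  then have 1: "g' (DK u k) = k" for k
    using has_derivative_unique[OF has_derivative_ident] by metis
  have "((\<lambda>x. K (g x)) has_derivative (\<lambda>h. DK u (g' h))) (at (K u))"
    using has_derivative_compose[OF g', of K "DK u"] K_has_derivative[OF assms] Ku by simp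
  then have "((\<lambda>x. x) has_derivative (\<lambda>h. DK u (g' h))) (at (K u))"
    by (rule has_derivative_transform_within_open[OF _ *(3) Ku(1)]) (use * in \<open>auto simp: homeomorphism_def\<close>)
  then have 2: "DK u (g' k) = k" for k
    using has_derivative_unique[OF has_derivative_ident] by metis
  show ?thesis by (rule bijI') (metis 1, metis 2)
qed

lemma DK_J: "\<bar>snd u\<bar> \<le> 1 \<Longrightarrow> DK u (J u y) = y"
  and J_DK: "\<bar>snd u\<bar> \<le> 1 \<Longrightarrow> J u (DK u k) = k"
  using DK_bij[of u] by (auto simp: J_def DK_eq_frechet bij_is_surj surj_f_inv_f bij_is_inj)

lemma J_linear: "\<bar>snd u\<bar> \<le> 1 \<Longrightarrow> linear (J u)"
  unfolding J_def DK_eq_frechet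
  by (rule bounded_linear_bij_inv[OF _ DK_bij]) (simp_all add: blinfun.bounded_linear_right bounded_linear.linear)

lemma K_flow_eq: "\<bar>snd u\<bar> \<le> 1 \<Longrightarrow> X (K u, 0) = DK u (\<omega>\<^sub>0, lam\<^sub>0 * snd u)"
  using K_eq[of "snd u" "fst u"] DK_eq_frechet[of u] by (cases u) (auto simp: abs_le_iff)

section \<open>Uniform bounds for \<open>K\<close>, \<open>DK\<close> and \<open>J\<close> on
  \<open>band (1/2)\<close>\<close>

lemma DK_lipschitz: obtains C where "C-lipschitz_on (band (1/2)) DK"
proof -
  have "real_analytic_on K ({-1..2} \<times> {-(1/2)..1/2})"
    using K_analytic by (force simp: real_analytic_on_def)
  then obtain C where "C-lipschitz_on ({-1..2} \<times> {-(1/2)..1/2}) DK"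
    using real_analytic_on_compact compact_Times compact_Icc by metis
  then have "(2 * C)-lipschitz_on (band (1/2)) DK"
    by (intro periodic_lipschitz) (auto intro: DK_shift)
  then show ?thesis by (rule that)
qed

lemma DK_bounded: obtains B where "B > 0" "\<And>u. u \<in> band (1/2) \<Longrightarrow> norm (DK u) \<le> B"
proof -
  obtain C where C: "C-lipschitz_on (band (1/2)) DK" using DK_lipschitz .
  have "bounded (DK ` ({0..1} \<times> {-(1/2)..1/2}))"
  proof (rule lipschitz_on_bounded_image[OF lipschitz_on_subset[OF C]])
    show "bounded ({0..1::real} \<times> {-(1/2)..1/2::real})" by (simp add: bounded_Times)
  qed auto
  then have "bounded (DK ` band (1/2))"
    by (intro periodic_bounded) (auto intro: DK_shift)
  then show ?thesis using that by (auto simp: bounded_pos)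
qed

lemma K_lipschitz: obtains C where "C-lipschitz_on (band (1/2)) K"
proof -
  obtain B where B: "B > 0" "\<And>u. u \<in> band (1/2) \<Longrightarrow> norm (DK u) \<le> B" using DK_bounded by blast
  have "norm (K u - K v) \<le> B * norm (u - v)" if "u \<in> band (1/2)" "v \<in> band (1/2)" for u v
  proof (rule differentiable_bound[OF convex_band[of "1/2"], where f' = "\<lambda>u. DK u"])
    show "(K has_derivative DK x) (at x within band (1/2))" if "x \<in> band (1/2)" for x
      by (rule has_derivative_at_withinI, rule K_has_derivative) (use that in auto)
    show "onorm (DK x) \<le> B" if "x \<in> band (1/2)" for x
      using B(2)[OF that] by (simp add: norm_blinfun.rep_eq)
  qed (use that in auto)
  then show ?thesis using B(1) by (intro that[of B] lipschitz_onI) (auto simp: dist_norm)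
qed

lemma K_bounded: obtains M where "M > 0" "\<And>u. u \<in> band (1/2) \<Longrightarrow> norm (K u) \<le> M"
proof -
  obtain C where C: "C-lipschitz_on (band (1/2)) K" using K_lipschitz .
  have "bounded (K ` ({0..1} \<times> {-(1/2)..1/2}))"
  proof (rule lipschitz_on_bounded_image[OF lipschitz_on_subset[OF C]])
    show "bounded ({0..1::real} \<times> {-(1/2)..1/2::real})" by (simp add: bounded_Times)
  qed auto
  then have "bounded (K ` band (1/2))"
    by (intro periodic_bounded) (auto intro: K_shift)
  then show ?thesis using that by (auto simp: bounded_pos)
qed

text \<open>By periodicity and homogeneity it suffices to minimize over one period and over unit
  vectors, a compact set on which the norm is positive because \<open>DK u\<close> is
  injective.\<close>

lemma DK_lower: obtains m where "m > 0" "\<And>u k. u \<in> band (1/2) \<Longrightarrow> m * norm k \<le> norm (DK u k)"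
proof -
  obtain C where C: "C-lipschitz_on (band (1/2)) DK" using DK_lipschitz .
  define T where "T = ({0..1::real} \<times> {-(1/2)..1/2::real}) \<times> sphere (0::real\<times>real) 1"
  have T: "compact T" unfolding T_def by (intro compact_Times) auto
  have "continuous_on T (\<lambda>p. norm (DK (fst p) (snd p)))"
  proof -
    have "continuous_on (fst ` T) DK"
      by (rule continuous_on_subset[OF lipschitz_on_continuous_on[OF C]]) (auto simp: T_def)
    then have "continuous_on T (\<lambda>p. DK (fst p))"
      by (rule continuous_on_compose2) (auto intro: continuous_intros)
    then show ?thesis by (intro continuous_intros)
  qed
  moreover have "T \<noteq> {}"
  proof -
    have "((0,0),(1,0)) \<in> T" by (simp add: T_def)
    then show ?thesis by blast
  qed
  ultimately obtain p where p: "p \<in> T" "\<And>q. q \<in> T \<Longrightarrow> norm (DK (fst p) (snd p)) \<le> norm (DK (fst q) (snd q))"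
    using continuous_attains_inf[OF T] by blast
  define m where "m = norm (DK (fst p) (snd p))"
  have "m > 0"
  proof -
    have "snd p \<noteq> 0" "\<bar>snd (fst p)\<bar> \<le> 1" using p(1) by (auto simp: T_def abs_le_iff)
    then have "DK (fst p) (snd p) \<noteq> 0" using J_DK[of "fst p"] J_linear[of "fst p"]
      by (metis linear_0)
    then show ?thesis by (simp add: m_def)
  qed
  moreover have "m * norm k \<le> norm (DK u k)" if u: "u \<in> band (1/2)" for u k
  proof (cases "k = 0")
    case False
    have "DK u = DK (frac (fst u), snd u)"
      using periodic_frac[where f = DK, OF DK_shift u] by (auto intro: sym)
    moreover have "((frac (fst u), snd u), (1 / norm k) *\<^sub>R k) \<in> T"
      using u frac_lt_1[of "fst u"] False by (auto simp: T_def abs_le_iff less_imp_le)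
    ultimately have "m \<le> norm (DK u ((1 / norm k) *\<^sub>R k))"
      using p(2) unfolding m_def by (metis fst_conv snd_conv)
    then show ?thesis using False by (simp add: blinfun.scaleR_right field_simps)
  qed simp
  ultimately show ?thesis by (rule that)
qed

text \<open>The lower bound on \<open>DK\<close> bounds its inverse. The Lipschitz estimate is the
  resolvent identity J u - J v = J u (DK v - DK u) J v, used with \<open>DK u\<close> moved to the
  left side.\<close>

lemma J_bounds:
  obtains C where "C > 0" "\<And>u y. u \<in> band (1/2) \<Longrightarrow> norm (J u y) \<le> C * norm y"
    "\<And>u v y. u \<in> band (1/2) \<Longrightarrow> v \<in> band (1/2) \<Longrightarrow> norm (J u y - J v y) \<le> C * norm (u - v) * norm y"
proof -
  obtain C where C: "C-lipschitz_on (band (1/2)) DK" using DK_lipschitz .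
  then have C0: "C \<ge> 0" by (rule lipschitz_on_nonneg)
  obtain m where m: "m > 0" "\<And>u k. u \<in> band (1/2) \<Longrightarrow> m * norm k \<le> norm (DK u k)" using DK_lower by blast
  have J1: "norm (J u y) \<le> norm y / m" if "u \<in> band (1/2)" for u y
    using m(2)[OF that, of "J u y"] DK_J[of u y] that m(1) by (simp add: field_simps)
  have J2: "norm (J u y - J v y) \<le> C / (m * m) * norm (u - v) * norm y" if u: "u \<in> band (1/2)" and v: "v \<in> band (1/2)" for u v y
  proof -
    have "DK u (J u y - J v y) = DK v (J v y) - DK u (J v y)"
      using DK_J[of u y] DK_J[of v y] u v by (simp add: blinfun.diff_right)
    also have "\<dots> = (DK v - DK u) (J v y)" by (simp add: blinfun.diff_left)
    finally have "norm (DK u (J u y - J v y)) \<le> norm (DK v - DK u) * norm (J v y)"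
      by (simp add: norm_blinfun)
    also have "\<dots> \<le> (C * norm (u - v)) * (norm y / m)"
      using lipschitz_on_le_diff[OF C v u] J1[OF v, of y] C0
      by (intro mult_mono) (auto simp: norm_minus_commute)
    finally have "m * norm (J u y - J v y) \<le> (C * norm (u - v)) * (norm y / m)"
      using m(2)[OF u] order_trans by blast
    then show ?thesis using m(1) by (simp add: field_simps)
  qed
  define C' where "C' = max 1 (max (1/m) (C / (m*m)))"
  have "norm (J u y) \<le> C' * norm y" if "u \<in> band (1/2)" for u y
  proof -
    have "norm y / m = (1/m) * norm y" by simp
    also have "\<dots> \<le> C' * norm y" unfolding C'_def by (intro mult_right_mono) auto
    finally show ?thesis using J1[OF that, of y] by linarith
  qed
  moreover have "norm (J u y - J v y) \<le> C' * norm (u - v) * norm y" if "u \<in> band (1/2)" "v \<in> band (1/2)" for u v y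
  proof -
    have "C / (m * m) * norm (u - v) * norm y \<le> C' * norm (u - v) * norm y"
      unfolding C'_def by (intro mult_right_mono) auto
    then show ?thesis using J2[OF that, of y] by linarith
  qed
  moreover have "C' > 0" by (simp add: C'_def)
  ultimately show ?thesis using that by blast
qed

text \<open>Local injectivity at a scale that is the same all over the band. \<rho> is chosen so
  that \<open>DK\<close> changes by at most m/2 along a segment of that length, so half of the lower
  bound on \<open>DK\<close> survives; adding 1 to C covers a vanishing Lipschitz constant.\<close>

lemma K_expanding:
  obtains \<rho> m where "\<rho> > 0" "m > 0"
    "\<And>u v. u \<in> band (1/2) \<Longrightarrow> v \<in> band (1/2) \<Longrightarrow> norm (u - v) \<le> \<rho> \<Longrightarrow> m * norm (u - v) \<le> norm (K u - K v)"
proof -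
  obtain C where C: "C-lipschitz_on (band (1/2)) DK" using DK_lipschitz .
  then have C0: "C \<ge> 0" by (rule lipschitz_on_nonneg)
  obtain m where m: "m > 0" "\<And>u k. u \<in> band (1/2) \<Longrightarrow> m * norm k \<le> norm (DK u k)" using DK_lower by blast
  define \<rho> where "\<rho> = m / (2 * (C + 1))"
  have \<rho>: "\<rho> > 0" "C * \<rho> \<le> m / 2" using m(1) C0 by (simp_all add: \<rho>_def field_simps)
  have "m / 2 * norm (u - v) \<le> norm (K u - K v)"
    if u: "u \<in> band (1/2)" and v: "v \<in> band (1/2)" and d: "norm (u - v) \<le> \<rho>" for u v
  proof -
    have "norm (K u - K v - DK v (u - v)) \<le> norm (u - v) * (m / 2)"
    proof (rule differentiable_bound_linearization[where S = "closed_segment v u" and f' = "\<lambda>z. DK z"])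
      have sub: "closed_segment v u \<subseteq> band (1/2)"
        by (rule closed_segment_subset[OF v u convex_band])
      show "v + t *\<^sub>R (u - v) \<in> closed_segment v u" if "t \<in> {0..1}" for t
        using that by (auto simp: in_segment algebra_simps)
      show "(K has_derivative DK z) (at z within closed_segment v u)" if "z \<in> closed_segment v u" for z
        by (rule has_derivative_at_withinI, rule K_has_derivative) (use that sub in force)
      show "onorm (blinfun_apply (DK z) - blinfun_apply (DK v)) \<le> m / 2" if z: "z \<in> closed_segment v u" for z
      proof -
        have "onorm (blinfun_apply (DK z) - blinfun_apply (DK v)) = norm (DK z - DK v)"
          by (simp add: norm_blinfun.rep_eq minus_blinfun.rep_eq fun_diff_def)
        also have "\<dots> \<le> C * norm (z - v)"
          using lipschitz_on_le_diff[OF C _ v, of z] z sub by auto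
        also have "\<dots> \<le> C * \<rho>"
        proof (rule mult_left_mono[OF _ C0])
          show "norm (z - v) \<le> \<rho>" using segment_bound1[OF z] d by (simp add: norm_minus_commute)
        qed
        finally show ?thesis using \<rho>(2) by linarith
      qed
    qed simp
    moreover have "norm (DK v (u - v)) \<le> norm (K u - K v - DK v (u - v)) + norm (K u - K v)"
      using norm_triangle_ineq2[of "DK v (u - v)" "K u - K v"]
      by (simp add: norm_minus_commute algebra_simps)
    ultimately show ?thesis using m(2)[OF v, of "u - v"] by (simp add: mult.commute)
  qed
  then show ?thesis using that[of \<rho> "m/2"] \<rho>(1) m(1) by simp
qed

lemma K_open_map: assumes "open O'" "O' \<subseteq> band 1" shows "open (K ` O')"
  unfolding open_contains_ball
proof
  show "\<exists>e>0. ball y e \<subseteq> K ` O'" if y: "y \<in> K ` O'" for y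
  proof -
    obtain a where a: "a \<in> O'" "y = K a" using y by blast
    then have "\<bar>snd a\<bar> \<le> 1" using assms(2) by auto
    then obtain U V g where *: "open U" "a \<in> U" "open V" "homeomorphism U V K g"
      by (rule K_local_inverse)
    then have "openin (top_of_set V) (K ` (U \<inter> O'))"
      using homeomorphism_imp_open_map[OF *(4), of "U \<inter> O'"] assms(1)
      by (simp add: openin_open_eq open_Int)
    then have "open (K ` (U \<inter> O'))" using *(3) by (simp add: openin_open_eq)
    moreover have "y \<in> K ` (U \<inter> O')" using a * by blast
    ultimately obtain e where "e > 0" "ball y e \<subseteq> K ` (U \<inter> O')"
      by (rule openE)
    then show ?thesis by (meson Int_lower2 image_mono order_trans)
  qed
qed

end

section \<open>The tube around the cycle as a base of a covering\<close>

lemma real_analytic_on_compact_convex: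
  fixes f :: "'a::euclidean_space \<Rightarrow> 'b::euclidean_space"
  assumes f: "real_analytic_on f S" and S: "compact S" "convex S"
  obtains C where "C-lipschitz_on S f"
proof -
  obtain C where C: "C-lipschitz_on S (deriv_blin f)"
    using real_analytic_on_compact[OF f S(1)] .
  have "bounded (deriv_blin f ` S)"
    by (rule lipschitz_on_bounded_image[OF C compact_imp_bounded[OF S(1)]])
  then obtain B where "B > 0 \<and> (\<forall>y\<in>deriv_blin f ` S. norm y \<le> B)"
    unfolding bounded_pos ..
  then have B: "B > 0" "\<And>x. x \<in> S \<Longrightarrow> norm (deriv_blin f x) \<le> B" by auto
  have "norm (f x - f y) \<le> B * norm (x - y)" if "x \<in> S" "y \<in> S" for x y
  proof (rule differentiable_bound[OF S(2), where f' = "\<lambda>u. blinfun_apply (deriv_blin f u)"])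
    show "(f has_derivative blinfun_apply (deriv_blin f z)) (at z within S)" if "z \<in> S" for z
      by (rule has_derivative_at_withinI, rule real_analytic_at_has_derivative)
        (use f that in \<open>auto simp: real_analytic_on_def\<close>)
    show "onorm (blinfun_apply (deriv_blin f z)) \<le> B" if "z \<in> S" for z
      using B(2)[OF that] by (simp add: norm_blinfun.rep_eq)
  qed (use that in auto)
  then show ?thesis using B(1) by (intro that[of B] lipschitz_onI) (auto simp: dist_norm)
qed

text \<open>Gronwall in differential form: the squared distance multiplied by exp (- 2 C t) is
  nonincreasing and starts at 0.\<close>

lemma ode_unique_forward:
  fixes f :: "'a::real_inner \<Rightarrow> 'a"
  assumes p: "\<And>t. t \<ge> 0 \<Longrightarrow> (p has_vector_derivative f (p t)) (at t)" "\<And>t. t \<ge> 0 \<Longrightarrow> p t \<in> S"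
    and q: "\<And>t. t \<ge> 0 \<Longrightarrow> (q has_vector_derivative f (q t)) (at t)" "\<And>t. t \<ge> 0 \<Longrightarrow> q t \<in> S"
    and f: "C-lipschitz_on S f" and eq: "p 0 = q 0" and T: "T \<ge> 0"
  shows "p T = q T"
proof -
  define g where "g t = exp (- 2 * C * t) * ((p t - q t) \<bullet> (p t - q t))" for t
  have "g T \<le> g 0"
  proof (rule DERIV_nonpos_imp_nonincreasing[OF T])
    fix t assume t: "0 \<le> t" "t \<le> T"
    define d where "d = p t - q t"
    define d' where "d' = f (p t) - f (q t)"
    have "((\<lambda>t. p t - q t) has_vector_derivative d') (at t)"
      unfolding d'_def by (intro has_vector_derivative_diff p q t)
    then have der: "((\<lambda>t. (p t - q t) \<bullet> (p t - q t)) has_real_derivative 2 * (d \<bullet> d')) (at t)"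
      unfolding has_vector_derivative_def has_field_derivative_def
      using has_derivative_inner[of "\<lambda>t. p t - q t" "\<lambda>h. h *\<^sub>R d'" t UNIV "\<lambda>t. p t - q t" "\<lambda>h. h *\<^sub>R d'"]
      by (auto simp: d_def inner_commute elim!: has_derivative_eq_rhs)
    have "(g has_real_derivative exp (- 2 * C * t) * (2 * (d \<bullet> d') - 2 * C * (d \<bullet> d))) (at t)"
      unfolding g_def by (rule derivative_eq_intros der refl)+ (simp add: d_def algebra_simps)
    moreover have "d \<bullet> d' \<le> C * (d \<bullet> d)"
    proof -
      have "d \<bullet> d' \<le> norm d * norm d'" by (rule norm_cauchy_schwarz)
      also have "norm d' \<le> C * norm d"
        unfolding d_def d'_def by (rule lipschitz_on_le_diff[OF f p(2) q(2)]) (use t in auto)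
      then have "norm d * norm d' \<le> norm d * (C * norm d)" by (intro mult_left_mono) auto
      also have "\<dots> = C * (d \<bullet> d)" by (simp add: power2_norm_eq_inner[symmetric] power2_eq_square)
      finally show ?thesis .
    qed
    ultimately show "\<exists>y. (g has_real_derivative y) (at t) \<and> y \<le> 0"
      by (intro exI conjI) (auto simp: mult_le_0_iff)
  qed
  then have "(p T - q T) \<bullet> (p T - q T) \<le> 0"
    using eq by (simp add: g_def mult_le_0_iff)
  then have "(p T - q T) \<bullet> (p T - q T) = 0" using inner_ge_zero[of "p T - q T"] by linarith
  then show ?thesis by (simp only: inner_eq_zero_iff) simp
qed

section \<open>Size and Lipschitz constant of the perturbation\<close>

context delay_perturbation
begin

text \<open>This is \<epsilon> P, kept undivided so that \<epsilon> = 0 needs no separate treatment.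
  Accordingly \<open>H\<close> is \<epsilon> Y, as \<open>scaled_Y_eq_H\<close> confirms.\<close>

definition F :: "real \<Rightarrow> real^2 \<Rightarrow> real^2 \<Rightarrow> real^2" where
  "F \<epsilon> x y = X (x, \<epsilon> *\<^sub>R y) - X (x, 0)"

definition H :: "real \<Rightarrow> real \<times> real \<Rightarrow> real \<times> real \<Rightarrow> real \<times> real" where
  "H \<epsilon> u v = J u (F \<epsilon> (K u) (K v))"

lemma X_analytic_on: "real_analytic_on X S"
  using X_analytic by (auto simp: real_analytic_on_def)

text \<open>Each bound has to carry a factor \<epsilon>. For the size and the dependence on y it
  comes from the Lipschitz constant of \<open>X\<close> in its second argument. For the dependence
  on x, the x-derivative of \<open>F\<close> is a difference of two values of the derivative of
  \<open>X\<close> at arguments \<epsilon> |y| apart. The restriction \<epsilon> \<le> 1 keeps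
  \<epsilon> y in the ball.\<close>

lemma F_bounds:
  assumes M: "M > 0"
  obtains C where "C > 0"
    "\<And>\<epsilon> x y. 0 \<le> \<epsilon> \<Longrightarrow> \<epsilon> \<le> 1 \<Longrightarrow> x \<in> cball 0 M \<Longrightarrow> y \<in> cball 0 M \<Longrightarrow> norm (F \<epsilon> x y) \<le> C * \<epsilon>"
    "\<And>\<epsilon> x y x' y'. 0 \<le> \<epsilon> \<Longrightarrow> \<epsilon> \<le> 1 \<Longrightarrow> x \<in> cball 0 M \<Longrightarrow> y \<in> cball 0 M \<Longrightarrow>
        x' \<in> cball 0 M \<Longrightarrow> y' \<in> cball 0 M \<Longrightarrow>
        norm (F \<epsilon> x y - F \<epsilon> x' y') \<le> C * \<epsilon> * (norm (x - x') + norm (y - y'))"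
proof -
  define B where "B = cball (0::real^2) M"
  have cpt: "compact (B \<times> B)" "convex (B \<times> B)"
    by (auto simp: B_def intro: compact_Times convex_Times)
  obtain C1 where C1: "C1-lipschitz_on (B \<times> B) X"
    using real_analytic_on_compact_convex[OF X_analytic_on cpt] .
  obtain C2 where C2: "C2-lipschitz_on (B \<times> B) (deriv_blin X)"
    using real_analytic_on_compact[OF X_analytic_on cpt(1)] .
  have C0: "C1 \<ge> 0" "C2 \<ge> 0" using C1 C2 lipschitz_on_nonneg by blast+
  have scale: "\<epsilon> *\<^sub>R y \<in> B" if "0 \<le> \<epsilon>" "\<epsilon> \<le> 1" "y \<in> B" for \<epsilon> y
  proof -
    have "\<epsilon> * norm y \<le> 1 * norm y" using that by (intro mult_right_mono) auto
    then show ?thesis using that by (simp add: B_def)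
  qed
  have zero: "0 \<in> B" using M by (simp add: B_def)
  have bound: "norm (F \<epsilon> x y) \<le> C1 * M * \<epsilon>" if "0 \<le> \<epsilon>" "\<epsilon> \<le> 1" "x \<in> B" "y \<in> B" for \<epsilon> x y
  proof -
    have "norm (F \<epsilon> x y) \<le> C1 * norm ((x, \<epsilon> *\<^sub>R y) - (x, 0))"
      unfolding F_def by (rule lipschitz_on_le_diff[OF C1]) (use that scale zero in auto)
    also have "\<dots> = C1 * \<epsilon> * norm y" using that by (simp add: norm_Pair)
    also have "\<dots> \<le> C1 * \<epsilon> * M" using that C0 by (intro mult_left_mono) (auto simp: B_def)
    finally show ?thesis by (simp add: mult_ac)
  qed
  have Ly: "norm (F \<epsilon> x y - F \<epsilon> x y') \<le> C1 * \<epsilon> * norm (y - y')"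
    if "0 \<le> \<epsilon>" "\<epsilon> \<le> 1" "x \<in> B" "y \<in> B" "y' \<in> B" for \<epsilon> x y y'
  proof -
    have "norm (F \<epsilon> x y - F \<epsilon> x y') \<le> C1 * norm ((x, \<epsilon> *\<^sub>R y) - (x, \<epsilon> *\<^sub>R y'))"
      using lipschitz_on_le_diff[OF C1, of "(x, \<epsilon> *\<^sub>R y)" "(x, \<epsilon> *\<^sub>R y')"] that scale
      by (simp add: F_def)
    also have "\<dots> = C1 * \<epsilon> * norm (y - y')"
      using that by (simp add: norm_Pair flip: scaleR_right_diff_distrib)
    finally show ?thesis .
  qed
  have Lx: "norm (F \<epsilon> x y - F \<epsilon> x' y) \<le> C2 * M * \<epsilon> * norm (x - x')"
    if e: "0 \<le> \<epsilon>" "\<epsilon> \<le> 1" and x: "x \<in> B" "x' \<in> B" and y: "y \<in> B" for \<epsilon> x y x'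
  proof (rule differentiable_bound[where S = B and f = "\<lambda>x. F \<epsilon> x y"
        and f' = "\<lambda>x h. deriv_blin X (x, \<epsilon> *\<^sub>R y) (h, 0) - deriv_blin X (x, 0) (h, 0)"])
    show "convex B" by (simp add: B_def)
    fix z assume z: "z \<in> B"
    have dX: "((\<lambda>x. X (x, v)) has_derivative (\<lambda>h. deriv_blin X (z, v) (h, 0))) (at z)" for v
    proof -
      have "((\<lambda>x. (x, v)) has_derivative (\<lambda>h. (h, 0))) (at z)"
        by (auto intro!: derivative_eq_intros)
      moreover have "(X has_derivative deriv_blin X (z, v)) (at (z, v))"
        using X_analytic real_analytic_at_has_derivative by (auto simp: real_analytic_on_def)
      ultimately show ?thesis by (rule has_derivative_compose)
    qed
    show "((\<lambda>x. F \<epsilon> x y) has_derivative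
        (\<lambda>h. deriv_blin X (z, \<epsilon> *\<^sub>R y) (h, 0) - deriv_blin X (z, 0) (h, 0))) (at z within B)"
      unfolding F_def by (rule has_derivative_at_withinI[OF has_derivative_diff[OF dX dX]])
    show "onorm (\<lambda>h. deriv_blin X (z, \<epsilon> *\<^sub>R y) (h, 0) - deriv_blin X (z, 0) (h, 0)) \<le> C2 * M * \<epsilon>"
    proof (rule onorm_bound)
      show "0 \<le> C2 * M * \<epsilon>" using C0 M e by simp
      fix k :: "real^2"
      have "norm (deriv_blin X (z, \<epsilon> *\<^sub>R y) - deriv_blin X (z, 0)) \<le> C2 * norm ((z, \<epsilon> *\<^sub>R y) - (z, 0))"
        by (rule lipschitz_on_le_diff[OF C2]) (use z y e scale zero in auto)
      also have "\<dots> = C2 * \<epsilon> * norm y" using e by (simp add: norm_Pair)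
      also have "\<dots> \<le> C2 * \<epsilon> * M" using e y C0 by (intro mult_left_mono) (auto simp: B_def)
      finally have "norm (deriv_blin X (z, \<epsilon> *\<^sub>R y) - deriv_blin X (z, 0)) * norm (k, 0::real^2) \<le> C2 * \<epsilon> * M * norm (k, 0::real^2)"
        by (rule mult_right_mono) simp
      then have "norm ((deriv_blin X (z, \<epsilon> *\<^sub>R y) - deriv_blin X (z, 0)) (k, 0)) \<le> C2 * \<epsilon> * M * norm (k, 0::real^2)"
        using norm_blinfun order_trans by blast
      then show "norm (deriv_blin X (z, \<epsilon> *\<^sub>R y) (k, 0) - deriv_blin X (z, 0) (k, 0)) \<le> C2 * M * \<epsilon> * norm k"
        by (simp add: blinfun.diff_left norm_Pair mult_ac)
    qed
  qed (use x in auto)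
  define C where "C = 1 + C1 * M + C1 + C2 * M"
  have nn: "C1 * M \<ge> 0" "C2 * M \<ge> 0" using C0 M by auto
  show ?thesis
  proof (rule that[of C])
    show "C > 0" using nn C0 by (simp add: C_def)
    show "norm (F \<epsilon> x y) \<le> C * \<epsilon>" if "0 \<le> \<epsilon>" "\<epsilon> \<le> 1" "x \<in> cball 0 M" "y \<in> cball 0 M" for \<epsilon> x y
    proof -
      have "C1 * M * \<epsilon> \<le> C * \<epsilon>" using nn C0 that by (intro mult_right_mono) (auto simp: C_def)
      then show ?thesis using bound[of \<epsilon> x y] that by (simp add: B_def)
    qed
    show "norm (F \<epsilon> x y - F \<epsilon> x' y') \<le> C * \<epsilon> * (norm (x - x') + norm (y - y'))"
      if e: "0 \<le> \<epsilon>" "\<epsilon> \<le> 1" and "x \<in> cball 0 M" "y \<in> cball 0 M" "x' \<in> cball 0 M" "y' \<in> cball 0 M"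
      for \<epsilon> x y x' y'
    proof -
      have "norm (F \<epsilon> x y - F \<epsilon> x' y') \<le> norm (F \<epsilon> x y - F \<epsilon> x' y) + norm (F \<epsilon> x' y - F \<epsilon> x' y')"
        using norm_triangle_ineq[of "F \<epsilon> x y - F \<epsilon> x' y" "F \<epsilon> x' y - F \<epsilon> x' y'"] by simp
      also have "\<dots> \<le> C2 * M * \<epsilon> * norm (x - x') + C1 * \<epsilon> * norm (y - y')"
        by (intro add_mono Lx Ly) (use that in \<open>auto simp: B_def\<close>)
      also have "\<dots> \<le> C * \<epsilon> * norm (x - x') + C * \<epsilon> * norm (y - y')"
        using nn C0 e by (intro add_mono mult_right_mono) (auto simp: C_def)
      finally show ?thesis by (simp add: algebra_simps)
    qed
  qed
qed

lemma H_bounds: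
  obtains C where "C > 0"
    "\<And>\<epsilon> u v. 0 \<le> \<epsilon> \<Longrightarrow> \<epsilon> \<le> 1 \<Longrightarrow> u \<in> band (1/2) \<Longrightarrow> v \<in> band (1/2) \<Longrightarrow> norm (H \<epsilon> u v) \<le> C * \<epsilon>"
    "\<And>\<epsilon> u v u' v'. 0 \<le> \<epsilon> \<Longrightarrow> \<epsilon> \<le> 1 \<Longrightarrow> u \<in> band (1/2) \<Longrightarrow> v \<in> band (1/2) \<Longrightarrow>
        u' \<in> band (1/2) \<Longrightarrow> v' \<in> band (1/2) \<Longrightarrow>
        norm (H \<epsilon> u v - H \<epsilon> u' v') \<le> C * \<epsilon> * (norm (u - u') + norm (v - v'))"
proof -
  obtain M where M: "M > 0" "\<And>u. u \<in> band (1/2) \<Longrightarrow> norm (K u) \<le> M" using K_bounded by blast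
  obtain A where A: "A > 0"
    "\<And>\<epsilon> x y. 0 \<le> \<epsilon> \<Longrightarrow> \<epsilon> \<le> 1 \<Longrightarrow> x \<in> cball 0 M \<Longrightarrow> y \<in> cball 0 M \<Longrightarrow> norm (F \<epsilon> x y) \<le> A * \<epsilon>"
    "\<And>\<epsilon> x y x' y'. 0 \<le> \<epsilon> \<Longrightarrow> \<epsilon> \<le> 1 \<Longrightarrow> x \<in> cball 0 M \<Longrightarrow> y \<in> cball 0 M \<Longrightarrow>
        x' \<in> cball 0 M \<Longrightarrow> y' \<in> cball 0 M \<Longrightarrow>
        norm (F \<epsilon> x y - F \<epsilon> x' y') \<le> A * \<epsilon> * (norm (x - x') + norm (y - y'))"
    using F_bounds[OF M(1)] by blast
  obtain B where B: "B > 0" "\<And>u y. u \<in> band (1/2) \<Longrightarrow> norm (J u y) \<le> B * norm y"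
    "\<And>u v y. u \<in> band (1/2) \<Longrightarrow> v \<in> band (1/2) \<Longrightarrow> norm (J u y - J v y) \<le> B * norm (u - v) * norm y"
    using J_bounds by blast
  obtain L where L: "L-lipschitz_on (band (1/2)) K" using K_lipschitz .
  then have L0: "L \<ge> 0" by (rule lipschitz_on_nonneg)
  define C where "C = B * A + B * A * L"
  have C0: "B * A > 0" "B * A * L \<ge> 0" using A B L0 by auto
  have Kb: "K u \<in> cball 0 M" if "u \<in> band (1/2)" for u using M(2)[OF that] by simp
  show ?thesis
  proof (rule that[of C])
    show "C > 0" using C0 by (simp add: C_def)
    show "norm (H \<epsilon> u v) \<le> C * \<epsilon>"
      if e: "0 \<le> \<epsilon>" "\<epsilon> \<le> 1" and u: "u \<in> band (1/2)" and v: "v \<in> band (1/2)" for \<epsilon> u v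
    proof -
      have "norm (H \<epsilon> u v) \<le> B * norm (F \<epsilon> (K u) (K v))" unfolding H_def by (rule B(2)[OF u])
      also have "\<dots> \<le> B * (A * \<epsilon>)" using B(1) by (intro mult_left_mono A(2) e Kb u v) auto
      also have "\<dots> = (B * A) * \<epsilon>" by simp
      also have "\<dots> \<le> C * \<epsilon>" using C0 e by (intro mult_right_mono) (auto simp: C_def)
      finally show ?thesis .
    qed
    show "norm (H \<epsilon> u v - H \<epsilon> u' v') \<le> C * \<epsilon> * (norm (u - u') + norm (v - v'))"
      if e: "0 \<le> \<epsilon>" "\<epsilon> \<le> 1" and u: "u \<in> band (1/2)" and v: "v \<in> band (1/2)"
        and u': "u' \<in> band (1/2)" and v': "v' \<in> band (1/2)" for \<epsilon> u v u' v'
    proof -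
      let ?f = "F \<epsilon> (K u) (K v)" and ?f' = "F \<epsilon> (K u') (K v')"
      have "J u' (?f - ?f') = J u' ?f - J u' ?f'"
        by (rule linear_diff[OF J_linear]) (use u' in auto)
      then have "H \<epsilon> u v - H \<epsilon> u' v' = (J u ?f - J u' ?f) + J u' (?f - ?f')"
        unfolding H_def 
        by simp
      then have "norm (H \<epsilon> u v - H \<epsilon> u' v') \<le> norm (J u ?f - J u' ?f) + norm (J u' (?f - ?f'))"
        using norm_triangle_ineq by metis
      also have "\<dots> \<le> B * norm (u - u') * norm ?f + B * norm (?f - ?f')"
        by (intro add_mono B u u')
      also have "\<dots> \<le> B * norm (u - u') * (A * \<epsilon>) + B * (A * \<epsilon> * (norm (K u - K u') + norm (K v - K v')))"
        using B(1) by (intro add_mono mult_left_mono A e Kb u v u' v') auto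
      also have "\<dots> \<le> B * norm (u - u') * (A * \<epsilon>) + B * (A * \<epsilon> * (L * norm (u - u') + L * norm (v - v')))"
        using B(1) A(1) e by (intro add_mono mult_left_mono lipschitz_on_le_diff[OF L] u v u' v') auto
      also have "\<dots> = C * \<epsilon> * norm (u - u') + B * A * L * \<epsilon> * norm (v - v')"
        by (simp add: C_def algebra_simps)
      also have "\<dots> \<le> C * \<epsilon> * norm (u - u') + C * \<epsilon> * norm (v - v')"
        using C0 e by (intro add_mono mult_right_mono) (auto simp: C_def)
      finally show ?thesis by (simp add: algebra_simps)
    qed
  qed
qed

section \<open>The unperturbed flow and the fibres of \<open>K\<close>\<close>

lemma K_chain:
  assumes "\<bar>snd (u t)\<bar> \<le> 1" "(u has_vector_derivative u') (at t)"
  shows "((\<lambda>t. K (u t)) has_vector_derivative DK (u t) u') (at t)"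
  using has_derivative_compose[OF assms(2)[unfolded has_vector_derivative_def] K_has_derivative[OF assms(1)]]
  unfolding has_vector_derivative_def by (simp add: blinfun.scaleR_right)

text \<open>In the coordinates the unperturbed solution is explicit: the angle moves with speed
  \<open>\<omega>\<^sub>0\<close> and the radius decays like exp (\<open>lam\<^sub>0\<close> t).
  Equal images at time 0 stay equal for all t \<ge> 0 by ODE uniqueness. At the times n /
  \<open>\<omega>\<^sub>0\<close> the trajectory on the cycle is back at its start, while the other
  one tends to K (\<theta>, 0), so K (\<theta>, 0) = K (\<theta>', 0). After many turns the first
  trajectory is therefore within the injectivity radius of the central point at its own angle and
  has the same image, which forces s exp (\<open>lam\<^sub>0\<close> t) = 0.\<close>

lemma K_fibre_zero:
  assumes s: "\<bar>s\<bar> \<le> 1/2" and eq: "K (\<theta>, s) = K (\<theta>', 0)"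
  shows "s = 0"
proof -
  obtain M where M: "M > 0" "\<And>u. u \<in> band (1/2) \<Longrightarrow> norm (K u) \<le> M" using K_bounded by blast
  obtain A where A: "A-lipschitz_on (band (1/2)) K" using K_lipschitz .
  obtain \<rho> m where \<rho>: "\<rho> > 0" "m > 0"
    "\<And>u v. u \<in> band (1/2) \<Longrightarrow> v \<in> band (1/2) \<Longrightarrow> norm (u - v) \<le> \<rho> \<Longrightarrow> m * norm (u - v) \<le> norm (K u - K v)"
    using K_expanding by blast
  define u where "u \<theta> s t = (\<theta> + \<omega>\<^sub>0 * t, s * exp (lam\<^sub>0 * t))" for \<theta> s t :: real
  have ub: "u \<theta> s t \<in> band (1/2)" if "t \<ge> 0" "\<bar>s\<bar> \<le> 1/2" for \<theta> s t
  proof -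
    have "exp (lam\<^sub>0 * t) \<le> 1" using that lam_neg by (simp add: mult_nonpos_nonneg)
    then have "\<bar>s\<bar> * exp (lam\<^sub>0 * t) \<le> (1/2) * 1" using that by (intro mult_mono) auto
    then show ?thesis by (simp add: u_def abs_mult)
  qed
  have sol: "((\<lambda>t. K (u \<theta> s t)) has_vector_derivative X (K (u \<theta> s t), 0)) (at t)"
    if "t \<ge> 0" "\<bar>s\<bar> \<le> 1/2" for \<theta> s t
  proof -
    have "(u \<theta> s has_vector_derivative (\<omega>\<^sub>0, lam\<^sub>0 * snd (u \<theta> s t))) (at t)"
      unfolding u_def by (auto intro!: derivative_eq_intros has_vector_derivative_Pair
          simp flip: has_real_derivative_iff_has_vector_derivative)
    moreover have "\<bar>snd (u \<theta> s t)\<bar> \<le> 1" using ub[OF that, of \<theta>] by auto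
    ultimately show ?thesis using K_chain[of "u \<theta> s" t] K_flow_eq[of "u \<theta> s t"] by simp
  qed
  have cpt: "compact (cball (0::real^2) M \<times> {0::real^2})" "convex (cball (0::real^2) M \<times> {0::real^2})"
    by (auto intro: compact_Times convex_Times)
  obtain C where C: "C-lipschitz_on (cball 0 M \<times> {0}) X"
    using real_analytic_on_compact_convex[OF X_analytic_on cpt] .
  have CX: "C-lipschitz_on (cball 0 M) (\<lambda>x. X (x, 0))"
    using C unfolding lipschitz_on_def by (simp add: dist_Pair_Pair)
  have same: "K (u \<theta> s t) = K (u \<theta>' 0 t)" if "t \<ge> 0" for t
  proof (rule ode_unique_forward[OF _ _ _ _ CX _ that])
    show "K (u \<theta> s 0) = K (u \<theta>' 0 0)" using eq by (simp add: u_def)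
    show "K (u \<theta> s \<tau>) \<in> cball 0 M" "K (u \<theta>' 0 \<tau>) \<in> cball 0 M" if "\<tau> \<ge> 0" for \<tau>
      using M(2)[OF ub[OF that s]] M(2)[OF ub[OF that, of 0]] by simp_all
    show "((\<lambda>t. K (u \<theta> s t)) has_vector_derivative X (K (u \<theta> s \<tau>), 0)) (at \<tau>)"
      "((\<lambda>t. K (u \<theta>' 0 t)) has_vector_derivative X (K (u \<theta>' 0 \<tau>), 0)) (at \<tau>)"
      if "\<tau> \<ge> 0" for \<tau>
      by (rule sol[OF that s], rule sol[OF that]) simp
  qed
  text \<open>Both trajectories approach the cycle with their own phase, so the phases agree on the cycle.\<close>
  have decay: "(\<lambda>n::nat. s * exp (lam\<^sub>0 * (n / \<omega>\<^sub>0))) \<longlonglongrightarrow> 0"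
  proof -
    have "norm (exp (lam\<^sub>0 / \<omega>\<^sub>0)) < 1"
      unfolding real_norm_def abs_exp_cancel using lam_neg omega_pos by (simp add: divide_neg_pos)
    then have "(\<lambda>n. exp (lam\<^sub>0 / \<omega>\<^sub>0) ^ n) \<longlonglongrightarrow> 0" by (rule LIMSEQ_power_zero)
    then have "(\<lambda>n. s * exp (lam\<^sub>0 / \<omega>\<^sub>0) ^ n) \<longlonglongrightarrow> s * 0"
      by (intro tendsto_mult tendsto_const)
    moreover have "exp (lam\<^sub>0 * (n / \<omega>\<^sub>0)) = exp (lam\<^sub>0 / \<omega>\<^sub>0) ^ n" for n :: nat
      using exp_of_nat_mult[of n "lam\<^sub>0 / \<omega>\<^sub>0"] by (simp add: mult.commute)
    ultimately show ?thesis by simp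
  qed
  have Kn: "K (x + real n, s) = K (x, s)" if "\<bar>s\<bar> \<le> 1/2" for x s and n :: nat
    using periodic_int[where f = K and c = 1 and u = "(x,s)" and n = "int n"] K_shift that by simp
  have phase: "K (\<theta>, 0) = K (\<theta>', 0)"
  proof -
    have "norm (K (\<theta>, 0) - K (\<theta>', 0)) \<le> A * \<bar>s * exp (lam\<^sub>0 * (n / \<omega>\<^sub>0))\<bar>" for n :: nat
    proof -
      let ?t = "n / \<omega>\<^sub>0"
      have t: "?t \<ge> 0" "\<omega>\<^sub>0 * ?t = n" using omega_pos by auto
      have "K (\<theta>', 0) = K (u \<theta>' 0 ?t)" using Kn[of 0 \<theta>' n] t by (simp add: u_def)
      also have "\<dots> = K (u \<theta> s ?t)" using same[OF t(1)] by simp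
      finally have "norm (K (\<theta>, 0) - K (\<theta>', 0)) = norm (K (u \<theta> 0 ?t) - K (u \<theta> s ?t))"
        using Kn[of 0 \<theta> n] t by (simp add: u_def)
      also have "\<dots> \<le> A * norm (u \<theta> 0 ?t - u \<theta> s ?t)"
        by (rule lipschitz_on_le_diff[OF A ub[OF t(1)] ub[OF t(1) s]]) simp
      also have "\<dots> = A * \<bar>s * exp (lam\<^sub>0 * ?t)\<bar>" by (simp add: u_def norm_Pair)
      finally show ?thesis .
    qed
    moreover have "(\<lambda>n::nat. A * \<bar>s * exp (lam\<^sub>0 * (n / \<omega>\<^sub>0))\<bar>) \<longlonglongrightarrow> A * \<bar>0\<bar>"
      by (intro tendsto_intros decay)
    ultimately have "norm (K (\<theta>, 0) - K (\<theta>', 0)) \<le> A * \<bar>0\<bar>"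
      by (intro LIMSEQ_le_const) auto
    then show ?thesis by simp
  qed
  have "\<forall>\<^sub>F n in sequentially. \<bar>s * exp (lam\<^sub>0 * (real n / \<omega>\<^sub>0))\<bar> < \<rho>"
    using decay \<rho>(1) by (simp add: tendsto_iff dist_real_def)
  then obtain n :: nat where n: "\<bar>s * exp (lam\<^sub>0 * (n / \<omega>\<^sub>0))\<bar> < \<rho>"
    using eventually_happens' sequentially_bot by blast
  let ?t = "n / \<omega>\<^sub>0"
  have t: "?t \<ge> 0" "\<omega>\<^sub>0 * ?t = n" using omega_pos by auto
  have "K (u \<theta> s ?t) = K (u \<theta> 0 ?t)"
    using same[OF t(1)] phase Kn[of 0 \<theta> n] Kn[of 0 \<theta>' n] t by (simp add: u_def)
  moreover have "m * norm (u \<theta> s ?t - u \<theta> 0 ?t) \<le> norm (K (u \<theta> s ?t) - K (u \<theta> 0 ?t))"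
    by (rule \<rho>(3)[OF ub[OF t(1) s] ub[OF t(1)]]) (use n in \<open>simp_all add: u_def norm_Pair\<close>)
  ultimately have "m * norm (u \<theta> s ?t - u \<theta> 0 ?t) \<le> 0" by simp
  then have "u \<theta> s ?t = u \<theta> 0 ?t" using \<rho>(2) by (simp add: mult_le_0_iff)
  then show ?thesis by (simp add: u_def)
qed

lemma K_continuous: "continuous_on (band 1) K"
  by (rule has_derivative_continuous_on, rule has_derivative_at_withinI, rule K_has_derivative) simp

definition tube :: "real \<Rightarrow> (real^2) set" where
  "tube \<sigma> = K ` {w. \<bar>snd w\<bar> < \<sigma>}"

lemma open_tube: assumes "\<sigma> \<le> 1" shows "open (tube \<sigma>)"
  unfolding tube_def
proof (rule K_open_map)
  show "open {w::real \<times> real. \<bar>snd w\<bar> < \<sigma>}" by (intro open_Collect_less continuous_intros)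
qed (use assms in auto)

text \<open>Over one period, the image of the part of the band with |s| between 1/4 and 1/2 is
  compact and misses the cycle by \<open>K_fibre_zero\<close>. It therefore stays at some distance d
  from it, while points of the tube are within A \<sigma> of the cycle; \<sigma> makes the latter
  smaller than d.\<close>

lemma K_fibre_narrow:
  obtains \<sigma> where "\<sigma> > 0" "\<sigma> \<le> 1/4" "\<And>w. w \<in> band (1/2) \<Longrightarrow> K w \<in> tube \<sigma> \<Longrightarrow> w \<in> band (1/4)"
proof -
  obtain A where A: "A-lipschitz_on (band (1/2)) K" using K_lipschitz .
  define T where "T = K ` ({0..1} \<times> ({-(1/2)..-(1/4)} \<union> {1/4..1/2}))"
  define T0 where "T0 = K ` ({0..1} \<times> {0})"
  have "compact T" unfolding T_def
    by (rule compact_continuous_image[OF continuous_on_subset[OF K_continuous]])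
      (auto intro: compact_Times)
  moreover have "compact T0" unfolding T0_def
    by (rule compact_continuous_image[OF continuous_on_subset[OF K_continuous]])
      (auto intro: compact_Times)
  moreover have "T \<inter> T0 = {}"
  proof (rule ccontr)
    assume "T \<inter> T0 \<noteq> {}"
    then obtain y where y: "y \<in> T" "y \<in> T0" by auto
    obtain p where p: "p \<in> {0..1} \<times> ({-(1/2)..-(1/4)} \<union> {1/4..1/2})" "y = K p"
      using y(1) unfolding T_def by (rule imageE)
    obtain q where q: "q \<in> {0..1} \<times> {0}" "y = K q"
      using y(2) unfolding T0_def by (rule imageE)
    obtain a s where as: "p = (a, s)" by (cases p)
    obtain b where b: "q = (b, 0)" using q by (cases q) auto
    have "s \<in> {-(1/2)..-(1/4)} \<union> {1/4..1/2}" "K (a, s) = K (b, 0)"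
      using p q as b by auto
    then show False using K_fibre_zero[of s a b] by auto
  qed
  ultimately obtain d where d: "d > 0" "\<And>x y. x \<in> T \<Longrightarrow> y \<in> T0 \<Longrightarrow> d \<le> dist x y"
    using separate_compact_closed compact_imp_closed by metis
  have A0: "A \<ge> 0" using A lipschitz_on_nonneg by blast
  define \<sigma> where "\<sigma> = min (1/4) (d / (A + 1))"
  have \<sigma>: "\<sigma> > 0" "\<sigma> \<le> 1/4" "\<sigma> * (A + 1) \<le> d"
  proof -
    show "\<sigma> > 0" using d(1) A0 by (simp add: \<sigma>_def)
    show "\<sigma> \<le> 1/4" unfolding \<sigma>_def by (rule min.cobounded1)
    have "\<sigma> * (A + 1) \<le> d / (A + 1) * (A + 1)"
      using A0 by (intro mult_right_mono) (auto simp: \<sigma>_def)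
    then show "\<sigma> * (A + 1) \<le> d" using A0 by simp
  qed
  have "w \<in> band (1/4)" if w: "w \<in> band (1/2)" and Kw: "K w \<in> tube \<sigma>" for w
  proof (rule ccontr)
    assume n: "w \<notin> band (1/4)"
    obtain w' where w': "\<bar>snd w'\<bar> < \<sigma>" "K w = K w'" using Kw by (auto simp: tube_def)
    have fr: "K (frac (fst v), snd v) = K v" if "\<bar>snd v\<bar> \<le> 1" for v
      using periodic_frac[where f = K and c = 1 and u = v] K_shift that by simp
    have fr1: "frac x \<in> {0..1}" for x :: real using frac_lt_1[of x] by (auto simp: less_imp_le)
    have "K w \<in> T"
    proof -
      have "(frac (fst w), snd w) \<in> {0..1} \<times> ({-(1/2)..-(1/4)} \<union> {1/4..1/2})"
        using fr1 n w by auto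
      moreover have "K w = K (frac (fst w), snd w)" using fr[of w] w by simp
      ultimately show ?thesis unfolding T_def by (intro image_eqI)
    qed
    moreover have "K (fst w', 0) \<in> T0"
    proof -
      have "K (fst w', 0) = K (frac (fst w'), 0)" using fr[of "(fst w', 0)"] by simp
      then show ?thesis unfolding T0_def by (rule image_eqI) (use fr1 in blast)
    qed
    ultimately have "d \<le> dist (K w') (K (fst w', 0))" using d(2) w'(2) by metis
    also have "\<dots> \<le> A * dist w' (fst w', 0)"
      by (rule lipschitz_onD[OF A]) (use w' \<sigma> in auto)
    also have "dist w' (fst w', 0) = \<bar>snd w'\<bar>" by (cases w') (simp add: dist_Pair_Pair dist_real_def)
    also have "A * \<bar>snd w'\<bar> \<le> A * \<sigma>" using A0 w' by (intro mult_left_mono) auto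
    also have "A * \<sigma> < \<sigma> * (A + 1)" using \<sigma> by (simp add: algebra_simps)
    finally show False using \<sigma>(3) by simp
  qed
  then show ?thesis using that \<sigma> by blast
qed

text \<open>An inverse function theorem with uniform radii. On the sphere of radius \<rho> about u,
  \<open>K\<close> keeps distance at least m \<rho> from K u. Inside the ball of that radius the
  images of the open and of the closed \<rho>-ball therefore agree, so this set is both open and
  closed there, and connectedness makes it the whole ball.\<close>

lemma K_ball_cover:
  obtains \<rho> c m where "\<rho> > 0" "\<rho> \<le> 1/8" "c > 0" "m > 0"
    "\<And>u. u \<in> band (1/4) \<Longrightarrow> ball (K u) c \<subseteq> K ` ball u \<rho>"
    "\<And>u v. u \<in> band (1/2) \<Longrightarrow> v \<in> band (1/2) \<Longrightarrow> norm (u - v) \<le> 2 * \<rho> \<Longrightarrow> m * norm (u - v) \<le> norm (K u - K v)"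
proof -
  obtain \<rho>' m where \<rho>': "\<rho>' > 0" and m: "m > 0"
    "\<And>u v. u \<in> band (1/2) \<Longrightarrow> v \<in> band (1/2) \<Longrightarrow> norm (u - v) \<le> \<rho>' \<Longrightarrow> m * norm (u - v) \<le> norm (K u - K v)"
    using K_expanding by blast
  \<comment> \<open>The bound 1/8 keeps balls centred in \<open>band (1/4)\<close> away from the
    edge of \<open>band (1/2)\<close>. The halving is there because two points of one ball can be
    almost 2 \<rho> apart.\<close>
  define \<rho> where "\<rho> = min (1/8) (\<rho>' / 2)"
  have \<rho>: "\<rho> > 0" "\<rho> \<le> 1/8" "2 * \<rho> \<le> \<rho>'" using \<rho>' by (auto simp: \<rho>_def)
  have inner: "cball u \<rho> \<subseteq> band (1/2)" if "u \<in> band (1/4)" for u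
  proof
    fix v assume "v \<in> cball u \<rho>"
    then have "\<bar>snd u - snd v\<bar> \<le> 1/8"
      using dist_snd_le[of u v] \<rho> by (simp add: dist_real_def)
    moreover have "\<bar>snd u\<bar> \<le> 1/4" using that by simp
    ultimately have "\<bar>snd v\<bar> \<le> 1/2" by linarith
    then show "v \<in> band (1/2)" by simp
  qed
  have "ball (K u) (m * \<rho>) \<subseteq> K ` ball u \<rho>" if u: "u \<in> band (1/4)" for u
  proof -
    define B where "B = ball (K u) (m * \<rho>)"
    have ub: "u \<in> band (1/2)" using u by auto
    have far: "K v \<notin> B" if "v \<in> sphere u \<rho>" for v
    proof -
      have "m * norm (u - v) \<le> norm (K u - K v)"
        by (rule m(2)[OF ub]) (use that inner[OF u] \<rho> in \<open>auto simp: dist_norm\<close>)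
      then show ?thesis using that by (simp add: B_def dist_norm)
    qed
    have inner1: "cball u \<rho> \<subseteq> band 1" using inner[OF u] by fastforce
    have "open (K ` ball u \<rho>)"
      by (rule K_open_map[OF open_ball order_trans[OF ball_subset_cball inner1]])
    then have "openin (top_of_set B) (B \<inter> K ` ball u \<rho>)" by (simp add: openin_open_Int)
    moreover have "compact (K ` cball u \<rho>)"
      by (rule compact_continuous_image[OF continuous_on_subset[OF K_continuous]])
        (use inner1 in auto)
    then have "closedin (top_of_set B) (B \<inter> K ` cball u \<rho>)"
      by (simp add: closedin_closed_Int compact_imp_closed)
    moreover have "B \<inter> K ` cball u \<rho> = B \<inter> K ` ball u \<rho>"
      using far by (force simp: less_le)
    ultimately have "openin (top_of_set B) (B \<inter> K ` ball u \<rho>) \<and> closedin (top_of_set B) (B \<inter> K ` ball u \<rho>)"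
      by simp
    moreover have "connected B" unfolding B_def by (rule connected_ball)
    ultimately have "B \<inter> K ` ball u \<rho> = {} \<or> B \<inter> K ` ball u \<rho> = B"
      unfolding connected_clopen by (elim allE) (erule mp)
    moreover have "K u \<in> B \<inter> K ` ball u \<rho>" using \<rho> m by (simp add: B_def)
    ultimately show ?thesis unfolding B_def by blast
  qed
  moreover have "m * norm (u - v) \<le> norm (K u - K v)"
    if "u \<in> band (1/2)" "v \<in> band (1/2)" "norm (u - v) \<le> 2 * \<rho>" for u v
    by (rule m(2)) (use that \<rho> in auto)
  moreover have "m * \<rho> > 0" using m \<rho> by simp
  ultimately show ?thesis using that \<rho> m(1) by blast
qed

text \<open>As c does not depend on the centre, one neighbourhood T of y serves all, possibly
  infinitely many, points of the fibre. The narrowness assumption keeps the fibre in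
  \<open>band (1/4)\<close>, so no \<rho>-ball around a fibre point reaches the edge and every sheet
  maps onto all of T. Expansion at scale 2 \<rho> makes \<open>K\<close> injective on each sheet and
  keeps the sheets over different fibre points disjoint.\<close>

lemma K_covering:
  assumes \<sigma>: "\<sigma> > 0" "\<sigma> \<le> 1/4" "\<And>w. w \<in> band (1/2) \<Longrightarrow> K w \<in> tube \<sigma> \<Longrightarrow> w \<in> band (1/4)"
  shows "covering_space {w. \<bar>snd w\<bar> < 1/2 \<and> K w \<in> tube \<sigma>} K (tube \<sigma>)"
proof
  let ?C = "{w. \<bar>snd w\<bar> < 1/2 \<and> K w \<in> tube \<sigma>}"
  obtain \<rho> c m where \<rho>: "\<rho> > 0" "\<rho> \<le> 1/8" "c > 0" and m: "m > 0"
    and cover: "\<And>u. u \<in> band (1/4) \<Longrightarrow> ball (K u) c \<subseteq> K ` ball u \<rho>"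
    and inj: "\<And>u v. u \<in> band (1/2) \<Longrightarrow> v \<in> band (1/2) \<Longrightarrow> norm (u - v) \<le> 2 * \<rho> \<Longrightarrow> m * norm (u - v) \<le> norm (K u - K v)"
    using K_ball_cover by blast
  show contC: "continuous_on ?C K"
    by (rule continuous_on_subset[OF K_continuous]) auto
  show "K ` ?C = tube \<sigma>" using \<sigma>(2) by (force simp: tube_def)
  have near: "\<bar>snd z\<bar> < 1/2" if "z \<in> ball w \<rho>" "w \<in> band (1/4)" for z w
  proof -
    have "\<bar>snd w - snd z\<bar> < 1/8" using that dist_snd_le[of w z] \<rho> by (simp add: dist_real_def)
    moreover have "\<bar>snd w\<bar> \<le> 1/4" using that by simp
    ultimately show ?thesis by linarith
  qed
  fix y assume y: "y \<in> tube \<sigma>"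
  define T where "T = ball y c \<inter> tube \<sigma>"
  define fib where "fib = {w. \<bar>snd w\<bar> < 1/2 \<and> K w = y}"
  define sheet where "sheet w = {z \<in> ball w \<rho>. K z \<in> T}" for w
  have fib: "w \<in> band (1/4)" "w \<in> band (1/2)" "K w = y" if "w \<in> fib" for w
    using that \<sigma>(3)[of w] y by (auto simp: fib_def)
  show "\<exists>T. y \<in> T \<and> openin (top_of_set (tube \<sigma>)) T \<and>
      (\<exists>v. \<Union> v = ?C \<inter> K -` T \<and> (\<forall>u\<in>v. openin (top_of_set ?C) u) \<and> pairwise disjnt v \<and>
        (\<forall>u\<in>v. \<exists>q. homeomorphism u T K q))"
  proof (intro exI[of _ T] exI[of _ "sheet ` fib"] conjI ballI)
    show "y \<in> T" using y \<rho> by (simp add: T_def)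
    show "openin (top_of_set (tube \<sigma>)) T"
      unfolding T_def by (subst Int_commute) (simp add: openin_open_Int)
    show "\<Union> (sheet ` fib) = ?C \<inter> K -` T"
    proof (intro equalityI subsetI)
      fix z assume "z \<in> \<Union> (sheet ` fib)"
      then obtain w where w: "w \<in> fib" "z \<in> ball w \<rho>" and "K z \<in> T" by (auto simp: sheet_def)
      moreover have "\<bar>snd z\<bar> < 1/2" by (rule near[OF w(2) fib(1)[OF w(1)]])
      ultimately show "z \<in> ?C \<inter> K -` T" by (simp add: T_def)
    next
      fix z assume z: "z \<in> ?C \<inter> K -` T"
      then have zb: "z \<in> band (1/4)" using \<sigma>(3)[of z] by auto
      \<comment> \<open>The covering radius is used at z rather than at a fibre point: it produces
        the fibre point whose sheet contains z.\<close>
      moreover have "y \<in> ball (K z) c" using z by (simp add: T_def dist_commute)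
      ultimately obtain w where w: "w \<in> ball z \<rho>" "K w = y" using cover by blast
      then have "w \<in> fib" using near[OF w(1) zb] by (simp add: fib_def)
      moreover have "z \<in> sheet w" using w z by (simp add: sheet_def dist_commute)
      ultimately show "z \<in> \<Union> (sheet ` fib)" by blast
    qed
    show "pairwise disjnt (sheet ` fib)"
    proof (rule pairwiseI)
      fix S S' assume "S \<in> sheet ` fib" "S' \<in> sheet ` fib" and ne: "S \<noteq> S'"
      then obtain w w' where w: "w \<in> fib" "S = sheet w" "w' \<in> fib" "S' = sheet w'" by blast
      show "disjnt S S'"
      proof (rule ccontr)
        assume "\<not> disjnt S S'"
        then obtain z where "dist w z < \<rho>" "dist w' z < \<rho>"
          using w by (auto simp: disjnt_iff sheet_def)
        then have "norm (w - w') \<le> 2 * \<rho>"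
          using dist_triangle2[of w w' z] by (simp add: dist_norm)
        then have "m * norm (w - w') \<le> norm (K w - K w')"
          using inj fib w by blast
        then have "m * norm (w - w') \<le> 0" using fib w by simp
        then have "w = w'" using m by (simp add: mult_le_0_iff)
        then show False using ne w by simp
      qed
    qed
    fix S assume "S \<in> sheet ` fib"
    then obtain w where w: "w \<in> fib" and S: "S = sheet w" by blast
    have sub: "S \<subseteq> ?C"
    proof
      fix z assume z: "z \<in> S"
      have "\<bar>snd z\<bar> < 1/2" by (rule near[OF _ fib(1)[OF w]]) (use z in \<open>simp add: S sheet_def\<close>)
      then show "z \<in> ?C" using z by (simp add: S sheet_def T_def)
    qed
    show "openin (top_of_set ?C) S"
    proof -
      have "openin (top_of_set ?C) (?C \<inter> K -` ball y c)"
        by (rule continuous_openin_preimage_gen[OF contC open_ball])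
      then have "openin (top_of_set ?C) ((?C \<inter> K -` ball y c) \<inter> ball w \<rho>)"
        by (rule openin_Int_open) simp
      moreover have "S = (?C \<inter> K -` ball y c) \<inter> ball w \<rho>"
        using sub by (auto simp: S sheet_def T_def)
      ultimately show ?thesis by simp
    qed
    have Sinj: "m * norm (u - v) \<le> norm (K u - K v)" if "u \<in> S" "v \<in> S" for u v
    proof (rule inj)
      show "norm (u - v) \<le> 2 * \<rho>"
        using that dist_triangle3[of u v w] by (simp add: S sheet_def dist_norm)
    qed (use that sub in force)+
    have "inj_on K S"
    proof (rule inj_onI)
      fix a b assume "a \<in> S" "b \<in> S" "K a = K b"
      then have "m * norm (a - b) \<le> 0" using Sinj[of a b] by simp
      then show "a = b" using m by (simp add: mult_le_0_iff)
    qed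
    have img: "K ` S = T"
    proof (intro equalityI subsetI)
      fix t assume t: "t \<in> T"
      then have "t \<in> ball (K w) c" using fib[OF w] by (simp add: T_def)
      then obtain z where "z \<in> ball w \<rho>" "t = K z" using cover[OF fib(1)[OF w]] by blast
      then show "t \<in> K ` S" using t by (auto simp: S sheet_def)
    qed (auto simp: S sheet_def)
    define q where "q = inv_into S K"
    have qS: "q t \<in> S" "K (q t) = t" if "t \<in> T" for t
      using that img by (auto simp: q_def inv_into_into f_inv_into_f)
    have "(1/m)-lipschitz_on T q"
    proof (rule lipschitz_onI)
      fix a b assume "a \<in> T" "b \<in> T"
      then show "dist (q a) (q b) \<le> 1 / m * dist a b"
        using Sinj[of "q a" "q b"] qS m by (simp add: dist_norm field_simps)
    qed (use m in simp)
    then have "homeomorphism S T K q"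
      using img qS \<open>inj_on K S\<close> continuous_on_subset[OF contC sub]
      by (intro homeomorphismI) (auto simp: q_def lipschitz_on_continuous_on)
    then show "\<exists>q. homeomorphism S T K q" by blast
  qed
qed

section \<open>Lifting curves from the tube to the strip\<close>

lemma K_lift:
  assumes \<sigma>: "\<sigma> > 0" "\<sigma> \<le> 1/4" "\<And>w. w \<in> band (1/2) \<Longrightarrow> K w \<in> tube \<sigma> \<Longrightarrow> w \<in> band (1/4)"
    and x: "continuous_on UNIV x" "\<And>t::real. x t \<in> tube \<sigma>"
  obtains u where "continuous_on UNIV u" "\<And>t. u t \<in> band (1/4)" "\<And>t. K (u t) = x t"
proof -
  obtain u where u: "continuous_on UNIV u" "u \<in> UNIV \<rightarrow> {w. \<bar>snd w\<bar> < 1/2 \<and> K w \<in> tube \<sigma>}"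
    "\<And>t. t \<in> UNIV \<Longrightarrow> K (u t) = x t"
    using covering_space_lift[OF K_covering[OF \<sigma>], of UNIV x] x
    by (auto simp: convex_imp_simply_connected convex_imp_locally_path_connected)
  have "u t \<in> band (1/4)" for t
  proof (rule \<sigma>(3))
    have "u t \<in> {w. \<bar>snd w\<bar> < 1/2 \<and> K w \<in> tube \<sigma>}" using u(2) by blast
    then show "u t \<in> band (1/2)" "K (u t) \<in> tube \<sigma>" by auto
  qed
  then show ?thesis using that u by blast
qed

text \<open>By continuity the lift coincides near t with the local inverse of \<open>K\<close>
  applied to x, which is differentiable; the chain rule for \<open>K\<close> then identifies the
  derivative.\<close>

lemma lift_has_vector_derivative:
  assumes u: "continuous_on UNIV u" "\<And>t. \<bar>snd (u t)\<bar> \<le> 1" "\<And>t. K (u t) = x t"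
    and x: "(x has_vector_derivative x') (at t)"
  shows "(u has_vector_derivative J (u t) x') (at t)"
proof -
  obtain U V g where g: "open U" "u t \<in> U" "open V" "homeomorphism U V K g" "g differentiable (at (K (u t)))"
    using K_local_inverse[OF u(2)] .
  have op: "open (u -` U)" using u(1) g(1) by (simp add: continuous_on_open_vimage)
  have "x differentiable (at t)" using x differentiableI_vector by blast
  moreover have "g differentiable (at (x t))" using g(5) u(3) by simp
  ultimately have "(\<lambda>t. g (x t)) differentiable (at t)"
    using differentiable_chain_at[of x t g] by (simp add: o_def)
  then obtain u' where "((\<lambda>t. g (x t)) has_vector_derivative u') (at t)"
    using vector_derivative_works by blast
  then have u': "(u has_vector_derivative u') (at t)"
  proof (rule has_vector_derivative_transform_within_open[OF _ op])
    show "t \<in> u -` U" using g by simp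
    show "g (x s) = u s" if "s \<in> u -` U" for s
      using that g(4) u(3)[of s] unfolding homeomorphism_def by (metis vimageE)
  qed
  have "((\<lambda>t. K (u t)) has_vector_derivative DK (u t) u') (at t)"
    by (rule K_chain[OF u(2) u'])
  moreover have "(\<lambda>t. K (u t)) = x" using u(3) by auto
  ultimately have "DK (u t) u' = x'" using x vector_derivative_unique_at by metis
  then have "J (u t) x' = u'" using J_DK[OF u(2)] by metis
  then show ?thesis using u' by simp
qed

end

section \<open>Uniqueness of bounded solutions on the whole line\<close>

text \<open>Variation of constants from minus infinity: the derivative of exp (\<kappa> s) f(s) is
  exp (\<kappa> s) g(s), and boundedness of f makes exp (\<kappa> s) f(s) negligible as s goes to
  minus infinity. The value of B thus does not enter the conclusion, which is what lets a crude
  bound be improved. For s \<le> t one has |s| \<le> |t| + (t - s), and \<mu> < \<kappa> makes the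
  weighted forcing integrable.\<close>

lemma slow_component_upper:
  fixes f g :: "real \<Rightarrow> real"
  assumes f: "\<And>s. (f has_real_derivative - \<kappa> * f s + g s) (at s)"
    and g: "\<And>s. g s \<le> M * exp (\<mu> * \<bar>s\<bar>)" and B: "\<And>s. f s \<le> B"
    and M: "M \<ge> 0" and \<mu>: "0 \<le> \<mu>" "\<mu> < \<kappa>"
  shows "f t \<le> M / (\<kappa> - \<mu>) * exp (\<mu> * \<bar>t\<bar>)"
proof -
  \<comment> \<open>With this A, the derivative of \<psi> at x is exp (\<kappa> x) times the
    majorant M exp (\<mu> (|t| + t - x)) of the forcing.\<close>
  define A where "A = M * exp (\<mu> * \<bar>t\<bar> + \<mu> * t) / (\<kappa> - \<mu>)"
  define \<psi> where "\<psi> s = A * exp ((\<kappa> - \<mu>) * s)" for s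
  define G where "G s = exp (\<kappa> * s) * f s - \<psi> s" for s
  have A: "A \<ge> 0" using M \<mu> by (simp add: A_def)
  have G: "G t \<le> G s" if "s \<le> t" for s
  proof (rule DERIV_nonpos_imp_nonincreasing[OF that])
    fix x assume x: "s \<le> x" "x \<le> t"
    have "(G has_real_derivative exp (\<kappa> * x) * g x - A * ((\<kappa> - \<mu>) * exp ((\<kappa> - \<mu>) * x))) (at x)"
      unfolding G_def \<psi>_def by (rule derivative_eq_intros f refl)+ (simp add: algebra_simps)
    moreover have "exp (\<kappa> * x) * g x \<le> A * ((\<kappa> - \<mu>) * exp ((\<kappa> - \<mu>) * x))"
    proof -
      have "\<mu> * \<bar>x\<bar> \<le> \<mu> * (\<bar>t\<bar> + (t - x))" using \<mu>(1) x by (intro mult_left_mono) auto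
      then have "M * exp (\<mu> * \<bar>x\<bar>) \<le> M * exp (\<mu> * (\<bar>t\<bar> + (t - x)))"
        using M by (intro mult_left_mono) auto
      then have "g x \<le> M * exp (\<mu> * (\<bar>t\<bar> + (t - x)))" using g[of x] by linarith
      then have "exp (\<kappa> * x) * g x \<le> exp (\<kappa> * x) * (M * exp (\<mu> * (\<bar>t\<bar> + (t - x))))"
        by (intro mult_left_mono) auto
      also have "\<dots> = M * exp ((\<mu> * \<bar>t\<bar> + \<mu> * t) + (\<kappa> - \<mu>) * x)"
        by (simp add: algebra_simps flip: exp_add)
      also have "\<dots> = A * ((\<kappa> - \<mu>) * exp ((\<kappa> - \<mu>) * x))"
        using \<mu>(2) by (simp add: A_def exp_add)
      finally show ?thesis .
    qed
    ultimately show "\<exists>y. (G has_real_derivative y) (at x) \<and> y \<le> 0"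
      by (intro exI conjI) auto
  qed
  have key: "exp (\<kappa> * t) * f t \<le> \<psi> t + exp (\<kappa> * s) * B" if "s \<le> t" for s
  proof -
    have "\<psi> s \<ge> 0" using A by (simp add: \<psi>_def)
    moreover have "exp (\<kappa> * s) * f s \<le> exp (\<kappa> * s) * B" using B by simp
    ultimately show ?thesis using G[OF that] unfolding G_def by linarith
  qed
  have "((\<lambda>s. \<psi> t + exp (\<kappa> * s) * B) \<longlongrightarrow> \<psi> t + 0 * B) at_bot"
  proof (intro tendsto_add tendsto_mult tendsto_const)
    have "filterlim (\<lambda>s. \<kappa> * s) at_bot at_bot"
      using \<mu> by (intro filterlim_tendsto_pos_mult_at_bot[OF tendsto_const]) (auto simp: filterlim_ident)
    then show "((\<lambda>s. exp (\<kappa> * s)) \<longlongrightarrow> 0) at_bot"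
      by (rule filterlim_compose[OF exp_at_bot])
  qed
  moreover have "\<forall>\<^sub>F s in at_bot. exp (\<kappa> * t) * f t \<le> \<psi> t + exp (\<kappa> * s) * B"
    by (rule eventually_mono[OF eventually_le_at_bot[of t] key])
  ultimately have "exp (\<kappa> * t) * f t \<le> \<psi> t"
    using tendsto_lowerbound[of "\<lambda>s. \<psi> t + exp (\<kappa> * s) * B" "\<psi> t" at_bot] by simp
  also have "\<psi> t = exp (\<kappa> * t) * (M / (\<kappa> - \<mu>) * exp (\<mu> * \<bar>t\<bar>))"
    by (simp add: \<psi>_def A_def exp_add exp_diff algebra_simps)
  finally show ?thesis by (simp only: mult_le_cancel_left_pos exp_gt_zero)
qed

lemma slow_component_bound:
  fixes f g :: "real \<Rightarrow> real"
  assumes f: "\<And>s. (f has_real_derivative - \<kappa> * f s + g s) (at s)"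
    and g: "\<And>s. \<bar>g s\<bar> \<le> M * exp (\<mu> * \<bar>s\<bar>)" and B: "\<And>s. \<bar>f s\<bar> \<le> B"
    and \<mu>: "0 \<le> \<mu>" "\<mu> < \<kappa>"
  shows "\<bar>f t\<bar> \<le> M / (\<kappa> - \<mu>) * exp (\<mu> * \<bar>t\<bar>)"
proof -
  have M: "M \<ge> 0" using g[of 0] by simp
  have "f t \<le> M / (\<kappa> - \<mu>) * exp (\<mu> * \<bar>t\<bar>)"
  proof (rule slow_component_upper[OF f _ _ M \<mu>])
    show "g s \<le> M * exp (\<mu> * \<bar>s\<bar>)" "f s \<le> B" for s using g[of s] B[of s] by auto
  qed
  moreover have "- f t \<le> M / (\<kappa> - \<mu>) * exp (\<mu> * \<bar>t\<bar>)"
  proof (rule slow_component_upper[OF _ _ _ M \<mu>])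
    show "((\<lambda>s. - f s) has_real_derivative - \<kappa> * - f s + - g s) (at s)" for s
      using DERIV_minus[OF f[of s]] by (simp add: algebra_simps)
    show "- g s \<le> M * exp (\<mu> * \<bar>s\<bar>)" "- f s \<le> B" for s using g[of s] B[of s] by auto
  qed
  ultimately show ?thesis by linarith
qed

lemma drift_upper:
  fixes f f' :: "real \<Rightarrow> real"
  assumes f: "\<And>s. (f has_real_derivative f' s) (at s)" and f0: "f 0 = 0"
    and f': "\<And>s. s \<ge> 0 \<Longrightarrow> f' s \<le> M * exp (\<mu> * s)" and M: "M \<ge> 0" and \<mu>: "\<mu> > 0" and t: "t \<ge> 0"
  shows "f t \<le> M / \<mu> * exp (\<mu> * t)"
proof -
  define G where "G s = f s - M / \<mu> * exp (\<mu> * s)" for s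
  have "G t \<le> G 0"
  proof (rule DERIV_nonpos_imp_nonincreasing[OF t])
    fix x assume x: "0 \<le> x" "x \<le> t"
    have "(G has_real_derivative f' x - M * exp (\<mu> * x)) (at x)"
      unfolding G_def by (rule derivative_eq_intros f refl)+ (use \<mu> in simp)
    then show "\<exists>y. (G has_real_derivative y) (at x) \<and> y \<le> 0"
      using f'[OF x(1)] by (intro exI conjI) auto
  qed
  also have "G 0 \<le> 0" using M \<mu> f0 by (simp add: G_def)
  finally show ?thesis by (simp add: G_def)
qed

lemma drift_bound:
  fixes f f' :: "real \<Rightarrow> real"
  assumes f: "\<And>s. (f has_real_derivative f' s) (at s)" and f0: "f 0 = 0"
    and f': "\<And>s. \<bar>f' s\<bar> \<le> M * exp (\<mu> * \<bar>s\<bar>)" and \<mu>: "\<mu> > 0"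
  shows "\<bar>f t\<bar> \<le> M / \<mu> * exp (\<mu> * \<bar>t\<bar>)"
proof -
  have M: "M \<ge> 0" using f'[of 0] by simp
  have half: "\<bar>k t\<bar> \<le> M / \<mu> * exp (\<mu> * t)"
    if k: "\<And>s. (k has_real_derivative k' s) (at s)" and k0: "k 0 = 0"
      and k': "\<And>s. \<bar>k' s\<bar> \<le> M * exp (\<mu> * \<bar>s\<bar>)" and t: "t \<ge> 0" for k k' t
  proof -
    have "k t \<le> M / \<mu> * exp (\<mu> * t)"
    proof (rule drift_upper[OF k k0 _ M \<mu> t])
      show "k' s \<le> M * exp (\<mu> * s)" if "s \<ge> 0" for s using k'[of s] that by simp
    qed
    moreover have "- k t \<le> M / \<mu> * exp (\<mu> * t)"
    proof (rule drift_upper[OF _ _ _ M \<mu> t])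
      show "((\<lambda>s. - k s) has_real_derivative - k' s) (at s)" for s
        by (rule DERIV_minus[OF k])
      show "- k' s \<le> M * exp (\<mu> * s)" if "s \<ge> 0" for s using k'[of s] that by simp
    qed (use k0 in simp)
    ultimately show ?thesis by linarith
  qed
  show ?thesis
  proof (cases "t \<ge> 0")
    case True
    then show ?thesis using half[OF f f0 f' True] by simp
  next
    case False
    \<comment> \<open>Negative times are reduced to positive ones by reflecting time; the weight is
      even.\<close>
    have "((\<lambda>s. f (- s)) has_real_derivative - f' (- s)) (at s)" for s
      using DERIV_mirror[of f "f' (- s)" s] f by simp
    then have "\<bar>f (- (- t))\<bar> \<le> M / \<mu> * exp (\<mu> * (- t))"
    proof (rule half)
      show "\<bar>- f' (- s)\<bar> \<le> M * exp (\<mu> * \<bar>s\<bar>)" for s using f'[of "- s"] by simp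
    qed (use f0 False in auto)
    then show ?thesis using False by simp
  qed
qed

text \<open>\<open>C1_map\<close> gives continuity of one directional derivative at a time. Bounds
  along the finitely many basis vectors add up to an operator norm bound on the ball.\<close>

lemma C1_map_lipschitz:
  fixes f :: "'a::euclidean_space \<Rightarrow> real"
  assumes "C1_map f"
  obtains C where "C-lipschitz_on (cball 0 M) f"
proof -
  have d: "(f has_derivative frechet_derivative f (at x)) (at x)" for x
    using assms unfolding C1_map_def by (simp add: frechet_derivative_works[symmetric])
  have "\<exists>B. \<forall>x\<in>cball 0 M. \<bar>frechet_derivative f (at x) b\<bar> \<le> B" for b
  proof -
    have "compact ((\<lambda>x. frechet_derivative f (at x) b) ` cball 0 M)"
      by (rule compact_continuous_image)
        (use assms continuous_on_subset[OF _ subset_UNIV] in \<open>auto simp: C1_map_def\<close>)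
    then show ?thesis by (auto simp: bounded_iff dest!: compact_imp_bounded)
  qed
  then obtain B where B: "\<And>b x. x \<in> cball 0 M \<Longrightarrow> \<bar>frechet_derivative f (at x) b\<bar> \<le> B b"
    by metis
  define C where "C = (\<Sum>b\<in>Basis. \<bar>B b\<bar>)"
  have "norm (f x - f y) \<le> C * norm (x - y)" if "x \<in> cball 0 M" "y \<in> cball 0 M" for x y
  proof (rule differentiable_bound[where S = "cball 0 M" and f' = "\<lambda>x. frechet_derivative f (at x)"])
    fix z :: 'a assume z: "z \<in> cball 0 M"
    show "(f has_derivative frechet_derivative f (at z)) (at z within cball 0 M)"
      by (rule has_derivative_at_withinI[OF d])
    show "onorm (frechet_derivative f (at z)) \<le> C"
    proof (rule onorm_bound)
      show "0 \<le> C" by (simp add: C_def sum_nonneg)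
      fix k :: 'a
      have lin: "linear (frechet_derivative f (at z))" using d has_derivative_linear by blast
      have "frechet_derivative f (at z) k = frechet_derivative f (at z) (\<Sum>b\<in>Basis. (k \<bullet> b) *\<^sub>R b)"
        by (simp add: euclidean_representation)
      also have "\<dots> = (\<Sum>b\<in>Basis. (k \<bullet> b) * frechet_derivative f (at z) b)"
        by (simp add: linear_sum[OF lin] linear_scale[OF lin])
      finally have "\<bar>frechet_derivative f (at z) k\<bar> \<le> (\<Sum>b\<in>Basis. \<bar>(k \<bullet> b) * frechet_derivative f (at z) b\<bar>)"
        by (metis sum_abs)
      also have "\<dots> \<le> (\<Sum>b\<in>Basis. norm k * \<bar>B b\<bar>)"
        unfolding abs_mult
      proof (intro sum_mono mult_mono)
        fix b :: 'a assume "b \<in> Basis"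
        then show "\<bar>k \<bullet> b\<bar> \<le> norm k" by (rule Basis_le_norm)
        show "\<bar>frechet_derivative f (at z) b\<bar> \<le> \<bar>B b\<bar>" using B[OF z, of b] by linarith
      qed auto
      also have "\<dots> = C * norm k" by (simp add: C_def mult.commute flip: sum_distrib_left)
      finally show "norm (frechet_derivative f (at z) k) \<le> C * norm k" by simp
    qed
  qed (use that in auto)
  moreover have "C \<ge> 0" by (simp add: C_def sum_nonneg)
  ultimately show ?thesis by (intro that[of C] lipschitz_onI) (auto simp: dist_norm)
qed

lemma norm_Pair_le_sum: "norm (u :: real \<times> real) \<le> \<bar>fst u\<bar> + \<bar>snd u\<bar>"
  using norm_Pair_le[of "fst u" "snd u"] by simp

lemma abs_fst_le_norm: "\<bar>fst u\<bar> \<le> norm (u :: real \<times> real)"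
  and abs_snd_le_norm: "\<bar>snd u\<bar> \<le> norm (u :: real \<times> real)"
  using norm_fst_le[of "fst u" "snd u"] norm_snd_le[of "snd u" "fst u"] by simp_all

section \<open>The delay equation in the coordinates \<open>K\<close>\<close>

context delay_perturbation
begin

text \<open>The band condition, for all times, belongs to the notion: boundedness in the past is
  what singles out the radial component, and the delayed point has to lie where \<open>H\<close> is
  controlled.\<close>

definition lifted :: "real \<Rightarrow> (real \<Rightarrow> real \<times> real) \<Rightarrow> bool" where
  "lifted \<epsilon> u \<longleftrightarrow> (\<forall>t. u t \<in> band (1/2)) \<and>
     (\<forall>t. (u has_vector_derivative (\<omega>\<^sub>0, lam\<^sub>0 * snd (u t)) + H \<epsilon> (u t) (u (t - r (K (u t))))) (at t))"

lemma lifted_band: "lifted \<epsilon> u \<Longrightarrow> u t \<in> band (1/2)"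
  by (simp add: lifted_def)

lemma lifted_derivative:
  "lifted \<epsilon> u \<Longrightarrow>
    (u has_vector_derivative (\<omega>\<^sub>0, lam\<^sub>0 * snd (u t)) + H \<epsilon> (u t) (u (t - r (K (u t))))) (at t)"
  by (simp add: lifted_def)

lemma X_split:
  assumes "\<bar>snd u\<bar> \<le> 1"
  shows "X (K u, \<epsilon> *\<^sub>R K v) = DK u ((\<omega>\<^sub>0, lam\<^sub>0 * snd u) + H \<epsilon> u v)"
  using K_flow_eq[OF assms] by (simp add: blinfun.add_right H_def DK_J[OF assms] F_def)

lemma lifted_dde:
  assumes "lifted \<epsilon> u"
  shows "dde_solution X r \<epsilon> (\<lambda>t. K (u t))"
  unfolding dde_solution_def
proof
  fix t
  have b: "\<bar>snd (u t)\<bar> \<le> 1" using lifted_band[OF assms, of t] by simp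
  show "((\<lambda>t. K (u t)) has_vector_derivative X (K (u t), \<epsilon> *\<^sub>R K (u (t - r (K (u t)))))) (at t)"
    unfolding X_split[OF b] by (rule K_chain[OF b lifted_derivative[OF assms]])
qed

lemma dde_lifted:
  assumes u: "continuous_on UNIV u" "\<And>t. u t \<in> band (1/2)" and x: "dde_solution X r \<epsilon> (\<lambda>t. K (u t))"
  shows "lifted \<epsilon> u"
  unfolding lifted_def
proof (intro conjI allI u)
  fix t
  have b: "\<bar>snd (u t)\<bar> \<le> 1" for t using u(2)[of t] by simp
  have "((\<lambda>t. K (u t)) has_vector_derivative DK (u t) ((\<omega>\<^sub>0, lam\<^sub>0 * snd (u t)) + H \<epsilon> (u t) (u (t - r (K (u t)))))) (at t)"
    unfolding X_split[OF b, symmetric] using x by (simp add: dde_solution_def)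
  from lift_has_vector_derivative[OF u(1) b refl this]
  show "(u has_vector_derivative (\<omega>\<^sub>0, lam\<^sub>0 * snd (u t)) + H \<epsilon> (u t) (u (t - r (K (u t))))) (at t)"
    by (simp add: J_DK[OF b])
qed

lemma lifted_fst:
  assumes "lifted \<epsilon> u"
  shows "((\<lambda>t. fst (u t)) has_real_derivative \<omega>\<^sub>0 + fst (H \<epsilon> (u t) (u (t - r (K (u t)))))) (at t)"
  using bounded_linear.has_vector_derivative[OF bounded_linear_fst lifted_derivative[OF assms]]
  by (simp add: has_real_derivative_iff_has_vector_derivative)

text \<open>The double sign displays the decay rate \<kappa> = \<open>- lam\<^sub>0\<close> expected
  by \<open>slow_component_bound\<close>.\<close>

lemma lifted_snd:
  assumes "lifted \<epsilon> u"
  shows "((\<lambda>t. snd (u t)) has_real_derivative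
    - (- lam\<^sub>0) * snd (u t) + snd (H \<epsilon> (u t) (u (t - r (K (u t)))))) (at t)"
  using bounded_linear.has_vector_derivative[OF bounded_linear_snd lifted_derivative[OF assms]]
  by (simp add: has_real_derivative_iff_has_vector_derivative)

lemma lifted_snd_small:
  obtains C where "C > 0" "\<And>\<epsilon> u t. 0 \<le> \<epsilon> \<Longrightarrow> \<epsilon> \<le> 1 \<Longrightarrow> lifted \<epsilon> u \<Longrightarrow> \<bar>snd (u t)\<bar> \<le> C * \<epsilon>"
proof -
  obtain C where C: "C > 0"
    "\<And>\<epsilon> u v. 0 \<le> \<epsilon> \<Longrightarrow> \<epsilon> \<le> 1 \<Longrightarrow> u \<in> band (1/2) \<Longrightarrow> v \<in> band (1/2) \<Longrightarrow> norm (H \<epsilon> u v) \<le> C * \<epsilon>"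
    using H_bounds by metis
  have "\<bar>snd (u t)\<bar> \<le> C / (- lam\<^sub>0) * \<epsilon>" if e: "0 \<le> \<epsilon>" "\<epsilon> \<le> 1" and u: "lifted \<epsilon> u" for \<epsilon> u t
  proof -
    \<comment> \<open>Weight exponent 0: forcing of size C \<epsilon> against the decay rate
      \<open>- lam\<^sub>0\<close>. The a priori bound 1/2 serves only as boundedness.\<close>
    have "\<bar>snd (u t)\<bar> \<le> C * \<epsilon> / (- lam\<^sub>0 - 0) * exp (0 * \<bar>t\<bar>)"
    proof (rule slow_component_bound[OF lifted_snd[OF u]])
      show "\<bar>snd (H \<epsilon> (u s) (u (s - r (K (u s)))))\<bar> \<le> C * \<epsilon> * exp (0 * \<bar>s\<bar>)" for s
        using C(2)[OF e lifted_band[OF u] lifted_band[OF u], of s "s - r (K (u s))"]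
          abs_snd_le_norm[of "H \<epsilon> (u s) (u (s - r (K (u s))))"] by simp
      show "\<bar>snd (u s)\<bar> \<le> 1/2" for s using lifted_band[OF u, of s] by simp
    qed (use lam_neg in auto)
    then show ?thesis by simp
  qed
  moreover have "C / (- lam\<^sub>0) > 0" using C(1) lam_neg by (simp add: divide_pos_neg)
  ultimately show ?thesis using that by blast
qed

text \<open>The difference of two solutions is measured against the weight \<^term>\<open>\<lambda>t::real. exp (\<mu> * \<bar>t\<bar>)\<close> with
  \<open>\<mu> = - lam\<^sub>0 / 2\<close>, for which the linear part gains a fixed factor while the perturbation has a
  Lipschitz constant of order \<^term>\<open>\<epsilon>::real\<close>; a bound on the weighted difference can then be halved.\<close>

lemma lifted_unique:
  obtains \<delta> where "\<delta> > 0" "\<And>\<epsilon> u v t. 0 \<le> \<epsilon> \<Longrightarrow> \<epsilon> < \<delta> \<Longrightarrow> lifted \<epsilon> u \<Longrightarrow> lifted \<epsilon> v \<Longrightarrow>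
      fst (u 0) = fst (v 0) \<Longrightarrow> u t = v t"
proof -
  obtain C where C: "C > 0"
    "\<And>\<epsilon> u v. 0 \<le> \<epsilon> \<Longrightarrow> \<epsilon> \<le> 1 \<Longrightarrow> u \<in> band (1/2) \<Longrightarrow> v \<in> band (1/2) \<Longrightarrow> norm (H \<epsilon> u v) \<le> C * \<epsilon>"
    "\<And>\<epsilon> u v u' v'. 0 \<le> \<epsilon> \<Longrightarrow> \<epsilon> \<le> 1 \<Longrightarrow> u \<in> band (1/2) \<Longrightarrow> v \<in> band (1/2) \<Longrightarrow>
        u' \<in> band (1/2) \<Longrightarrow> v' \<in> band (1/2) \<Longrightarrow>
        norm (H \<epsilon> u v - H \<epsilon> u' v') \<le> C * \<epsilon> * (norm (u - u') + norm (v - v'))"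
    using H_bounds by blast
  obtain L where L: "L-lipschitz_on (band (1/2)) K" using K_lipschitz .
  obtain M where M: "M > 0" "\<And>u. u \<in> band (1/2) \<Longrightarrow> norm (K u) \<le> M" using K_bounded by blast
  obtain R where R: "R-lipschitz_on (cball 0 M) r" using C1_map_lipschitz[OF r_C1] .
  have L0: "L \<ge> 0" and R0: "R \<ge> 0" using L R by (auto dest: lipschitz_on_nonneg)
  have rK: "\<bar>r (K a) - r (K b)\<bar> \<le> R * L * norm (a - b)" if "a \<in> band (1/2)" "b \<in> band (1/2)" for a b
  proof -
    have "\<bar>r (K a) - r (K b)\<bar> \<le> R * norm (K a - K b)"
      using lipschitz_on_le_diff[OF R, of "K a" "K b"] M(2) that by simp
    also have "\<dots> \<le> R * (L * norm (a - b))"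
      by (intro mult_left_mono lipschitz_on_le_diff[OF L] that R0)
    finally show ?thesis by simp
  qed
  define \<mu> where "\<mu> = - lam\<^sub>0 / 2"
  have \<mu>: "\<mu> > 0" "\<mu> < - lam\<^sub>0" "- lam\<^sub>0 - \<mu> = \<mu>" using lam_neg by (auto simp: \<mu>_def)
  \<comment> \<open>A speed bound for all lifted solutions with \<epsilon> \<le> 1. It is needed to
    compare one solution at two different delayed times.\<close>
  define V where "V = \<omega>\<^sub>0 + \<bar>lam\<^sub>0\<bar> + C"
  have V: "V > 0" using omega_pos C(1) by (simp add: V_def add_pos_nonneg)
  have h: "h \<ge> 0" using r_nonneg r_le order_trans by blast
  \<comment> \<open>The three terms come from the current states, from two solutions at a common
    delayed time (reaching back by at most h raises the weight by at most exp (\<mu> h)), and from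
    one solution at two delayed times (speed times the Lipschitz constant R L of the delay).\<close>
  define E where "E = 1 + exp (\<mu> * h) + V * (R * L)"
  have E: "E > 0" using V R0 L0 by (simp add: E_def add_pos_nonneg)
  have speed: "norm (u t - u s) \<le> V * \<bar>t - s\<bar>" if e: "0 \<le> \<epsilon>" "\<epsilon> \<le> 1" and u: "lifted \<epsilon> u" for \<epsilon> u t s
  proof -
    have "norm (u t - u s) \<le> V * norm (t - s)"
    proof (rule differentiable_bound[OF convex_UNIV])
      show "(u has_derivative (\<lambda>h. h *\<^sub>R ((\<omega>\<^sub>0, lam\<^sub>0 * snd (u z)) + H \<epsilon> (u z) (u (z - r (K (u z))))))) (at z within UNIV)" for z
        using lifted_derivative[OF u, of z] unfolding has_vector_derivative_def .
      show "onorm (\<lambda>h. h *\<^sub>R ((\<omega>\<^sub>0, lam\<^sub>0 * snd (u z)) + H \<epsilon> (u z) (u (z - r (K (u z)))))) \<le> V" for z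
      proof (rule onorm_bound)
        let ?H = "H \<epsilon> (u z) (u (z - r (K (u z))))"
        have "norm ((\<omega>\<^sub>0, lam\<^sub>0 * snd (u z)) + ?H) \<le> norm (\<omega>\<^sub>0, lam\<^sub>0 * snd (u z)) + norm ?H"
          by (rule norm_triangle_ineq)
        also have "norm (\<omega>\<^sub>0, lam\<^sub>0 * snd (u z)) \<le> \<omega>\<^sub>0 + \<bar>lam\<^sub>0\<bar> * \<bar>snd (u z)\<bar>"
          using norm_Pair_le_sum[of "(\<omega>\<^sub>0, lam\<^sub>0 * snd (u z))"] omega_pos by (simp add: abs_mult)
        also have "\<bar>lam\<^sub>0\<bar> * \<bar>snd (u z)\<bar> \<le> \<bar>lam\<^sub>0\<bar> * 1"
          using lifted_band[OF u, of z] by (intro mult_left_mono) auto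
        also have "norm ?H \<le> C * \<epsilon>" by (rule C(2)[OF e lifted_band[OF u] lifted_band[OF u]])
        also have "C * \<epsilon> \<le> C * 1" using e C(1) by (intro mult_left_mono) auto
        finally have "norm ((\<omega>\<^sub>0, lam\<^sub>0 * snd (u z)) + ?H) \<le> V" by (simp add: V_def)
        then show "norm (k *\<^sub>R ((\<omega>\<^sub>0, lam\<^sub>0 * snd (u z)) + ?H)) \<le> V * norm k" for k :: real
          unfolding norm_scaleR real_norm_def[symmetric] by (subst mult.commute[of V]) (intro mult_left_mono norm_ge_zero)
      qed (use V in simp)
    qed auto
    then show ?thesis by simp
  qed
  \<comment> \<open>This makes C \<epsilon> E / \<mu> at most 1/4; \<open>diff_bound\<close>
    contributes a factor 2, which leaves the factor 1/2 of \<open>halve\<close>.\<close>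
  define \<delta> where "\<delta> = min 1 (\<mu> / (4 * C * E))"
  have \<delta>: "\<delta> > 0" using \<mu> C E by (simp add: \<delta>_def)
  have "u t = v t"
    if e: "0 \<le> \<epsilon>" "\<epsilon> < \<delta>" and u: "lifted \<epsilon> u" and v: "lifted \<epsilon> v" and eq: "fst (u 0) = fst (v 0)" for \<epsilon> u v t
  proof -
    have e1: "\<epsilon> \<le> 1" using e by (simp add: \<delta>_def)
    have small: "C * \<epsilon> * E / \<mu> \<le> 1/4"
    proof -
      have "\<epsilon> \<le> \<mu> / (4 * C * E)" using e by (simp add: \<delta>_def)
      then have "\<epsilon> * (4 * C * E) \<le> \<mu>" using C E by (simp add: pos_le_divide_eq)
      then show ?thesis using \<mu> by (simp add: divide_le_eq mult_ac)
    qed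
    note ub = lifted_band[OF u] and vb = lifted_band[OF v]
    define du where "du t = H \<epsilon> (u t) (u (t - r (K (u t))))" for t
    define dv where "dv t = H \<epsilon> (v t) (v (t - r (K (v t))))" for t
    have der1: "((\<lambda>t. fst (u t) - fst (v t)) has_real_derivative fst (du s - dv s)) (at s)" for s
      using DERIV_diff[OF lifted_fst[OF u, of s] lifted_fst[OF v, of s]] by (simp add: du_def dv_def)
    have der2: "((\<lambda>t. snd (u t) - snd (v t)) has_real_derivative
        - (- lam\<^sub>0) * (snd (u s) - snd (v s)) + snd (du s - dv s)) (at s)" for s
      using DERIV_diff[OF lifted_snd[OF u, of s] lifted_snd[OF v, of s]]
      by (simp add: du_def dv_def algebra_simps)
    have snd1: "\<bar>snd (u s) - snd (v s)\<bar> \<le> 1" for s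
    proof -
      have "\<bar>snd (u s)\<bar> \<le> 1/2" "\<bar>snd (v s)\<bar> \<le> 1/2" using ub[of s] vb[of s] by auto
      then show ?thesis by linarith
    qed
    \<comment> \<open>The choice of \<mu> gives \<open>- lam\<^sub>0 - \<mu> = \<mu>\<close>, so the
      angular and the radial component satisfy the same bound A / \<mu>; hence the factor 2.\<close>
    have diff_bound: "norm (u s - v s) \<le> 2 * (A / \<mu>) * exp (\<mu> * \<bar>s\<bar>)"
      if A: "\<And>s. norm (du s - dv s) \<le> A * exp (\<mu> * \<bar>s\<bar>)" for A s
    proof -
      have "\<bar>fst (u s) - fst (v s)\<bar> \<le> A / \<mu> * exp (\<mu> * \<bar>s\<bar>)"
      proof (rule drift_bound[OF der1 _ _ \<mu>(1)])
        show "\<bar>fst (du s - dv s)\<bar> \<le> A * exp (\<mu> * \<bar>s\<bar>)" for s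
          using order_trans[OF abs_fst_le_norm A[of s]] .
      qed (use eq in simp)
      moreover have "\<bar>snd (u s) - snd (v s)\<bar> \<le> A / (- lam\<^sub>0 - \<mu>) * exp (\<mu> * \<bar>s\<bar>)"
      proof (rule slow_component_bound[OF der2 _ snd1 _ \<mu>(2)])
        show "\<bar>snd (du s - dv s)\<bar> \<le> A * exp (\<mu> * \<bar>s\<bar>)" for s
          using order_trans[OF abs_snd_le_norm A[of s]] .
      qed (use \<mu>(1) in simp)
      ultimately show ?thesis
        using norm_Pair_le_sum[of "u s - v s"] unfolding \<mu>(3) fst_diff snd_diff by linarith
    qed
    have halve: "norm (u s - v s) \<le> D / 2 * exp (\<mu> * \<bar>s\<bar>)"
      if D: "\<And>s. norm (u s - v s) \<le> D * exp (\<mu> * \<bar>s\<bar>)" for D s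
    proof -
      have D0: "D \<ge> 0" using order_trans[OF norm_ge_zero D[of 0]] by simp
      have "norm (du s - dv s) \<le> (C * \<epsilon> * E * D) * exp (\<mu> * \<bar>s\<bar>)" for s
      proof -
        let ?a = "s - r (K (u s))" and ?b = "s - r (K (v s))" and ?w = "exp (\<mu> * \<bar>s\<bar>)"
        have "norm (u ?a - v ?a) \<le> D * exp (\<mu> * \<bar>?a\<bar>)" by (rule D)
        also have "\<dots> \<le> D * exp (\<mu> * (\<bar>s\<bar> + h))"
        proof -
          have "\<bar>?a\<bar> \<le> \<bar>s\<bar> + h" using r_nonneg[of "K (u s)"] r_le[of "K (u s)"] by linarith
          then show ?thesis using D0 \<mu>(1) by (intro mult_left_mono) simp_all
        qed
        finally have 1: "norm (u ?a - v ?a) \<le> exp (\<mu> * h) * (D * ?w)"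
          by (simp add: exp_add algebra_simps)
        have "norm (v ?a - v ?b) \<le> V * \<bar>?a - ?b\<bar>" by (rule speed[OF e(1) e1 v])
        also have "\<dots> \<le> V * (R * L * norm (u s - v s))"
          using rK[OF ub vb, of s s] V by (intro mult_left_mono) auto
        also have "\<dots> \<le> V * (R * L * (D * ?w))"
          using V R0 L0 D by (intro mult_left_mono) auto
        finally have 2: "norm (v ?a - v ?b) \<le> V * (R * L) * (D * ?w)" by simp
        have "norm (u ?a - v ?b) \<le> norm (u ?a - v ?a) + norm (v ?a - v ?b)"
          using norm_triangle_ineq[of "u ?a - v ?a" "v ?a - v ?b"] by simp
        then have 3: "norm (u s - v s) + norm (u ?a - v ?b) \<le> E * (D * ?w)"
          using 1 2 D[of s] by (simp add: E_def algebra_simps)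
        have "norm (du s - dv s) \<le> C * \<epsilon> * (norm (u s - v s) + norm (u ?a - v ?b))"
          unfolding du_def dv_def by (rule C(3)[OF e(1) e1 ub ub vb vb])
        also have "\<dots> \<le> C * \<epsilon> * (E * (D * ?w))"
          using C(1) e(1) by (intro mult_left_mono 3) auto
        finally show ?thesis by (simp add: mult_ac)
      qed
      then have "norm (u s - v s) \<le> 2 * (C * \<epsilon> * E * D / \<mu>) * exp (\<mu> * \<bar>s\<bar>)"
        by (rule diff_bound)
      also have "2 * (C * \<epsilon> * E * D / \<mu>) = (C * \<epsilon> * E / \<mu>) * (2 * D)" by simp
      also have "\<dots> \<le> (1/4) * (2 * D)" using small D0 by (intro mult_right_mono) auto
      finally show ?thesis by simp
    qed
    \<comment> \<open>The halving needs a first finite constant. The angles are not known to stay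
      close, but the perturbations are bounded, and integrating against the weight supplies
      one.\<close>
    have "norm (du s - dv s) \<le> (2 * C) * exp (\<mu> * \<bar>s\<bar>)" for s
    proof -
      have "norm (du s) \<le> C * \<epsilon>" "norm (dv s) \<le> C * \<epsilon>"
        unfolding du_def dv_def by (rule C(2)[OF e(1) e1 ub ub], rule C(2)[OF e(1) e1 vb vb])
      moreover have "C * \<epsilon> \<le> C * 1" using C(1) e1 by (intro mult_left_mono) auto
      ultimately have "norm (du s - dv s) \<le> 2 * C * 1"
        using norm_triangle_ineq4[of "du s" "dv s"] by linarith
      also have "\<dots> \<le> 2 * C * exp (\<mu> * \<bar>s\<bar>)" using C(1) \<mu>(1) by (intro mult_left_mono) auto
      finally show ?thesis .
    qed
    then have start: "norm (u s - v s) \<le> 2 * (2 * C / \<mu>) * exp (\<mu> * \<bar>s\<bar>)" for s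
      by (rule diff_bound)
    have iter: "norm (u s - v s) \<le> 2 * (2 * C / \<mu>) * (1/2) ^ n * exp (\<mu> * \<bar>s\<bar>)" for n s
    proof (induction n arbitrary: s)
      case (Suc n)
      then have "norm (u s - v s) \<le> 2 * (2 * C / \<mu>) * (1/2) ^ n / 2 * exp (\<mu> * \<bar>s\<bar>)" by (rule halve)
      then show ?case by simp
    qed (use start in simp)
    have "(\<lambda>n. 2 * (2 * C / \<mu>) * (1/2) ^ n * exp (\<mu> * \<bar>t\<bar>)) \<longlonglongrightarrow> 2 * (2 * C / \<mu>) * 0 * exp (\<mu> * \<bar>t\<bar>)"
      by (intro tendsto_mult tendsto_const LIMSEQ_power_zero) simp
    then have "norm (u t - v t) \<le> 2 * (2 * C / \<mu>) * 0 * exp (\<mu> * \<bar>t\<bar>)"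
      by (rule LIMSEQ_le_const) (intro exI allI impI iter)
    then show ?thesis by simp
  qed
  then show ?thesis using that \<delta> by blast
qed

end

section \<open>The invariant curve\<close>

lemma times_diff_Lipschitz_has_vector_derivative:
  assumes "times_diff_Lipschitz L W" "L > 0"
  shows "(W has_vector_derivative vderiv W t) (at t)"
proof -
  have "(vderiv ^^ 0) W differentiable (at t)"
    using assms unfolding times_diff_Lipschitz_def by blast
  then show ?thesis by (simp add: vderiv_def vector_derivative_works)
qed

lemma circle_lift_nat:
  assumes "circle_lift W"
  shows "W (\<theta> + real n) = W \<theta> + (real n, 0)"
proof (induction n)
  case (Suc n)
  have "W (\<theta> + real n + 1) = W (\<theta> + real n) + (1, 0)"
    using assms unfolding circle_lift_def by blast
  moreover have "\<theta> + real (Suc n) = \<theta> + real n + 1" by simp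
  ultimately show ?case unfolding Suc by (simp only: add.assoc add_Pair) simp
qed (simp flip: zero_prod_def)

text \<open>A lift of degree one moves its angle by exactly n over n turns, so the intermediate
  value theorem reaches every angle.\<close>

lemma circle_lift_surj:
  assumes W: "circle_lift W" and cont: "continuous_on UNIV W"
  obtains \<theta> where "fst (W \<theta>) = y"
proof -
  obtain n :: nat where n: "\<bar>y\<bar> + \<bar>fst (W 0)\<bar> \<le> real n" using real_arch_simple by blast
  have hi: "fst (W (real n)) = fst (W 0) + real n"
    using circle_lift_nat[OF W, of 0 n] by simp
  have lo: "fst (W (- real n)) = fst (W 0) - real n"
    using circle_lift_nat[OF W, of "- real n" n] by simp
  have "continuous_on {- real n..real n} (\<lambda>t. fst (W t))"
    by (intro continuous_intros continuous_on_subset[OF cont]) simp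
  then have "\<exists>x\<ge>- real n. x \<le> real n \<and> fst (W x) = y"
    by (intro IVT') (use n hi lo in auto)
  then show ?thesis using that by blast
qed

text \<open>A real \<open>SUP\<close> controls the values only when the range is bounded above, so
  boundedness is derived first, from continuity on one period.\<close>

lemma circle_lift_SUP_less:
  assumes W: "circle_lift W" and cont: "continuous_on UNIV W"
    and sup: "(SUP \<theta>. \<bar>snd (W \<theta>)\<bar>) < c"
  shows "\<bar>snd (W \<theta>)\<bar> < c"
proof -
  have per: "snd (W (fst u + 1)) = snd (W (fst u))" for u :: "real \<times> real"
    using W by (simp add: circle_lift_def)
  \<comment> \<open>A function of the angle alone is regarded as a function on the degenerate band c
    = 0, so that \<open>periodic_frac\<close> applies.\<close>
  have eq: "snd (W (frac \<theta>)) = snd (W \<theta>)" for \<theta>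
    using periodic_frac[where f = "\<lambda>u. snd (W (fst u))" and c = 0 and u = "(\<theta>, 0)"] per by simp
  have "compact ((\<lambda>\<theta>. \<bar>snd (W \<theta>)\<bar>) ` {0..1})"
    by (intro compact_continuous_image continuous_intros continuous_on_subset[OF cont]) auto
  then have "bdd_above ((\<lambda>\<theta>. \<bar>snd (W \<theta>)\<bar>) ` {0..1})"
    by (intro bounded_imp_bdd_above compact_imp_bounded)
  then obtain B where "\<forall>x\<in>(\<lambda>\<theta>. \<bar>snd (W \<theta>)\<bar>) ` {0..1}. x \<le> B"
    unfolding bdd_above_def ..
  then have B: "\<bar>snd (W \<theta>)\<bar> \<le> B" if "\<theta> \<in> {0..1}" for \<theta>
    using that by simp
  have "\<bar>snd (W \<theta>)\<bar> \<le> B" for \<theta>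
    using B[of "frac \<theta>"] eq[of \<theta>] frac_lt_1[of \<theta>] by simp
  then have "bdd_above (range (\<lambda>\<theta>. \<bar>snd (W \<theta>)\<bar>))" by (auto simp: bdd_above_def)
  then show ?thesis using cSUP_lessD[OF _ sup] by simp
qed

section \<open>From the invariance equation to closed orbits\<close>

context delay_perturbation
begin

text \<open>The outer factor cancels the division in \<open>P_fun\<close>; at \<epsilon> = 0 both
  sides vanish.\<close>

lemma scaled_Y_eq_H:
  assumes "\<bar>snd u\<bar> \<le> 1"
  shows "\<epsilon> *\<^sub>R Y_fun X K u v \<epsilon> = H \<epsilon> u v"
proof (cases "\<epsilon> = 0")
  case True
  then show ?thesis using linear_0[OF J_linear[OF assms]] by (simp add: H_def F_def)
next
  case False
  have "Y_fun X K u v \<epsilon> = J u ((1 / \<epsilon>) *\<^sub>R F \<epsilon> (K u) (K v))"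
    using False by (simp add: Y_fun_def J_def P_fun_def F_def)
  also have "\<dots> = (1 / \<epsilon>) *\<^sub>R H \<epsilon> u v"
    unfolding H_def by (rule linear_scale[OF J_linear[OF assms]])
  finally show ?thesis using False by simp
qed

lemma invariance_eq_of_cut:
  assumes W: "invariance_eq_cut X r K \<phi> \<omega>\<^sub>0 lam\<^sub>0 \<epsilon> \<omega> W"
    and \<phi>: "\<And>x. \<bar>x\<bar> \<le> 1/2 \<Longrightarrow> \<phi> x = 1" and small: "\<And>\<theta>. \<bar>snd (W \<theta>)\<bar> < 1/2"
  shows "invariance_eq X r K \<omega>\<^sub>0 lam\<^sub>0 \<epsilon> \<omega> W"
proof -
  have one: "\<phi> (snd (W \<theta>)) = 1" "\<not> \<bar>snd (W \<theta>)\<bar> > 1" for \<theta>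
    using \<phi>[of "snd (W \<theta>)"] small[of \<theta>] by auto
  have rho: "rho_cut r K \<phi> (W \<theta>) = r (K (W \<theta>))" for \<theta>
    using one[of \<theta>] by (simp add: rho_cut_def)
  have "Y_cut X K \<phi> (W a) (W b) \<epsilon> = Y_fun X K (W a) (W b) \<epsilon>" for a b
    using one[of a] one[of b] by (simp add: Y_cut_def)
  then show ?thesis using W unfolding invariance_eq_def invariance_eq_cut_def rho by simp
qed

text \<open>Along \<theta> + \<nu> t a time delay of length r is a parameter shift by \<nu> r, which
  is exactly the shifted argument in the invariance equation.\<close>

lemma invariance_lifted:
  assumes der: "\<And>\<theta>. (V has_vector_derivative vderiv V \<theta>) (at \<theta>)"
    and small: "\<And>\<theta>. \<bar>snd (V \<theta>)\<bar> < 1/2"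
    and inv: "invariance_eq X r K \<omega>\<^sub>0 lam\<^sub>0 \<epsilon> \<nu> V"
  shows "lifted \<epsilon> (\<lambda>t. V (\<theta> + \<nu> * t))"
  unfolding lifted_def
proof (intro conjI allI)
  show "V (\<theta> + \<nu> * t) \<in> band (1/2)" for t using small[of "\<theta> + \<nu> * t"] by simp
  fix t
  let ?\<theta> = "\<theta> + \<nu> * t"
  have "((\<lambda>t. \<theta> + \<nu> * t) has_vector_derivative \<nu>) (at t)"
    by (auto intro!: derivative_eq_intros simp flip: has_real_derivative_iff_has_vector_derivative)
  from vector_diff_chain_at[OF this der]
  have "((\<lambda>t. V (\<theta> + \<nu> * t)) has_vector_derivative \<nu> *\<^sub>R vderiv V ?\<theta>) (at t)"
    by (simp add: o_def)
  moreover have "\<nu> *\<^sub>R vderiv V ?\<theta> = (\<omega>\<^sub>0, lam\<^sub>0 * snd (V ?\<theta>)) + H \<epsilon> (V ?\<theta>) (V (?\<theta> - \<nu> * r (K (V ?\<theta>))))"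
  proof -
    have "\<bar>snd (V ?\<theta>)\<bar> \<le> 1" using small[of ?\<theta>] by linarith
    then show ?thesis
      using inv scaled_Y_eq_H unfolding invariance_eq_def by (metis add.commute diff_eq_eq)
  qed
  moreover have "?\<theta> - \<nu> * r (K (V ?\<theta>)) = \<theta> + \<nu> * (t - r (K (V ?\<theta>)))"
    by (simp add: algebra_simps)
  ultimately show "((\<lambda>t. V (\<theta> + \<nu> * t)) has_vector_derivative (\<omega>\<^sub>0, lam\<^sub>0 * snd (V ?\<theta>)) +
      H \<epsilon> (V ?\<theta>) (V (\<theta> + \<nu> * (t - r (K (V ?\<theta>)))))) (at t)"
    by simp
qed

text \<open>What the equations with and without cut-off have in common, so that everything below is
  proved once for both. The quantifier over \<theta> provides the phase shifts used in the isolation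
  argument.\<close>

definition invariant_curve :: "real \<Rightarrow> real \<Rightarrow> (real \<Rightarrow> real \<times> real) \<Rightarrow> bool" where
  "invariant_curve \<epsilon> \<nu> V \<longleftrightarrow> \<nu> > 0 \<and> circle_lift V \<and> continuous_on UNIV V \<and>
     (\<forall>\<theta>. lifted \<epsilon> (\<lambda>t. V (\<theta> + \<nu> * t)))"

lemma invariant_curve_dde:
  "invariant_curve \<epsilon> \<nu> V \<Longrightarrow> dde_solution X r \<epsilon> (\<lambda>t. K (V (\<theta> + \<nu> * t)))"
  by (rule lifted_dde) (simp add: invariant_curve_def)

lemma invariant_curve_closed_orbit:
  assumes "invariant_curve \<epsilon> \<nu> V"
  shows "closed_orbit (dde_solution X r \<epsilon>) (range (\<lambda>\<theta>. K (V \<theta>)))"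
  unfolding closed_orbit_def
proof (rule exI[of _ "\<lambda>t. K (V (\<nu> * t))"], rule exI[of _ "1 / \<nu>"], intro conjI allI)
  let ?u = "\<lambda>t. V (\<nu> * t)"
  have \<nu>: "\<nu> > 0" and V: "circle_lift V" using assms by (auto simp: invariant_curve_def)
  have "lifted \<epsilon> (\<lambda>t. V (0 + \<nu> * t))" using assms unfolding invariant_curve_def by blast
  then have lift: "lifted \<epsilon> ?u" by simp
  show "dde_solution X r \<epsilon> (\<lambda>t. K (?u t))" by (rule lifted_dde[OF lift])
  show "1 / \<nu> > 0" using \<nu> by simp
  show "K (V (\<nu> * (t + 1 / \<nu>))) = K (V (\<nu> * t))" for t
  proof -
    have "\<nu> * (t + 1 / \<nu>) = \<nu> * t + 1" using \<nu> by (simp add: algebra_simps)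
    moreover have "V (\<nu> * t + 1) = V (\<nu> * t) + (1, 0)" using V by (simp add: circle_lift_def)
    moreover have "\<bar>snd (V (\<nu> * t))\<bar> \<le> 1" using lifted_band[OF lift, of t] by simp
    ultimately show ?thesis using K_shift by simp
  qed
  \<comment> \<open>As \<open>K\<close> may fail to be injective, different values of V do not
    suffice. A constant image would force the velocity of V to vanish, because \<open>DK\<close> is
    injective, whereas V gains (1, 0) over one period.\<close>
  show "\<exists>s t. K (?u s) \<noteq> K (?u t)"
  proof (rule ccontr)
    assume "\<nexists>s t. K (?u s) \<noteq> K (?u t)"
    then have const: "(\<lambda>t. K (?u t)) = (\<lambda>t. K (?u 0))" by blast
    have "(?u has_vector_derivative 0) (at t)" for t
    proof -
      let ?d = "(\<omega>\<^sub>0, lam\<^sub>0 * snd (?u t)) + H \<epsilon> (?u t) (?u (t - r (K (?u t))))"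
      have b: "\<bar>snd (?u t)\<bar> \<le> 1" using lifted_band[OF lift, of t] by simp
      have "((\<lambda>t. K (?u t)) has_vector_derivative DK (?u t) ?d) (at t)"
        by (rule K_chain[OF b lifted_derivative[OF lift]])
      moreover have "((\<lambda>t. K (?u t)) has_vector_derivative 0) (at t)"
        unfolding const by simp
      ultimately have "DK (?u t) ?d = 0" by (rule vector_derivative_unique_at)
      then have "?d = 0" using J_DK[OF b, of ?d] linear_0[OF J_linear[OF b]] by simp
      then show ?thesis using lifted_derivative[OF lift, of t] by simp
    qed
    then obtain c where "?u t = c" for t
      using has_vector_derivative_zero_constant[OF convex_UNIV, of ?u] by auto
    then have "V (\<nu> * 0) = V (\<nu> * (1 / \<nu>))" by metis
    then have "V 1 = V 0" using \<nu> by simp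
    moreover have "V (0 + 1) = V 0 + (1, 0)" using V unfolding circle_lift_def by blast
    ultimately show False by (simp add: prod_eq_iff)
  qed
  show "range (\<lambda>\<theta>. K (V \<theta>)) = range (\<lambda>t. K (?u t))"
  proof (intro equalityI image_subsetI)
    fix \<theta>
    have "K (V \<theta>) = K (V (\<nu> * (\<theta> / \<nu>)))" using \<nu> by simp
    then show "K (V \<theta>) \<in> range (\<lambda>t. K (V (\<nu> * t)))" by (rule image_eqI) simp
  qed auto
qed

text \<open>A closed orbit inside a thin tube lifts to the strip, where it solves the same equation as the
  invariant curve; after a phase shift \<open>lifted_unique\<close> identifies the two.\<close>

lemma invariant_curve_isolated:
  obtains \<delta> \<sigma> where "\<delta> > 0" "open (tube \<sigma>)"
    "\<And>\<epsilon> \<nu> V. 0 \<le> \<epsilon> \<Longrightarrow> \<epsilon> < \<delta> \<Longrightarrow> invariant_curve \<epsilon> \<nu> V \<Longrightarrow>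
      range (\<lambda>\<theta>. K (V \<theta>)) \<subseteq> tube \<sigma> \<and>
      (\<forall>\<Gamma>. closed_orbit (dde_solution X r \<epsilon>) \<Gamma> \<and> \<Gamma> \<subseteq> tube \<sigma> \<longrightarrow> \<Gamma> = range (\<lambda>\<theta>. K (V \<theta>)))"
proof -
  obtain \<delta>1 where \<delta>1: "\<delta>1 > 0" "\<And>\<epsilon> u v t. 0 \<le> \<epsilon> \<Longrightarrow> \<epsilon> < \<delta>1 \<Longrightarrow> lifted \<epsilon> u \<Longrightarrow> lifted \<epsilon> v \<Longrightarrow>
      fst (u 0) = fst (v 0) \<Longrightarrow> u t = v t"
    using lifted_unique by blast
  obtain C where C: "C > 0" "\<And>\<epsilon> u t. 0 \<le> \<epsilon> \<Longrightarrow> \<epsilon> \<le> 1 \<Longrightarrow> lifted \<epsilon> u \<Longrightarrow> \<bar>snd (u t)\<bar> \<le> C * \<epsilon>"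
    using lifted_snd_small by blast
  obtain \<sigma> where \<sigma>: "\<sigma> > 0" "\<sigma> \<le> 1/4" "\<And>w. w \<in> band (1/2) \<Longrightarrow> K w \<in> tube \<sigma> \<Longrightarrow> w \<in> band (1/4)"
    using K_fibre_narrow by blast
  \<comment> \<open>The three bounds give uniqueness of lifted solutions, validity of the radial
    estimate, and C \<epsilon> < \<sigma>, so that the invariant curve itself lies in the
    tube.\<close>
  define \<delta> where "\<delta> = min \<delta>1 (min 1 (\<sigma> / C))"
  show ?thesis
  proof (rule that)
    show "\<delta> > 0" using \<delta>1(1) C(1) \<sigma>(1) by (simp add: \<delta>_def)
    show "open (tube \<sigma>)" by (rule open_tube) (use \<sigma> in simp)
    fix \<epsilon> \<nu> :: real and V
    assume e: "0 \<le> \<epsilon>" "\<epsilon> < \<delta>" and inv: "invariant_curve \<epsilon> \<nu> V"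
    have \<nu>: "\<nu> > 0" and V: "circle_lift V" and cont: "continuous_on UNIV V"
      and lift: "lifted \<epsilon> (\<lambda>t. V (\<theta> + \<nu> * t))" for \<theta>
      using inv by (auto simp: invariant_curve_def)
    have e1: "\<epsilon> < \<delta>1" "\<epsilon> \<le> 1" "\<epsilon> < \<sigma> / C" using e by (auto simp: \<delta>_def)
    have "\<bar>snd (V \<theta>)\<bar> < \<sigma>" for \<theta>
    proof -
      have "\<bar>snd (V (\<theta> + \<nu> * 0))\<bar> \<le> C * \<epsilon>" by (rule C(2)[OF e(1) e1(2) lift])
      also have "C * \<epsilon> < \<sigma>" using e1(3) C(1) by (simp add: pos_less_divide_eq mult.commute)
      finally show ?thesis by simp
    qed
    then have "range (\<lambda>\<theta>. K (V \<theta>)) \<subseteq> tube \<sigma>" by (auto simp: tube_def)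
    moreover have "\<Gamma> = range (\<lambda>\<theta>. K (V \<theta>))"
      if orb: "closed_orbit (dde_solution X r \<epsilon>) \<Gamma>" and sub: "\<Gamma> \<subseteq> tube \<sigma>" for \<Gamma>
    proof -
      obtain x where x: "dde_solution X r \<epsilon> x" "\<Gamma> = range x"
        using orb unfolding closed_orbit_def by blast
      have "(x has_vector_derivative X (x t, \<epsilon> *\<^sub>R x (t - r (x t)))) (at t)" for t
        using x(1) unfolding dde_solution_def by blast
      then have "continuous_on UNIV x"
        by (intro continuous_at_imp_continuous_on ballI has_vector_derivative_continuous)
      then obtain u where u: "continuous_on UNIV u" "\<And>t. u t \<in> band (1/4)" "\<And>t. K (u t) = x t"
        using K_lift[OF \<sigma>, of x] x(2) sub by blast
      have "lifted \<epsilon> u"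
      proof (rule dde_lifted[OF u(1)])
        show "u t \<in> band (1/2)" for t using u(2)[of t] by simp
        show "dde_solution X r \<epsilon> (\<lambda>t. K (u t))" using x(1) by (simp add: u(3))
      qed
      moreover obtain \<theta> where "fst (V \<theta>) = fst (u 0)" using circle_lift_surj[OF V cont] .
      ultimately have eq: "u t = V (\<theta> + \<nu> * t)" for t
        using \<delta>1(2)[OF e(1) e1(1) _ lift[of \<theta>], of u t] by simp
      have "range x = range (\<lambda>\<theta>. K (V \<theta>))"
      proof (intro equalityI image_subsetI)
        show "x t \<in> range (\<lambda>\<theta>. K (V \<theta>))" for t
          using u(3)[of t] eq[of t] by (metis rangeI)
        fix \<theta>'
        have "K (V \<theta>') = x ((\<theta>' - \<theta>) / \<nu>)"
          using u(3)[of "(\<theta>' - \<theta>) / \<nu>"] eq[of "(\<theta>' - \<theta>) / \<nu>"] \<nu> by simp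
        then show "K (V \<theta>') \<in> range x" by simp
      qed
      then show ?thesis using x(2) by simp
    qed
    ultimately show "range (\<lambda>\<theta>. K (V \<theta>)) \<subseteq> tube \<sigma> \<and>
      (\<forall>\<Gamma>. closed_orbit (dde_solution X r \<epsilon>) \<Gamma> \<and> \<Gamma> \<subseteq> tube \<sigma> \<longrightarrow> \<Gamma> = range (\<lambda>\<theta>. K (V \<theta>)))"
      by blast
  qed
qed

text \<open>A point of the curve is compared with the central point at the same angle, at a distance
  controlled by the radial component. Since every angle occurs on the curve, the same comparison
  serves both directions.\<close>

lemma invariant_curve_Hausdorff_close:
  assumes \<eta>: "\<eta> > 0"
  obtains \<delta> where "\<delta> > 0"
    "\<And>\<epsilon> \<nu> V. 0 \<le> \<epsilon> \<Longrightarrow> \<epsilon> < \<delta> \<Longrightarrow> invariant_curve \<epsilon> \<nu> V \<Longrightarrow>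
      Hausdorff_close \<eta> (range (\<lambda>\<theta>. K (V \<theta>))) (range (\<lambda>\<theta>. K (\<theta>, 0)))"
proof -
  obtain C where C: "C > 0" "\<And>\<epsilon> u t. 0 \<le> \<epsilon> \<Longrightarrow> \<epsilon> \<le> 1 \<Longrightarrow> lifted \<epsilon> u \<Longrightarrow> \<bar>snd (u t)\<bar> \<le> C * \<epsilon>"
    using lifted_snd_small by blast
  obtain L where L: "L-lipschitz_on (band (1/2)) K" using K_lipschitz .
  have L0: "L \<ge> 0" using L by (rule lipschitz_on_nonneg)
  define \<delta> where "\<delta> = min 1 (\<eta> / (C * (L + 1)))"
  show ?thesis
  proof (rule that)
    show "\<delta> > 0" using \<eta> C(1) L0 by (simp add: \<delta>_def)
    fix \<epsilon> \<nu> :: real and V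
    assume e: "0 \<le> \<epsilon>" "\<epsilon> < \<delta>" and inv: "invariant_curve \<epsilon> \<nu> V"
    have V: "circle_lift V" and cont: "continuous_on UNIV V"
      and lift: "lifted \<epsilon> (\<lambda>t. V (\<theta> + \<nu> * t))" for \<theta>
      using inv by (auto simp: invariant_curve_def)
    have e1: "\<epsilon> \<le> 1" "\<epsilon> < \<eta> / (C * (L + 1))" using e by (auto simp: \<delta>_def)
    have near: "dist (K (V \<theta>)) (K (fst (V \<theta>), 0)) < \<eta>" for \<theta>
    proof -
      have "V \<theta> \<in> band (1/2)" using lifted_band[OF lift[of \<theta>], of 0] by simp
      then have "dist (K (V \<theta>)) (K (fst (V \<theta>), 0)) \<le> L * dist (V \<theta>) (fst (V \<theta>), 0)"
        by (intro lipschitz_onD[OF L]) auto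
      also have "dist (V \<theta>) (fst (V \<theta>), 0) = \<bar>snd (V \<theta>)\<bar>"
        by (cases "V \<theta>") (simp add: dist_Pair_Pair dist_real_def)
      also have "\<bar>snd (V \<theta>)\<bar> \<le> C * \<epsilon>" using C(2)[OF e(1) e1(1) lift[of \<theta>], of 0] by simp
      then have "L * \<bar>snd (V \<theta>)\<bar> \<le> L * (C * \<epsilon>)" using L0 by (rule mult_left_mono)
      also have "\<dots> \<le> \<epsilon> * (C * (L + 1))" using C(1) e(1) by (simp add: algebra_simps)
      also have "\<dots> < \<eta>" using e1(2) C(1) L0 by (simp add: pos_less_divide_eq)
      finally show ?thesis .
    qed
    show "Hausdorff_close \<eta> (range (\<lambda>\<theta>. K (V \<theta>))) (range (\<lambda>\<theta>. K (\<theta>, 0)))"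
      unfolding Hausdorff_close_def
    proof (intro conjI ballI)
      fix a assume "a \<in> range (\<lambda>\<theta>. K (V \<theta>))"
      then obtain \<theta> where a: "a = K (V \<theta>)" by blast
      have "infdist a (range (\<lambda>\<theta>. K (\<theta>, 0))) \<le> dist a (K (fst (V \<theta>), 0))"
        by (rule infdist_le) simp
      then show "infdist a (range (\<lambda>\<theta>. K (\<theta>, 0))) < \<eta>" using near[of \<theta>] a by simp
    next
      fix b assume "b \<in> range (\<lambda>\<theta>. K (\<theta>, 0))"
      then obtain \<theta>' where b: "b = K (\<theta>', 0)" by blast
      obtain \<theta> where "fst (V \<theta>) = \<theta>'" using circle_lift_surj[OF V cont] .
      moreover have "infdist b (range (\<lambda>\<theta>. K (V \<theta>))) \<le> dist b (K (V \<theta>))"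
        by (rule infdist_le) simp
      ultimately show "infdist b (range (\<lambda>\<theta>. K (V \<theta>))) < \<eta>"
        using near[of \<theta>] b by (simp add: dist_commute)
    qed
  qed
qed

end

theorem corollary15:
  fixes X :: "(real^2) \<times> (real^2) \<Rightarrow> real^2"
    and r :: "real^2 \<Rightarrow> real"
    and K :: "real \<times> real \<Rightarrow> real^2"
    and \<phi> :: "real \<Rightarrow> real"
    and h \<omega>\<^sub>0 lam\<^sub>0 \<epsilon>\<^sub>0 :: real
    and L :: nat
    and \<omega> :: "real \<Rightarrow> real"
    and W :: "real \<Rightarrow> real \<Rightarrow> real \<times> real"
  assumes X: "real_analytic_on X UNIV"
    and r: "C1_map r" "\<And>x. 0 \<le> r x \<and> r x \<le> h"
    and \<omega>\<^sub>0: "\<omega>\<^sub>0 > 0" and lam\<^sub>0: "lam\<^sub>0 < 0"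
    and K_analytic: "real_analytic_on K strip"
    and K_diffeo: "local_diffeo_on K strip"
    and K_periodic: "\<And>\<theta> s. s \<in> {-1..1} \<Longrightarrow> K (\<theta> + 1, s) = K (\<theta>, s)"
    and K_eq: "\<And>\<theta> s. s \<in> {-1..1} \<Longrightarrow>
        X (K (\<theta>, s), 0) = frechet_derivative K (at (\<theta>, s)) (\<omega>\<^sub>0, lam\<^sub>0 * s)"
    and cycle: "limit_cycle (ode_solution (\<lambda>x. X (x, 0))) (range (\<lambda>\<theta>. K (\<theta>, 0)))"
      "ode_stable_set (\<lambda>x. X (x, 0)) (range (\<lambda>\<theta>. K (\<theta>, 0)))"
    and \<phi>_smooth: "smooth_real \<phi>"
    and \<phi>_range: "\<And>x. 0 \<le> \<phi> x \<and> \<phi> x \<le> 1"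
    and \<phi>_one: "\<And>x. \<bar>x\<bar> \<le> 1/2 \<Longrightarrow> \<phi> x = 1"
    and \<phi>_zero: "\<And>x. \<bar>x\<bar> > 1 \<Longrightarrow> \<phi> x = 0"
    and L: "L > 0" and \<epsilon>\<^sub>0: "\<epsilon>\<^sub>0 > 0"
    and W: "\<And>\<epsilon>. 0 \<le> \<epsilon> \<Longrightarrow> \<epsilon> < \<epsilon>\<^sub>0 \<Longrightarrow>
        \<omega> \<epsilon> > 0 \<and> circle_lift (W \<epsilon>) \<and> times_diff_Lipschitz L (W \<epsilon>) \<and>
        invariance_eq_cut X r K \<phi> \<omega>\<^sub>0 lam\<^sub>0 \<epsilon> (\<omega> \<epsilon>) (W \<epsilon>)"
  shows
    "(\<forall>\<epsilon>. 0 \<le> \<epsilon> \<and> \<epsilon> < \<epsilon>\<^sub>0 \<and> (SUP \<theta>. \<bar>snd (W \<epsilon> \<theta>)\<bar>) < 1/2 \<longrightarrow>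
        (\<forall>\<theta>. dde_solution X r \<epsilon> (\<lambda>t. K (W \<epsilon> (\<theta> + \<omega> \<epsilon> * t)))) \<and>
        closed_orbit (dde_solution X r \<epsilon>) (range (\<lambda>\<theta>. K (W \<epsilon> \<theta>)))) \<and>
     (\<forall>\<eta>>0. \<exists>\<delta>>0. \<forall>\<epsilon>. 0 \<le> \<epsilon> \<and> \<epsilon> < \<epsilon>\<^sub>0 \<and> \<epsilon> < \<delta> \<and> (SUP \<theta>. \<bar>snd (W \<epsilon> \<theta>)\<bar>) < 1/2 \<longrightarrow>
        limit_cycle (dde_solution X r \<epsilon>) (range (\<lambda>\<theta>. K (W \<epsilon> \<theta>))) \<and>
        Hausdorff_close \<eta> (range (\<lambda>\<theta>. K (W \<epsilon> \<theta>))) (range (\<lambda>\<theta>. K (\<theta>, 0)))) \<and>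
     (\<forall>\<epsilon> \<nu> V. 0 \<le> \<epsilon> \<and> \<epsilon> < \<epsilon>\<^sub>0 \<and> \<nu> > 0 \<and> circle_lift V \<and> times_diff_Lipschitz L V \<and>
        (SUP \<theta>. \<bar>snd (V \<theta>)\<bar>) < 1/2 \<and> invariance_eq X r K \<omega>\<^sub>0 lam\<^sub>0 \<epsilon> \<nu> V \<longrightarrow>
        (\<forall>\<theta>. dde_solution X r \<epsilon> (\<lambda>t. K (V (\<theta> + \<nu> * t)))) \<and>
        closed_orbit (dde_solution X r \<epsilon>) (range (\<lambda>\<theta>. K (V \<theta>))))"
proof -
  interpret delay_perturbation X r K h \<omega>\<^sub>0 lam\<^sub>0
    by unfold_locales (use X r \<omega>\<^sub>0 lam\<^sub>0 K_analytic K_diffeo K_periodic K_eq in auto)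
  \<comment> \<open>The disjunction treats the given family, which solves the equation with
    cut-offs, together with an arbitrary solution of the equation without them.\<close>
  have curve: "invariant_curve \<epsilon> \<nu> V"
    if "\<nu> > 0" and V: "circle_lift V" "times_diff_Lipschitz L V" "(SUP \<theta>. \<bar>snd (V \<theta>)\<bar>) < 1/2"
      and inv: "invariance_eq X r K \<omega>\<^sub>0 lam\<^sub>0 \<epsilon> \<nu> V \<or> invariance_eq_cut X r K \<phi> \<omega>\<^sub>0 lam\<^sub>0 \<epsilon> \<nu> V" for \<epsilon> \<nu> V
  proof -
    note der = times_diff_Lipschitz_has_vector_derivative[OF V(2) L]
    have cont: "continuous_on UNIV V"
      by (intro continuous_at_imp_continuous_on ballI has_vector_derivative_continuous[OF der])
    have small: "\<bar>snd (V \<theta>)\<bar> < 1/2" for \<theta>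
      by (rule circle_lift_SUP_less[OF V(1) cont V(3)])
    have "invariance_eq X r K \<omega>\<^sub>0 lam\<^sub>0 \<epsilon> \<nu> V"
      using inv
    proof
      assume "invariance_eq_cut X r K \<phi> \<omega>\<^sub>0 lam\<^sub>0 \<epsilon> \<nu> V"
      then show ?thesis by (rule invariance_eq_of_cut) (rule \<phi>_one, assumption, rule small)
    qed
    then show ?thesis
      using that(1) V(1) cont invariance_lifted[OF der small] unfolding invariant_curve_def by blast
  qed
  have curve_W: "invariant_curve \<epsilon> (\<omega> \<epsilon>) (W \<epsilon>)"
    if "0 \<le> \<epsilon>" "\<epsilon> < \<epsilon>\<^sub>0" "(SUP \<theta>. \<bar>snd (W \<epsilon> \<theta>)\<bar>) < 1/2" for \<epsilon>
    using curve[of "\<omega> \<epsilon>" "W \<epsilon>" \<epsilon>] W[OF that(1,2)] that(3) by blast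
  have near: "\<exists>\<delta>>0. \<forall>\<epsilon>. 0 \<le> \<epsilon> \<and> \<epsilon> < \<epsilon>\<^sub>0 \<and> \<epsilon> < \<delta> \<and> (SUP \<theta>. \<bar>snd (W \<epsilon> \<theta>)\<bar>) < 1/2 \<longrightarrow>
      limit_cycle (dde_solution X r \<epsilon>) (range (\<lambda>\<theta>. K (W \<epsilon> \<theta>))) \<and>
      Hausdorff_close \<eta> (range (\<lambda>\<theta>. K (W \<epsilon> \<theta>))) (range (\<lambda>\<theta>. K (\<theta>, 0)))"
    if \<eta>: "\<eta> > 0" for \<eta>
  proof -
    obtain \<delta>1 \<sigma> where \<delta>1: "\<delta>1 > 0" "open (tube \<sigma>)" and isolated:
      "\<And>\<epsilon> \<nu> V. 0 \<le> \<epsilon> \<Longrightarrow> \<epsilon> < \<delta>1 \<Longrightarrow> invariant_curve \<epsilon> \<nu> V \<Longrightarrow>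
        range (\<lambda>\<theta>. K (V \<theta>)) \<subseteq> tube \<sigma> \<and>
        (\<forall>\<Gamma>. closed_orbit (dde_solution X r \<epsilon>) \<Gamma> \<and> \<Gamma> \<subseteq> tube \<sigma> \<longrightarrow> \<Gamma> = range (\<lambda>\<theta>. K (V \<theta>)))"
      using invariant_curve_isolated by blast
    obtain \<delta>2 where \<delta>2: "\<delta>2 > 0" and close:
      "\<And>\<epsilon> \<nu> V. 0 \<le> \<epsilon> \<Longrightarrow> \<epsilon> < \<delta>2 \<Longrightarrow> invariant_curve \<epsilon> \<nu> V \<Longrightarrow>
        Hausdorff_close \<eta> (range (\<lambda>\<theta>. K (V \<theta>))) (range (\<lambda>\<theta>. K (\<theta>, 0)))"
      using invariant_curve_Hausdorff_close[OF \<eta>] by blast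
    have "limit_cycle (dde_solution X r \<epsilon>) (range (\<lambda>\<theta>. K (W \<epsilon> \<theta>))) \<and>
        Hausdorff_close \<eta> (range (\<lambda>\<theta>. K (W \<epsilon> \<theta>))) (range (\<lambda>\<theta>. K (\<theta>, 0)))"
      if "0 \<le> \<epsilon>" "\<epsilon> < \<epsilon>\<^sub>0" "\<epsilon> < min \<delta>1 \<delta>2" "(SUP \<theta>. \<bar>snd (W \<epsilon> \<theta>)\<bar>) < 1/2" for \<epsilon>
    proof -
      have e: "\<epsilon> < \<delta>1" "\<epsilon> < \<delta>2" using that(3) by auto
      have c: "invariant_curve \<epsilon> (\<omega> \<epsilon>) (W \<epsilon>)" by (rule curve_W[OF that(1,2,4)])
      show ?thesis
        unfolding limit_cycle_def
        using invariant_curve_closed_orbit[OF c] isolated[OF that(1) e(1) c] close[OF that(1) e(2) c] \<delta>1(2)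
        by blast
    qed
    moreover have "min \<delta>1 \<delta>2 > 0" using \<delta>1(1) \<delta>2 by simp
    ultimately show ?thesis by blast
  qed
  have V_orbit: "(\<forall>\<theta>. dde_solution X r \<epsilon> (\<lambda>t. K (V (\<theta> + \<nu> * t)))) \<and>
      closed_orbit (dde_solution X r \<epsilon>) (range (\<lambda>\<theta>. K (V \<theta>)))"
    if "invariant_curve \<epsilon> \<nu> V" for \<epsilon> \<nu> V
    using invariant_curve_dde[OF that] invariant_curve_closed_orbit[OF that] by blast
  show ?thesis
    using V_orbit curve_W near curve by (intro conjI allI impI) blast+
qed

end
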